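(* Let $(\varphi_{ij})_{i,j\ge1}$ be a matrix with complex entries and let $M_\varphi\colon(x_{ij})\mapsto(\varphi_{ij}x_{ij})$ be the associated Schur multiplier. The following assertions are equivalent: (i) $M_\varphi$ is completely bounded from $K$ to $S_1$. (i)$'$ $M_\varphi$ is completely bounded from $B$ to $S_1$. (ii) There are $x,y\in\ell_2$ and a constant $C$ such that $|\varphi_{ij}|\le C|x_i|\,|y_j|$ for all $i,j$. (iii) There are an element $T\in S_1$ and a constant $C$ such that $|\varphi_{ij}|\le C|T_{ij}|$ for all $i,j$.
   Context: $B=B(\ell_2)$, $K\subset B$ is the algebra of compact operators on $\ell_2$, and $S_1$ is the trace class on $\ell_2$ with norm $\|x\|_1=\mathrm{tr}|x|$; operators are identified with matrices in the canonical basis. $S_1$ is an operator space through the identification $S_1=K^*$ (so also $S_1^*=B$), using the duality $\langle x,y\rangle=\sum_{i,j}x_{ij}y_{ij}=\mathrm{tr}(x\,{}^ty)$, where duals carry the operator space structure $M_n(X^* )=CB(X,M_n)$. Thus $\langle M_\varphi a,b\rangle=\sum_{i,j}\varphi_{ij}a_{ij}b_{ij}$ for finitely supported $a,b$. *)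

theory Defs
  imports "HOL-Analysis.Analysis"
begin

text \<open>
  Operators on \<open>\<ell>\<^sub>2\<close> are identified throughout with their matrices in the canonical basis;
  indices run over \<open>nat\<close>, starting at \<open>0\<close>.
\<close>

type_synonym vec = "nat \<Rightarrow> complex"
type_synonym cmat = "nat \<Rightarrow> nat \<Rightarrow> complex"

definition ell2 :: "vec set" where
  "ell2 = {\<xi>. summable (\<lambda>i. (cmod (\<xi> i))\<^sup>2)}"

definition ell2_norm :: "vec \<Rightarrow> real" where
  "ell2_norm \<xi> = sqrt (\<Sum>i. (cmod (\<xi> i))\<^sup>2)"

definition mat_app :: "cmat \<Rightarrow> vec \<Rightarrow> vec" where
  "mat_app a \<xi> = (\<lambda>i. \<Sum>j. a i j * \<xi> j)"

definition mat_mult :: "cmat \<Rightarrow> cmat \<Rightarrow> cmat" where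
  "mat_mult a b = (\<lambda>i j. \<Sum>k. a i k * b k j)"

definition mat_transpose :: "cmat \<Rightarrow> cmat" where
  "mat_transpose a = (\<lambda>i j. a j i)"

definition mat_adjoint :: "cmat \<Rightarrow> cmat" where
  "mat_adjoint a = (\<lambda>i j. cnj (a j i))"

definition mat_trace :: "cmat \<Rightarrow> complex" where
  "mat_trace a = (\<Sum>i. a i i)"


subsection \<open>The spaces \<open>B\<close>, \<open>K\<close> and \<open>S\<^sub>1\<close>\<close>

definition bounded_ops :: "cmat set" where
  "bounded_ops = {a.
     (\<forall>\<xi>\<in>ell2. (\<forall>i. summable (\<lambda>j. a i j * \<xi> j)) \<and> mat_app a \<xi> \<in> ell2) \<and>
     (\<exists>C. \<forall>\<xi>\<in>ell2. ell2_norm (mat_app a \<xi>) \<le> C * ell2_norm \<xi>)}"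

text \<open>The image of every sequence in the unit ball has a norm convergent subsequence.\<close>

definition compact_ops :: "cmat set" where
  "compact_ops = {a \<in> bounded_ops.
     \<forall>\<xi> :: nat \<Rightarrow> vec. (\<forall>n. \<xi> n \<in> ell2 \<and> ell2_norm (\<xi> n) \<le> 1) \<longrightarrow>
       (\<exists>r \<eta>. strict_mono (r :: nat \<Rightarrow> nat) \<and> \<eta> \<in> ell2 \<and>
          (\<lambda>n. ell2_norm (\<lambda>i. mat_app a (\<xi> (r n)) i - \<eta> i)) \<longlonglongrightarrow> 0)}"

definition positive_op :: "cmat \<Rightarrow> bool" where
  "positive_op p \<longleftrightarrow> p \<in> bounded_ops \<and>
     (\<forall>\<xi>\<in>ell2. (\<Sum>i. mat_app p \<xi> i * cnj (\<xi> i)) \<in> \<real>\<^sub>\<ge>\<^sub>0)"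

text \<open>
  \<open>is_abs_op a p\<close> says that \<open>p = |a|\<close>, the (unique) positive square root of \<open>a\<^sup>*a\<close>.
  Since the diagonal of \<open>|a|\<close> is nonnegative, its summability says \<open>tr |a| < \<infinity>\<close>.
\<close>

definition is_abs_op :: "cmat \<Rightarrow> cmat \<Rightarrow> bool" where
  "is_abs_op a p \<longleftrightarrow> positive_op p \<and> mat_mult p p = mat_mult (mat_adjoint a) a"

definition trace_class :: "cmat set" where
  "trace_class = {a \<in> bounded_ops. \<exists>p. is_abs_op a p \<and> summable (\<lambda>i. p i i)}"


subsection \<open>Matrix norms and complete boundedness\<close>

text \<open>
  An operator space structure on a space \<open>X \<subseteq> 'a\<close> is given by its norms on \<open>M\<^sub>n(X)\<close>, where an
  element of \<open>M\<^sub>n(X)\<close> is a function \<open>nat \<Rightarrow> nat \<Rightarrow> 'a\<close> of which only the entries with both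
  indices \<open>< n\<close> are relevant. Norms and suprema take values in \<open>ennreal\<close>, so that an
  unbounded supremum is \<open>\<infinity>\<close> instead of an unspecified real.
\<close>

type_synonym 'a matrix_norms = "nat \<Rightarrow> (nat \<Rightarrow> nat \<Rightarrow> 'a) \<Rightarrow> ennreal"

text \<open>\<open>M\<^sub>n(B)\<close>, and hence \<open>M\<^sub>n(K)\<close>, is normed by its action on \<open>\<ell>\<^sub>2 \<oplus> \<dots> \<oplus> \<ell>\<^sub>2\<close> (\<open>n\<close> summands).\<close>

definition op_norms :: "cmat matrix_norms" where
  "op_norms n x =
     (SUP \<xi> \<in> {\<xi> :: nat \<Rightarrow> vec. (\<forall>l<n. \<xi> l \<in> ell2) \<and> (\<Sum>l<n. (ell2_norm (\<xi> l))\<^sup>2) \<le> 1}.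
        ennreal (sqrt (\<Sum>k<n. (ell2_norm (\<lambda>i. \<Sum>l<n. mat_app (x k l) (\<xi> l) i))\<^sup>2)))"

text \<open>Operator norm of a scalar matrix indexed by a finite set \<open>I\<close>, acting on \<open>\<ell>\<^sub>2(I)\<close>.\<close>

definition fin_op_norm :: "'i set \<Rightarrow> ('i \<Rightarrow> 'i \<Rightarrow> complex) \<Rightarrow> ennreal" where
  "fin_op_norm I A =
     (SUP v \<in> {v. (\<Sum>i\<in>I. (cmod (v i))\<^sup>2) \<le> 1}.
        ennreal (sqrt (\<Sum>i\<in>I. (cmod (\<Sum>j\<in>I. A i j * v j))\<^sup>2)))"

text \<open>The operator space \<open>M\<^sub>n\<close>: its norms on \<open>M\<^sub>m(M\<^sub>n) = M\<^bsub>mn\<^esub>\<close>.\<close>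

definition Mn_norms :: "nat \<Rightarrow> cmat matrix_norms" where
  "Mn_norms n m A =
     fin_op_norm ({..<m} \<times> {..<n}) (\<lambda>(p, k) (q, l). A p q k l)"

definition cb_norm ::
  "'a set \<Rightarrow> 'a matrix_norms \<Rightarrow> 'b matrix_norms \<Rightarrow> ('a \<Rightarrow> 'b) \<Rightarrow> ennreal" where
  "cb_norm X NX NY u =
     (SUP m. SUP x \<in> {x. (\<forall>p<m. \<forall>q<m. x p q \<in> X) \<and> NX m x \<le> 1}.
        NY m (\<lambda>p q. u (x p q)))"

definition completely_bounded ::
  "cmat set \<Rightarrow> cmat matrix_norms \<Rightarrow> cmat set \<Rightarrow> cmat matrix_norms \<Rightarrow> (cmat \<Rightarrow> cmat) \<Rightarrow> bool" where
  "completely_bounded X NX Y NY u \<longleftrightarrow>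
     (\<forall>a\<in>X. u a \<in> Y) \<and>
     (\<forall>a\<in>X. \<forall>b\<in>X. \<forall>c. u (\<lambda>i j. c * a i j + b i j) = (\<lambda>i j. c * u a i j + u b i j)) \<and>
     cb_norm X NX NY u < \<infinity>"

text \<open>
  The duality \<open>\<langle>a, b\<rangle> = tr (a \<^sup>tb) = \<Sum>\<^sub>i \<Sum>\<^sub>j a\<^sub>i\<^sub>j b\<^sub>i\<^sub>j\<close> between \<open>S\<^sub>1\<close> and \<open>K\<close>. The double series need not
  converge absolutely, but the iterated one, which is the trace, converges.
\<close>

definition duality :: "cmat \<Rightarrow> cmat \<Rightarrow> complex" where
  "duality a b = mat_trace (mat_mult a (mat_transpose b))"

text \<open>
  \<open>M\<^sub>n(S\<^sub>1) = M\<^sub>n(K\<^sup>*) = CB(K, M\<^sub>n)\<close>: the matrix \<open>[f\<^sub>k\<^sub>l]\<close> is normed as the map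
  \<open>b \<mapsto> [\<langle>f\<^sub>k\<^sub>l, b\<rangle>]\<close> from \<open>K\<close> to \<open>M\<^sub>n\<close>.
\<close>

definition S1_norms :: "cmat matrix_norms" where
  "S1_norms n f = cb_norm compact_ops op_norms (Mn_norms n) (\<lambda>b k l. duality (f k l) b)"

definition schur_multiplier :: "cmat \<Rightarrow> cmat \<Rightarrow> cmat" where
  "schur_multiplier \<phi> x = (\<lambda>i j. \<phi> i j * x i j)"

end

theory Submission
  imports Defs "HOL-Complex_Analysis.Great_Picard"
begin

text \<open>
  If \<open>|\<phi>\<^sub>i\<^sub>j| \<le> \<alpha>\<^sub>i \<beta>\<^sub>j\<close> with \<open>\<alpha>, \<beta> \<in> \<ell>\<^sub>2\<close>, two applications of the Cauchy-Schwarz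
  inequality, to the rows of \<open>a\<close> and the columns of \<open>b\<close>, bound
  \<open>\<Sum>\<^sub>i\<^sub>j \<phi>\<^sub>i\<^sub>j a\<^sub>i\<^sub>j \<otimes> b\<^sub>i\<^sub>j\<close> by \<open>\<parallel>\<alpha>\<parallel> \<parallel>\<beta>\<parallel> \<parallel>a\<parallel> \<parallel>b\<parallel>\<close>.

  Conversely, let \<open>C\<close> be the completely bounded norm on \<open>K\<close>, and let \<open>c \<ge> 0\<close> be a finite matrix
  with marginals \<open>f\<^sub>i = \<Sum>\<^sub>j c\<^sub>i\<^sub>j\<close> and \<open>g\<^sub>j = \<Sum>\<^sub>i c\<^sub>i\<^sub>j\<close>. Partial permutation matrices
  that spread \<open>c\<close> over many scales, tested on the vector \<open>\<Sum>\<^sub>h h\<^bsup>-1/2\<^esup> e\<^sub>h \<otimes> e\<^sub>h\<close>, give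
  \<open>\<Sum>\<^sub>i\<^sub>j |\<phi>\<^sub>i\<^sub>j| c\<^sub>i\<^sub>j (f\<^sub>i g\<^sub>j)\<^bsup>-1/2\<^esup> \<le> C\<close>. By convex duality these inequalities
  force \<open>|\<phi>\<^sub>i\<^sub>j|\<^sup>2 \<le> f\<^sub>i g\<^sub>j\<close> for some summable \<open>f\<close> and \<open>g\<close>; here the dual plan \<open>c\<close> is
  read off from a minimum of a smoothly penalised problem.

  Finally, a trace class \<open>T\<close> is a product of two Hilbert-Schmidt matrices, so
  \<open>|T\<^sub>i\<^sub>j|\<close> is bounded by the product of the norms of a row and a column.
\<close>

subsection \<open>Square-summable sequences and operator norms\<close>

text \<open>The obstacle in the converse is that the marginals f_i and g_j live on different scales,
  so a flat test vector cannot suit all pairs (i, j) at once. The weight 1/h is scale invariant: an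
  edge at level n contributes at least 1 / ((n+1) sqrt (f_i g_j)) whatever the marginals are, while
  the squared norm of the vector is the same harmonic sum up to a bounded error, which disappears as
  the number of levels grows. This is the embezzling vector of van Dam and Hayden.

  The denominator sqrt (f_i g_j) comes from minimising the sum of f and g under |\<phi>_ij|^2 \<le>
  f_i g_j. With the constraint written logarithmically, optimal multipliers c have marginals f and g
  and live where equality holds, so the tested sum is the mass of c. A power penalty replaces the
  constraint so that c appears by differentiating in one variable, with constants independent of the
  size of the section; compactness then reaches infinite matrices.

  For trace class T only p = |T| is given. Gram-Schmidt for the form of p takes the place of a
  spectral decomposition.\<close>

lemma bounded_pointwise_subseq:
  fixes F :: "nat \<Rightarrow> 'i::countable \<Rightarrow> 'b::{real_normed_vector,heine_borel}"
  assumes "\<And>n i. norm (F n i) \<le> M"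
  obtains r f where "strict_mono (r::nat\<Rightarrow>nat)" "\<And>i. (\<lambda>n. F (r n) i) \<longlonglongrightarrow> f i"
proof -
  obtain k where k: "strict_mono (k::nat\<Rightarrow>nat)" "\<And>x. x \<in> (UNIV::'i set) \<Longrightarrow> \<exists>l. (\<lambda>n. F (k n) x) \<longlonglongrightarrow> l"
    by (rule function_convergent_subsequence[of "UNIV::'i set" F M]) (simp_all add: assms)
  have "(\<lambda>n. F (k n) i) \<longlonglongrightarrow> lim (\<lambda>n. F (k n) i)" for i
    using k(2)[of i] by (auto simp: convergent_def simp flip: convergent_LIMSEQ_iff)
  with k(1) show thesis by (rule that)
qed

lemma cmod_sum_mult_le:
  fixes a b :: "'i \<Rightarrow> complex"
  shows "(cmod (\<Sum>i\<in>I. a i * b i))\<^sup>2 \<le> (\<Sum>i\<in>I. (cmod (a i))\<^sup>2) * (\<Sum>i\<in>I. (cmod (b i))\<^sup>2)"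
proof -
  have "cmod (\<Sum>i\<in>I. a i * b i) \<le> (\<Sum>i\<in>I. cmod (a i) * cmod (b i))"
    by (rule order_trans[OF norm_sum]) (simp add: norm_mult)
  then have "(cmod (\<Sum>i\<in>I. a i * b i))\<^sup>2 \<le> (\<Sum>i\<in>I. cmod (a i) * cmod (b i))\<^sup>2"
    by (rule power_mono) simp
  also note Cauchy_Schwarz_ineq_sum
  finally show ?thesis .
qed

lemma sum_mult_le_sqrt:
  fixes a b :: "'i \<Rightarrow> real"
  assumes "(\<Sum>i\<in>I. (a i)\<^sup>2) \<le> A" "(\<Sum>i\<in>I. (b i)\<^sup>2) \<le> B"
  shows "(\<Sum>i\<in>I. a i * b i) \<le> sqrt A * sqrt B"
proof -
  have A: "0 \<le> A" by (rule order_trans[OF _ assms(1)]) (simp add: sum_nonneg)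
  have "(\<Sum>i\<in>I. a i * b i)\<^sup>2 \<le> (\<Sum>i\<in>I. (a i)\<^sup>2) * (\<Sum>i\<in>I. (b i)\<^sup>2)"
    by (rule Cauchy_Schwarz_ineq_sum)
  also have "\<dots> \<le> A * B"
    using assms A by (intro mult_mono) (auto intro: sum_nonneg)
  finally have "\<bar>\<Sum>i\<in>I. a i * b i\<bar> \<le> sqrt (A * B)"
    by (rule real_le_rsqrt[of "\<bar>_\<bar>", simplified])
  then show ?thesis by (simp add: real_sqrt_mult)
qed


lemma ell2_norm_nonneg: "\<xi> \<in> ell2 \<Longrightarrow> 0 \<le> ell2_norm \<xi>"
  unfolding ell2_norm_def ell2_def by (simp add: suminf_nonneg)

lemma ell2_norm_sq: "\<xi> \<in> ell2 \<Longrightarrow> (ell2_norm \<xi>)\<^sup>2 = (\<Sum>i. (cmod (\<xi> i))\<^sup>2)"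
  unfolding ell2_norm_def ell2_def by (simp add: suminf_nonneg)

lemma ell2_sum_le: "\<xi> \<in> ell2 \<Longrightarrow> finite I \<Longrightarrow> (\<Sum>i\<in>I. (cmod (\<xi> i))\<^sup>2) \<le> (ell2_norm \<xi>)\<^sup>2"
  unfolding ell2_norm_sq by (auto simp: ell2_def intro!: sum_le_suminf)

lemma ell2_bounded:
  assumes "\<And>n. (\<Sum>i<n. (cmod (\<xi> i))\<^sup>2) \<le> B"
  shows "\<xi> \<in> ell2" "(ell2_norm \<xi>)\<^sup>2 \<le> B"
proof -
  have s: "summable (\<lambda>i. (cmod (\<xi> i))\<^sup>2)"
    by (rule bounded_imp_summable[of _ B]) (use assms[of "Suc _"] in \<open>auto simp: lessThan_Suc_atMost\<close>)
  then show "\<xi> \<in> ell2" by (simp add: ell2_def)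
  then show "(ell2_norm \<xi>)\<^sup>2 \<le> B"
    by (simp add: ell2_norm_sq suminf_le_const[OF s] assms)
qed

lemma ell2_finite_support:
  assumes "\<And>i. i \<ge> n \<Longrightarrow> \<xi> i = 0"
  shows "\<xi> \<in> ell2" "(ell2_norm \<xi>)\<^sup>2 = (\<Sum>i<n. (cmod (\<xi> i))\<^sup>2)"
proof -
  have s: "(\<lambda>i. (cmod (\<xi> i))\<^sup>2) sums (\<Sum>i<n. (cmod (\<xi> i))\<^sup>2)"
    by (rule sums_finite) (use assms in \<open>auto simp: not_less\<close>)
  then show "\<xi> \<in> ell2" by (auto simp: ell2_def sums_iff)
  then show "(ell2_norm \<xi>)\<^sup>2 = (\<Sum>i<n. (cmod (\<xi> i))\<^sup>2)"
    using s by (simp add: ell2_norm_sq sums_iff)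
qed

lemma ell2_0 [simp]: "(\<lambda>_. 0) \<in> ell2"
  by (simp add: ell2_def)

lemma ell2_scale:
  assumes "\<xi> \<in> ell2"
  shows "(\<lambda>i. c * \<xi> i) \<in> ell2" "(ell2_norm (\<lambda>i. c * \<xi> i))\<^sup>2 = (cmod c)\<^sup>2 * (ell2_norm \<xi>)\<^sup>2"
proof -
  show m: "(\<lambda>i. c * \<xi> i) \<in> ell2"
    using assms by (simp add: ell2_def norm_mult power_mult_distrib summable_mult)
  show "(ell2_norm (\<lambda>i. c * \<xi> i))\<^sup>2 = (cmod c)\<^sup>2 * (ell2_norm \<xi>)\<^sup>2"
    using assms m unfolding ell2_norm_sq[OF m] ell2_norm_sq[OF assms]
    by (simp add: ell2_def norm_mult power_mult_distrib suminf_mult)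
qed

lemma ell2_add:
  assumes "\<xi> \<in> ell2" "\<eta> \<in> ell2"
  shows "(\<lambda>i. \<xi> i + \<eta> i) \<in> ell2"
proof -
  have "(cmod (\<xi> i + \<eta> i))\<^sup>2 \<le> 2 * (cmod (\<xi> i))\<^sup>2 + 2 * (cmod (\<eta> i))\<^sup>2" for i
  proof -
    have "(cmod (\<xi> i + \<eta> i))\<^sup>2 \<le> (cmod (\<xi> i) + cmod (\<eta> i))\<^sup>2"
      by (intro power_mono norm_triangle_ineq) simp
    also have "\<dots> \<le> 2 * (cmod (\<xi> i))\<^sup>2 + 2 * (cmod (\<eta> i))\<^sup>2"
      using sum_squares_bound[of "cmod (\<xi> i)" "cmod (\<eta> i)"] by (simp add: power2_sum)
    finally show ?thesis .
  qed
  moreover have "summable (\<lambda>i. 2 * (cmod (\<xi> i))\<^sup>2 + 2 * (cmod (\<eta> i))\<^sup>2)"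
    using assms by (intro summable_add summable_mult) (simp_all add: ell2_def)
  ultimately show ?thesis
    unfolding ell2_def mem_Collect_eq by (rule_tac summable_comparison_test') simp_all
qed

lemma ell2_sum:
  "(\<And>l. l \<in> A \<Longrightarrow> \<xi> l \<in> ell2) \<Longrightarrow> (\<lambda>i. \<Sum>l\<in>A. \<xi> l i) \<in> ell2"
  by (induction A rule: infinite_finite_induct) (auto intro: ell2_add)

lemma mat_app_finite_support:
  assumes "\<And>j. j \<ge> n \<Longrightarrow> \<xi> j = 0"
  shows "mat_app a \<xi> i = (\<Sum>j<n. a i j * \<xi> j)"
  unfolding mat_app_def by (rule suminf_finite) (use assms in \<open>auto simp: not_less\<close>)

lemma mat_app_scale:
  assumes "summable (\<lambda>j. a i j * \<xi> j)"
  shows "mat_app a (\<lambda>j. c * \<xi> j) i = c * mat_app a \<xi> i"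
  unfolding mat_app_def using suminf_mult[OF assms, of c] by (simp add: mult_ac)

lemma bounded_ops_summable: "a \<in> bounded_ops \<Longrightarrow> \<xi> \<in> ell2 \<Longrightarrow> summable (\<lambda>j. a i j * \<xi> j)"
  and bounded_ops_mat_app: "a \<in> bounded_ops \<Longrightarrow> \<xi> \<in> ell2 \<Longrightarrow> mat_app a \<xi> \<in> ell2"
  by (auto simp: bounded_ops_def)

lemma bounded_ops_obtain:
  assumes "a \<in> bounded_ops"
  obtains C where "0 \<le> C" "\<And>\<xi>. \<xi> \<in> ell2 \<Longrightarrow> ell2_norm (mat_app a \<xi>) \<le> C * ell2_norm \<xi>"
proof -
  obtain C where C: "\<And>\<xi>. \<xi> \<in> ell2 \<Longrightarrow> ell2_norm (mat_app a \<xi>) \<le> C * ell2_norm \<xi>"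
    using assms by (auto simp: bounded_ops_def)
  have "ell2_norm (mat_app a \<xi>) \<le> max 0 C * ell2_norm \<xi>" if "\<xi> \<in> ell2" for \<xi>
    using C[OF that] mult_right_mono[OF max.cobounded2[of C 0] ell2_norm_nonneg[OF that]] by linarith
  then show thesis using that[of "max 0 C"] by auto
qed

lemma double_sum_square_le:
  fixes g :: cmat
  assumes "\<And>n. (\<Sum>i<n. \<Sum>j<n. (cmod (g i j))\<^sup>2) \<le> A"
  shows "(\<Sum>i<n. \<Sum>j<m. (cmod (g i j))\<^sup>2) \<le> A"
proof -
  have "(\<Sum>i<n. \<Sum>j<m. (cmod (g i j))\<^sup>2) \<le> (\<Sum>i<max n m. \<Sum>j<max n m. (cmod (g i j))\<^sup>2)"
    by (intro order_trans[OF sum_mono[OF sum_mono2] sum_mono2]) (auto intro!: sum_nonneg)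
  then show ?thesis using assms order_trans by blast
qed

lemma mult_summable_of_square_bounds:
  fixes f g :: vec
  assumes "\<And>n. (\<Sum>i<n. (cmod (f i))\<^sup>2) \<le> A" "\<And>n. (\<Sum>i<n. (cmod (g i))\<^sup>2) \<le> B"
  shows "summable (\<lambda>i. f i * g i)"
proof (rule summable_comparison_test')
  show "summable (\<lambda>i. (cmod (f i))\<^sup>2 + (cmod (g i))\<^sup>2)"
    using ell2_bounded(1)[OF assms(1)] ell2_bounded(1)[OF assms(2)] by (auto simp: ell2_def intro: summable_add)
  show "norm (f i * g i) \<le> (cmod (f i))\<^sup>2 + (cmod (g i))\<^sup>2" for i
    unfolding norm_mult using sum_squares_bound[of "cmod (f i)" "cmod (g i)"]
      mult_nonneg_nonneg[OF norm_ge_zero norm_ge_zero, of "f i" "g i"]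
    by linarith
qed

text \<open>Cauchy-Schwarz along each row of a finite section, summed over the rows, then a limit in
  the columns. Bounds on square sections are the form in which Hilbert-Schmidt norms are stated
  below.\<close>

lemma hilbert_schmidt_bounded:
  assumes "\<And>n. (\<Sum>i<n. \<Sum>j<n. (cmod (a i j))\<^sup>2) \<le> B"
  shows "a \<in> bounded_ops"
proof -
  have B: "0 \<le> B" using assms[of 0] by simp
  have row: "(\<Sum>j<m. (cmod (a i j))\<^sup>2) \<le> B" for i m
  proof -
    have "(\<Sum>j<m. (cmod (a i j))\<^sup>2) \<le> (\<Sum>i<Suc i. \<Sum>j<m. (cmod (a i j))\<^sup>2)"
      by (simp add: sum_nonneg)
    then show ?thesis using double_sum_square_le[OF assms, where n = "Suc i" and m = m] by linarith
  qed
  have sm: "summable (\<lambda>j. a i j * \<xi> j)" if "\<xi> \<in> ell2" for i \<xi>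
    by (rule mult_summable_of_square_bounds[OF row ell2_sum_le[OF that]]) simp
  have bd: "(\<Sum>i<n. (cmod (mat_app a \<xi> i))\<^sup>2) \<le> B * (ell2_norm \<xi>)\<^sup>2" if "\<xi> \<in> ell2" for \<xi> n
  proof (rule LIMSEQ_le_const2)
    show "(\<lambda>m. \<Sum>i<n. (cmod (\<Sum>j<m. a i j * \<xi> j))\<^sup>2) \<longlonglongrightarrow> (\<Sum>i<n. (cmod (mat_app a \<xi> i))\<^sup>2)"
      unfolding mat_app_def by (intro tendsto_intros summable_LIMSEQ sm that)
    have "(\<Sum>i<n. (cmod (\<Sum>j<m. a i j * \<xi> j))\<^sup>2) \<le> B * (ell2_norm \<xi>)\<^sup>2" for m
    proof -
      have "(\<Sum>i<n. (cmod (\<Sum>j<m. a i j * \<xi> j))\<^sup>2) \<le> (\<Sum>i<n. (\<Sum>j<m. (cmod (a i j))\<^sup>2) * (ell2_norm \<xi>)\<^sup>2)"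
        by (intro sum_mono order_trans[OF cmod_sum_mult_le] mult_left_mono ell2_sum_le that) (auto intro: sum_nonneg)
      also have "\<dots> = (\<Sum>i<n. \<Sum>j<m. (cmod (a i j))\<^sup>2) * (ell2_norm \<xi>)\<^sup>2"
        by (simp add: sum_distrib_right)
      also have "\<dots> \<le> B * (ell2_norm \<xi>)\<^sup>2" by (rule mult_right_mono[OF double_sum_square_le[OF assms]]) simp
      finally show ?thesis .
    qed
    then show "\<exists>N. \<forall>m\<ge>N. (\<Sum>i<n. (cmod (\<Sum>j<m. a i j * \<xi> j))\<^sup>2) \<le> B * (ell2_norm \<xi>)\<^sup>2" by blast
  qed
  have "ell2_norm (mat_app a \<xi>) \<le> sqrt B * ell2_norm \<xi>" if "\<xi> \<in> ell2" for \<xi>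
  proof (rule power2_le_imp_le)
    show "(ell2_norm (mat_app a \<xi>))\<^sup>2 \<le> (sqrt B * ell2_norm \<xi>)\<^sup>2"
      using ell2_bounded(2)[OF bd[OF that]] B by (simp add: power_mult_distrib)
    show "0 \<le> sqrt B * ell2_norm \<xi>" using B ell2_norm_nonneg[OF that] by simp
  qed
  then show ?thesis
    unfolding bounded_ops_def mem_Collect_eq
    by (intro conjI ballI allI sm ell2_bounded(1)[OF bd] exI[of _ "sqrt B"])
qed

section \<open>Matrices of operators: estimates along one row or one column\<close>

lemma op_norms_apply_bound:
  assumes x: "\<And>k l. k < n \<Longrightarrow> l < n \<Longrightarrow> x k l \<in> bounded_ops"
    and c: "0 \<le> c" "op_norms n x \<le> ennreal c"
    and \<xi>: "\<And>l. l < n \<Longrightarrow> \<xi> l \<in> ell2"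
  shows "(\<Sum>k<n. \<Sum>i<N. (cmod (\<Sum>l<n. mat_app (x k l) (\<xi> l) i))\<^sup>2) \<le> c\<^sup>2 * (\<Sum>l<n. (ell2_norm (\<xi> l))\<^sup>2)"
proof -
  define s where "s = (\<Sum>l<n. (ell2_norm (\<xi> l))\<^sup>2)"
  have s0: "0 \<le> s" unfolding s_def by (simp add: sum_nonneg)
  show ?thesis
  \<comment> \<open>Scaling into the unit ball divides by sqrt s, so vanishing input is treated
    apart.\<close>
  proof (cases "s = 0")
    case True
    have "\<xi> l i = 0" if "l < n" for l i
    proof -
      have "(ell2_norm (\<xi> l))\<^sup>2 = 0"
        using True that unfolding s_def by (subst (asm) sum_nonneg_eq_0_iff) auto
      then show ?thesis
        using ell2_sum_le[OF \<xi>[OF that], of "{i}"] by simp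
    qed
    then have "mat_app (x k l) (\<xi> l) i = 0" if "l < n" for k l i
      using that by (simp add: mat_app_def)
    then show ?thesis by (simp add: sum_nonneg)
  next
    case False
    with s0 have s: "0 < s" by simp
    define t where "t = complex_of_real (1 / sqrt s)"
    have t: "(cmod t)\<^sup>2 = 1 / s" using s by (simp add: t_def norm_divide power_divide)
    define \<zeta> where "\<zeta> l = (\<lambda>i. t * \<xi> l i)" for l
    have \<zeta>: "\<zeta> l \<in> ell2" "(ell2_norm (\<zeta> l))\<^sup>2 = (ell2_norm (\<xi> l))\<^sup>2 / s" if "l < n" for l
      using ell2_scale[OF \<xi>[OF that], of t] unfolding \<zeta>_def t by auto
    have ap: "mat_app (x k l) (\<zeta> l) i = t * mat_app (x k l) (\<xi> l) i" if "k < n" "l < n" for k l i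
      unfolding \<zeta>_def using that by (intro mat_app_scale bounded_ops_summable x \<xi>)
    have 1: "(\<Sum>l<n. (ell2_norm (\<zeta> l))\<^sup>2) \<le> 1"
      using s by (simp add: \<zeta> flip: sum_divide_distrib s_def)
    have in2: "(\<lambda>i. \<Sum>l<n. mat_app (x k l) (\<zeta> l) i) \<in> ell2" if "k < n" for k
      using that by (intro ell2_sum bounded_ops_mat_app x \<zeta>) auto
    have "ennreal (sqrt (\<Sum>k<n. (ell2_norm (\<lambda>i. \<Sum>l<n. mat_app (x k l) (\<zeta> l) i))\<^sup>2)) \<le> op_norms n x"
      unfolding op_norms_def by (rule SUP_upper) (use \<zeta> 1 in auto)
    then have "sqrt (\<Sum>k<n. (ell2_norm (\<lambda>i. \<Sum>l<n. mat_app (x k l) (\<zeta> l) i))\<^sup>2) \<le> c"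
      using c by (meson ennreal_le_iff order_trans)
    then have 2: "(\<Sum>k<n. (ell2_norm (\<lambda>i. \<Sum>l<n. mat_app (x k l) (\<zeta> l) i))\<^sup>2) \<le> c\<^sup>2"
      by (rule sqrt_le_D)
    have "(\<Sum>k<n. \<Sum>i<N. (cmod (\<Sum>l<n. mat_app (x k l) (\<xi> l) i))\<^sup>2) / s
        = (\<Sum>k<n. \<Sum>i<N. (cmod (\<Sum>l<n. mat_app (x k l) (\<zeta> l) i))\<^sup>2)"
      by (simp add: ap norm_mult power_mult_distrib t sum_divide_distrib flip: sum_distrib_left)
    also have "\<dots> \<le> c\<^sup>2"
      by (rule order_trans[OF sum_mono 2]) (auto intro!: ell2_sum_le in2)
    finally show ?thesis using s by (simp add: s_def[symmetric] divide_le_eq)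
  qed
qed

text \<open>On multiples \<open>v l\<close> of the \<open>j\<close>-th basis vector, the operators
  read off the \<open>j\<close>-th columns of all blocks.\<close>

lemma op_norms_column_bound:
  assumes x: "\<And>k l. k < n \<Longrightarrow> l < n \<Longrightarrow> x k l \<in> bounded_ops"
    and c: "0 \<le> c" "op_norms n x \<le> ennreal c"
  shows "(\<Sum>k<n. \<Sum>i<N. (cmod (\<Sum>l<n. x k l i j * v l))\<^sup>2) \<le> c\<^sup>2 * (\<Sum>l<n. (cmod (v l))\<^sup>2)"
proof -
  define \<xi> where "\<xi> l = (\<lambda>i. if i = j then v l else 0)" for l
  have \<xi>: "\<xi> l \<in> ell2" "(ell2_norm (\<xi> l))\<^sup>2 = (cmod (v l))\<^sup>2" for l
    by (auto simp: \<xi>_def intro!: ell2_finite_support(1)[of "Suc j"] trans[OF ell2_finite_support(2)[of "Suc j"]])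
  have ap: "mat_app (x k l) (\<xi> l) i = x k l i j * v l" for k l i
    by (subst mat_app_finite_support[of "Suc j"]) (auto simp: \<xi>_def)
  show ?thesis
    unfolding ap[symmetric] \<xi>(2)[symmetric]
    by (rule op_norms_apply_bound[OF _ c]) (auto intro: x \<xi>)
qed

text \<open>The column bound for the adjoint, obtained without forming it: applying \<open>x\<close>
  to the conjugate of the vector z to be estimated gives S^2 \<le> V c^2 S by Cauchy-Schwarz, and S
  cancels.\<close>

lemma op_norms_row_bound:
  assumes x: "\<And>k l. k < n \<Longrightarrow> l < n \<Longrightarrow> x k l \<in> bounded_ops"
    and c: "0 \<le> c" "op_norms n x \<le> ennreal c"
  shows "(\<Sum>l<n. \<Sum>j<N. (cmod (\<Sum>k<n. x k l i j * v k))\<^sup>2) \<le> c\<^sup>2 * (\<Sum>k<n. (cmod (v k))\<^sup>2)"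
proof -
  define z where "z l j = (\<Sum>k<n. x k l i j * v k)" for l j
  define S where "S = (\<Sum>l<n. \<Sum>j<N. (cmod (z l j))\<^sup>2)"
  define V where "V = (\<Sum>k<n. (cmod (v k))\<^sup>2)"
  define \<xi> where "\<xi> l = (\<lambda>j. if j < N then cnj (z l j) else 0)" for l
  have \<xi>: "\<xi> l \<in> ell2" "(ell2_norm (\<xi> l))\<^sup>2 = (\<Sum>j<N. (cmod (z l j))\<^sup>2)" for l
    by (auto simp: \<xi>_def intro!: ell2_finite_support(1)[of N] trans[OF ell2_finite_support(2)[of N]])
  have ap: "mat_app (x k l) (\<xi> l) i = (\<Sum>j<N. x k l i j * cnj (z l j))" for k l
    by (subst mat_app_finite_support[of N]) (auto simp: \<xi>_def)
  define y where "y k = (\<Sum>l<n. mat_app (x k l) (\<xi> l) i)" for k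
  have y: "(\<Sum>k<n. (cmod (y k))\<^sup>2) \<le> c\<^sup>2 * S"
  proof -
    have "(\<Sum>k<n. (cmod (y k))\<^sup>2) \<le> (\<Sum>k<n. \<Sum>i<Suc i. (cmod (\<Sum>l<n. mat_app (x k l) (\<xi> l) i))\<^sup>2)"
      unfolding y_def by (intro sum_mono) (simp add: sum_nonneg)
    also have "\<dots> \<le> c\<^sup>2 * S"
      unfolding S_def \<xi>(2)[symmetric] by (rule op_norms_apply_bound[OF _ c]) (auto intro: x \<xi>)
    finally show ?thesis .
  qed
  have "complex_of_real S = (\<Sum>l<n. \<Sum>j<N. z l j * cnj (z l j))"
    unfolding S_def by (simp only: of_real_sum complex_norm_square)
  also have "\<dots> = (\<Sum>l<n. \<Sum>j<N. \<Sum>k<n. v k * (x k l i j * cnj (z l j)))"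
  proof -
    have "z l j * w = (\<Sum>k<n. v k * (x k l i j * w))" for l j w
      by (simp add: z_def sum_distrib_right sum_distrib_left mult_ac)
    then show ?thesis by simp
  qed
  also have "\<dots> = (\<Sum>l<n. \<Sum>k<n. \<Sum>j<N. v k * (x k l i j * cnj (z l j)))"
    by (intro sum.cong refl sum.swap)
  also have "\<dots> = (\<Sum>k<n. v k * y k)"
    unfolding y_def ap by (subst sum.swap) (simp add: sum_distrib_left)
  finally have "S\<^sup>2 = (cmod (\<Sum>k<n. v k * y k))\<^sup>2"
    by (metis norm_of_real power2_abs)
  also have "\<dots> \<le> V * (\<Sum>k<n. (cmod (y k))\<^sup>2)"
    unfolding V_def by (rule cmod_sum_mult_le)
  also have "\<dots> \<le> V * (c\<^sup>2 * S)"
    by (intro mult_left_mono y) (simp add: V_def sum_nonneg)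
  finally have le: "S * S \<le> (c\<^sup>2 * V) * S" by (simp add: power2_eq_square mult_ac)
  have "0 \<le> S" "0 \<le> c\<^sup>2 * V" by (auto simp: S_def V_def sum_nonneg)
  with le have "S \<le> c\<^sup>2 * V"
    by (cases "S = 0") auto
  then show ?thesis by (simp add: S_def V_def z_def)
qed

text \<open>The two preceding bounds for 1 by 1 matrices; boundedness of a single operator enters
  the summability arguments in this form.\<close>

lemma bounded_ops_entry_bounds:
  assumes a: "a \<in> bounded_ops"
  obtains C where "0 \<le> C"
    "\<And>N i. (\<Sum>j<N. (cmod (a i j))\<^sup>2) \<le> C" "\<And>N j. (\<Sum>i<N. (cmod (a i j))\<^sup>2) \<le> C"
proof -
  obtain C where C: "0 \<le> C" "\<And>\<xi>. \<xi> \<in> ell2 \<Longrightarrow> ell2_norm (mat_app a \<xi>) \<le> C * ell2_norm \<xi>"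
    using bounded_ops_obtain[OF a] by blast
  have "op_norms 1 (\<lambda>_ _. a) \<le> ennreal C"
    unfolding op_norms_def
  proof (rule SUP_least)
    fix \<xi> :: "nat \<Rightarrow> vec"
    assume "\<xi> \<in> {\<xi>. (\<forall>l<1. \<xi> l \<in> ell2) \<and> (\<Sum>l<1. (ell2_norm (\<xi> l))\<^sup>2) \<le> 1}"
    then have \<xi>: "\<xi> 0 \<in> ell2" "(ell2_norm (\<xi> 0))\<^sup>2 \<le> 1" by auto
    then have "ell2_norm (\<xi> 0) \<le> 1"
      by (intro power2_le_imp_le[of "ell2_norm _" 1]) auto
    then have "ell2_norm (mat_app a (\<xi> 0)) \<le> C"
      by (intro order_trans[OF C(2)[OF \<xi>(1)]] mult_left_le C(1))
    then show "ennreal (sqrt (\<Sum>k<1::nat. (ell2_norm (\<lambda>i. \<Sum>l<1. mat_app a (\<xi> l) i))\<^sup>2)) \<le> ennreal C"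
      using ell2_norm_nonneg[OF bounded_ops_mat_app[OF a \<xi>(1)]] by (simp add: ennreal_leI)
  qed
  note C1 = C(1) this
  have "(\<Sum>l<1::nat. \<Sum>j<N. (cmod (\<Sum>k<1::nat. a i j * 1))\<^sup>2) \<le> C\<^sup>2 * (\<Sum>k<1::nat. (cmod 1)\<^sup>2)" for N i
    by (rule op_norms_row_bound[OF _ C1]) (rule a)
  moreover have "(\<Sum>k<1::nat. \<Sum>i<N. (cmod (\<Sum>l<1::nat. a i j * 1))\<^sup>2) \<le> C\<^sup>2 * (\<Sum>l<1::nat. (cmod 1)\<^sup>2)" for N j
    by (rule op_norms_column_bound[OF _ C1]) (rule a)
  ultimately show thesis by (intro that[of "C\<^sup>2"]) simp_all
qed

subsection \<open>Polar decomposition of finite matrices\<close>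

definition unitary_upto :: "nat \<Rightarrow> cmat \<Rightarrow> bool" where
  "unitary_upto n U \<longleftrightarrow> (\<forall>i<n. \<forall>j<n.
     (\<Sum>k<n. cnj (U k i) * U k j) = (if i = j then 1 else 0) \<and>
     (\<Sum>k<n. U i k * cnj (U j k)) = (if i = j then 1 else 0))"

lemma mult_delta:
  fixes x :: complex
  shows "(if P then 1 else 0) * x = (if P then x else 0)" "x * (if P then 1 else 0) = (if P then x else 0)"
    "cnj (if P then 1 else 0) = (if P then 1 else 0)"
  by auto

lemma unitary_upto_entry_le:
  assumes "unitary_upto n U" "i < n" "j < n"
  shows "cmod (U i j) \<le> 1"
proof -
  have "complex_of_real (\<Sum>k<n. (cmod (U i k))\<^sup>2) = complex_of_real 1"
    using assms unfolding unitary_upto_def of_real_sum complex_norm_square by auto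
  then have "(\<Sum>k<n. (cmod (U i k))\<^sup>2) = 1" unfolding of_real_eq_iff .
  moreover have "(cmod (U i j))\<^sup>2 \<le> (\<Sum>k<n. (cmod (U i k))\<^sup>2)"
    using assms(3) by (intro member_le_sum) auto
  ultimately show ?thesis by (simp add: abs_square_le_1)
qed

lemma unitary_upto_adjoint_norm:
  assumes "unitary_upto n U"
  shows "(\<Sum>i<n. (cmod (\<Sum>k<n. cnj (U k i) * x k))\<^sup>2) = (\<Sum>k<n. (cmod (x k))\<^sup>2)"
proof -
  have "complex_of_real (\<Sum>i<n. (cmod (\<Sum>k<n. cnj (U k i) * x k))\<^sup>2)
      = (\<Sum>i<n. (\<Sum>k<n. cnj (U k i) * x k) * (\<Sum>l<n. U l i * cnj (x l)))"
    unfolding of_real_sum complex_norm_square by simp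
  also have "\<dots> = (\<Sum>i<n. \<Sum>k<n. \<Sum>l<n. x k * cnj (x l) * (U l i * cnj (U k i)))"
    by (simp add: sum_product mult_ac)
  also have "\<dots> = (\<Sum>k<n. \<Sum>l<n. \<Sum>i<n. x k * cnj (x l) * (U l i * cnj (U k i)))"
    by (subst sum.swap, rule sum.cong[OF refl], rule sum.swap)
  also have "\<dots> = (\<Sum>k<n. \<Sum>l<n. x k * cnj (x l) * (if l = k then 1 else 0))"
    using assms by (intro sum.cong refl) (simp add: unitary_upto_def flip: sum_distrib_left)
  also have "\<dots> = (\<Sum>k<n. x k * cnj (x k))"
    by (intro sum.cong refl) (simp add: mult_delta)
  also have "\<dots> = complex_of_real (\<Sum>k<n. (cmod (x k))\<^sup>2)"
    unfolding of_real_sum complex_norm_square ..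
  finally show ?thesis unfolding of_real_eq_iff .
qed

lemma unitary_upto_limit:
  assumes U: "\<And>m. unitary_upto n (V m)"
    and lim: "\<And>i j. i < n \<Longrightarrow> j < n \<Longrightarrow> (\<lambda>m. V m i j) \<longlonglongrightarrow> U i j"
  shows "unitary_upto n U"
  unfolding unitary_upto_def
proof (intro allI impI conjI)
  fix i j assume ij: "i < n" "j < n"
  have "(\<lambda>m. \<Sum>k<n. cnj (V m k i) * V m k j) \<longlonglongrightarrow> (\<Sum>k<n. cnj (U k i) * U k j)"
    using ij by (intro tendsto_intros lim) auto
  moreover have "(\<Sum>k<n. cnj (V m k i) * V m k j) = (if i = j then 1 else 0)" for m
    using U[of m] ij by (simp add: unitary_upto_def)
  ultimately show "(\<Sum>k<n. cnj (U k i) * U k j) = (if i = j then 1 else 0)"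
    by (simp add: LIMSEQ_const_iff)
  have "(\<lambda>m. \<Sum>k<n. V m i k * cnj (V m j k)) \<longlonglongrightarrow> (\<Sum>k<n. U i k * cnj (U j k))"
    using ij by (intro tendsto_intros lim) auto
  moreover have "(\<Sum>k<n. V m i k * cnj (V m j k)) = (if i = j then 1 else 0)" for m
    using U[of m] ij by (simp add: unitary_upto_def)
  ultimately show "(\<Sum>k<n. U i k * cnj (U j k)) = (if i = j then 1 else 0)"
    by (simp add: LIMSEQ_const_iff)
qed

lemma unitary_upto_attains_max:
  fixes T :: cmat
  obtains U where "unitary_upto n U"
    "\<And>V. unitary_upto n V \<Longrightarrow>
       Re (\<Sum>i<n. \<Sum>k<n. cnj (V k i) * T k i) \<le> Re (\<Sum>i<n. \<Sum>k<n. cnj (U k i) * T k i)"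
proof -
  define val where "val V = Re (\<Sum>i<n. \<Sum>k<n. cnj (V k i) * T k i)" for V
  define S where "S = val ` {V. unitary_upto n V}"
  have "unitary_upto n (\<lambda>i j. if i = j then 1 else 0)"
    unfolding unitary_upto_def by (simp add: mult_delta)
  then have ne: "S \<noteq> {}" unfolding S_def by auto
  have "val V \<le> (\<Sum>i<n. \<Sum>k<n. cmod (T k i))" if "unitary_upto n V" for V
    unfolding val_def
  proof (rule order_trans[OF complex_Re_le_cmod], rule sum_norm_le, rule sum_norm_le)
    fix i k assume "i \<in> {..<n}" "k \<in> {..<n}"
    then show "cmod (cnj (V k i) * T k i) \<le> cmod (T k i)"
      using unitary_upto_entry_le[OF that, of k i] by (simp add: norm_mult mult_left_le_one_le)
  qed
  then have bdd: "bdd_above S" unfolding S_def by (auto intro!: bdd_aboveI)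
  have "\<exists>V. unitary_upto n V \<and> Sup S - 1 / real (Suc m) < val V" for m
    using less_cSup_iff[OF ne bdd, of "Sup S - 1 / real (Suc m)"] unfolding S_def by auto
  then obtain V where V: "\<And>m. unitary_upto n (V m)" "\<And>m. Sup S - 1 / real (Suc m) < val (V m)"
    by metis
  \<comment> \<open>Entries outside the corner are arbitrary; they are cut off to obtain the uniform
    bound behind the convergent subsequence.\<close>
  define W where "W m = (\<lambda>(i, j). if i < n \<and> j < n then V m i j else 0)" for m
  have W: "norm (W m q) \<le> 1" for m q
    using unitary_upto_entry_le[OF V(1)] by (auto simp: W_def split: prod.split)
  obtain r f where r: "strict_mono (r :: nat \<Rightarrow> nat)" and f: "\<And>q. (\<lambda>m. W (r m) q) \<longlonglongrightarrow> f q"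
    by (rule bounded_pointwise_subseq[of W 1, OF W]) (rule that)
  define U where "U i j = f (i, j)" for i j
  have U: "(\<lambda>m. V (r m) i j) \<longlonglongrightarrow> U i j" if "i < n" "j < n" for i j
    using f[of "(i, j)"] that by (simp add: U_def W_def)
  have un: "unitary_upto n U"
    by (rule unitary_upto_limit[of n "\<lambda>m. V (r m)"]) (use V U in auto)
  have "(\<lambda>m. val (V (r m))) \<longlonglongrightarrow> val U"
    unfolding val_def by (intro tendsto_intros U) auto
  moreover have "(\<lambda>m. Sup S - 1 / real (Suc (r m))) \<longlonglongrightarrow> Sup S - 0"
    by (intro tendsto_intros LIMSEQ_subseq_LIMSEQ[OF _ r, of "\<lambda>m. 1 / real (Suc m)", unfolded o_def] LIMSEQ_Suc[OF lim_1_over_n])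
  ultimately have "Sup S - 0 \<le> val U"
    by (rule_tac LIMSEQ_le) (use V(2) less_imp_le in blast)+
  then have "val V \<le> val U" if "unitary_upto n V" for V
    using cSup_upper[OF _ bdd, of "val V"] that unfolding S_def by auto
  with un show thesis by (intro that) (auto simp: val_def)
qed

section \<open>Positive semidefinite sections and their sesquilinear forms\<close>

definition sesq :: "nat \<Rightarrow> cmat \<Rightarrow> vec \<Rightarrow> vec \<Rightarrow> complex" where
  "sesq n p u v = (\<Sum>i<n. \<Sum>j<n. p i j * u j * cnj (v i))"

definition psd_upto :: "nat \<Rightarrow> cmat \<Rightarrow> bool" where
  "psd_upto n p \<longleftrightarrow> (\<forall>v. sesq n p v v \<in> \<real>\<^sub>\<ge>\<^sub>0)"

lemma sesq_add_left: "sesq n p (\<lambda>i. u i + u' i) v = sesq n p u v + sesq n p u' v"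
  by (simp add: sesq_def algebra_simps sum.distrib)

lemma sesq_add_right: "sesq n p u (\<lambda>i. v i + v' i) = sesq n p u v + sesq n p u v'"
  by (simp add: sesq_def algebra_simps sum.distrib)

lemma sesq_scale_left: "sesq n p (\<lambda>i. c * u i) v = c * sesq n p u v"
  by (simp add: sesq_def sum_distrib_left mult_ac)

lemma sesq_scale_right: "sesq n p u (\<lambda>i. c * v i) = cnj c * sesq n p u v"
  by (simp add: sesq_def sum_distrib_left mult_ac)

text \<open>Polarisation: the form is real at u + c v, and c = 1 and c = i give the imaginary and
  the real part of the identity.\<close>

lemma psd_upto_hermitian:
  assumes "psd_upto n p"
  shows "sesq n p v u = cnj (sesq n p u v)"
proof -
  have r: "Im (sesq n p w w) = 0" for w
    using assms unfolding psd_upto_def complex_nonneg_Reals_iff by blast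
  have "Im (sesq n p (\<lambda>i. u i + c * v i) (\<lambda>i. u i + c * v i)) = Im (c * sesq n p v u + cnj c * sesq n p u v)" for c
    by (simp add: sesq_add_left sesq_add_right sesq_scale_left sesq_scale_right r algebra_simps)
  then have z: "Im (c * sesq n p v u + cnj c * sesq n p u v) = 0" for c
    using r by metis
  show ?thesis
    using z[of 1] z[of \<i>] by (simp add: complex_eq_iff)
qed

lemma sesq_unit:
  assumes "i < n" "j < n"
  shows "sesq n p (\<lambda>k. if k = j then 1 else 0) (\<lambda>k. if k = i then 1 else 0) = p i j"
proof -
  have "sesq n p (\<lambda>k. if k = j then 1 else 0) (\<lambda>k. if k = i then 1 else 0)
      = (\<Sum>k<n. if k = i then \<Sum>l<n. if l = j then p k l else 0 else 0)"
    unfolding sesq_def by (intro sum.cong refl) (simp add: mult_delta)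
  then show ?thesis using assms by simp
qed

lemma psd_upto_entry_cnj:
  assumes "psd_upto n p" "i < n" "j < n"
  shows "p j i = cnj (p i j)"
  using psd_upto_hermitian[OF assms(1), of "\<lambda>k. if k = i then 1 else 0" "\<lambda>k. if k = j then 1 else 0"] assms(2,3)
  by (simp add: sesq_unit)

lemma psd_upto_diagonal:
  assumes "psd_upto n p" "i < n"
  shows "p i i \<in> \<real>\<^sub>\<ge>\<^sub>0"
  using assms sesq_unit[OF assms(2) assms(2), of p] unfolding psd_upto_def by metis

text \<open>The new matrix is U composed with 1 + d P, where P x = <x, v> v satisfies P^2 = N P. The
  condition on \<open>d\<close> makes the product of 1 + d P with its adjoint equal to 1.\<close>

lemma unitary_upto_rank_one_perturbation:
  fixes v :: vec
  assumes U: "unitary_upto n U" and N: "(\<Sum>i<n. v i * cnj (v i)) = N"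
    and d: "d + cnj d + d * cnj d * N = 0"
  shows "unitary_upto n (\<lambda>k i. U k i + d * (\<Sum>j<n. U k j * v j) * cnj (v i))"
  unfolding unitary_upto_def
proof (intro allI impI conjI)
  define y where "y k = (\<Sum>j<n. U k j * v j)" for k
  have yU: "(\<Sum>k<n. cnj (U k i) * y k) = v i" if "i < n" for i
  proof -
    have "(\<Sum>k<n. cnj (U k i) * y k) = (\<Sum>k<n. \<Sum>j<n. v j * (cnj (U k i) * U k j))"
      by (simp add: y_def sum_distrib_left mult_ac)
    also have "\<dots> = (\<Sum>j<n. v j * (\<Sum>k<n. cnj (U k i) * U k j))"
      by (subst sum.swap) (simp add: sum_distrib_left)
    also have "\<dots> = v i"
    proof -
      have "(\<Sum>j<n. v j * (\<Sum>k<n. cnj (U k i) * U k j)) = (\<Sum>j<n. v j * (if i = j then 1 else 0))"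
        using U that by (intro sum.cong refl) (simp add: unitary_upto_def)
      then show ?thesis using that by (simp add: mult_delta)
    qed
    finally show ?thesis .
  qed
  then have yU': "(\<Sum>k<n. cnj (y k) * U k i) = cnj (v i)" if "i < n" for i
    using arg_cong[OF yU[OF that], of cnj] by (simp add: mult_ac)
  have vU: "(\<Sum>i<n. cnj (v i) * cnj (U k i)) = cnj (y k)" for k
    by (simp add: y_def mult_ac)
  have vU': "(\<Sum>i<n. U k i * v i) = y k" for k
    by (simp add: y_def)
  have yy: "(\<Sum>k<n. cnj (y k) * y k) = N"
  proof -
    have "(\<Sum>k<n. cnj (y k) * y k) = (\<Sum>k<n. \<Sum>i<n. cnj (v i) * (cnj (U k i) * y k))"
      by (simp add: vU[symmetric] sum_distrib_right sum_distrib_left mult_ac)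
    also have "\<dots> = (\<Sum>i<n. cnj (v i) * (\<Sum>k<n. cnj (U k i) * y k))"
      by (subst sum.swap) (simp add: sum_distrib_left)
    also have "\<dots> = (\<Sum>i<n. cnj (v i) * v i)"
      by (intro sum.cong refl) (simp add: yU)
    also have "\<dots> = N" using N by (simp add: mult.commute)
    finally show ?thesis .
  qed
  fix i j assume ij: "i < n" "j < n"
  have "(\<Sum>k<n. cnj (U k i + d * y k * cnj (v i)) * (U k j + d * y k * cnj (v j)))
      = (\<Sum>k<n. cnj (U k i) * U k j) + d * cnj (v j) * (\<Sum>k<n. cnj (U k i) * y k)
        + cnj d * v i * (\<Sum>k<n. cnj (y k) * U k j) + d * cnj d * v i * cnj (v j) * (\<Sum>k<n. cnj (y k) * y k)"
    by (simp add: distrib_left distrib_right sum.distrib sum_distrib_left mult_ac)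
  also have "\<dots> = (if i = j then 1 else 0) + v i * cnj (v j) * (d + cnj d + d * cnj d * N)"
    using U ij unfolding yU[OF ij(1)] yU'[OF ij(2)] yy by (simp add: unitary_upto_def distrib_left mult_ac)
  finally show "(\<Sum>k<n. cnj (U k i + d * (\<Sum>j<n. U k j * v j) * cnj (v i)) * (U k j + d * (\<Sum>j<n. U k j * v j) * cnj (v j))) = (if i = j then 1 else 0)"
    unfolding d y_def by simp
  have "(\<Sum>k<n. (U i k + d * y i * cnj (v k)) * cnj (U j k + d * y j * cnj (v k)))
      = (\<Sum>k<n. U i k * cnj (U j k)) + d * y i * (\<Sum>k<n. cnj (v k) * cnj (U j k))
        + cnj d * cnj (y j) * (\<Sum>k<n. U i k * v k) + d * cnj d * y i * cnj (y j) * (\<Sum>k<n. v k * cnj (v k))"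
    by (simp add: distrib_left distrib_right sum.distrib sum_distrib_left mult_ac)
  also have "\<dots> = (if i = j then 1 else 0) + y i * cnj (y j) * (d + cnj d + d * cnj d * N)"
    using U ij unfolding vU vU' N by (simp add: unitary_upto_def distrib_left mult_ac)
  finally show "(\<Sum>k<n. (U i k + d * (\<Sum>j<n. U i j * v j) * cnj (v k)) * cnj (U j k + d * (\<Sum>i<n. U j i * v i) * cnj (v k))) = (if i = j then 1 else 0)"
    unfolding d y_def by simp
qed

text \<open>For w = s / |s| the left side becomes |s|, and a number whose modulus is at most its
  real part is nonnegative.\<close>

lemma complex_nonneg_of_rotations:
  fixes s :: complex
  assumes "\<And>w. cmod w = 1 \<Longrightarrow> Re (cnj w * s) \<le> Re s"
  shows "s \<in> \<real>\<^sub>\<ge>\<^sub>0"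
proof (cases "s = 0")
  case False
  have "cnj (s / cmod s) * s = complex_of_real (cmod s)"
    using False by (simp add: field_simps complex_norm_square[symmetric] power2_eq_square mult.commute[of "cnj s"])
  moreover have "cmod (s / cmod s) = 1" using False by (simp add: norm_divide)
  ultimately have "cmod s \<le> Re s" using assms[of "s / cmod s"] by simp
  then have "0 \<le> Re s" "(cmod s)\<^sup>2 \<le> (Re s)\<^sup>2"
    using norm_ge_zero[of s] by (linarith, intro power_mono) simp_all
  then show ?thesis by (simp add: complex_nonneg_Reals_iff cmod_power2)
qed simp

text \<open>
  A maximiser \<open>U\<close> of \<open>Re tr (U\<^sup>*T)\<close> over the unitaries is the unitary part of a polar
  decomposition: comparing it with \<open>U(1 + (w - 1)vv\<^sup>*)\<close> for unit vectors \<open>v\<close> and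
  \<open>|w| = 1\<close> shows that \<open>U\<^sup>*T\<close> is positive.
\<close>

lemma finite_polar_decomposition:
  fixes T :: cmat
  obtains U where "unitary_upto n U" "psd_upto n (\<lambda>i j. \<Sum>k<n. cnj (U k i) * T k j)"
proof -
  obtain U where U: "unitary_upto n U" and mx: "\<And>V. unitary_upto n V \<Longrightarrow>
       Re (\<Sum>i<n. \<Sum>k<n. cnj (V k i) * T k i) \<le> Re (\<Sum>i<n. \<Sum>k<n. cnj (U k i) * T k i)"
    using unitary_upto_attains_max[of n T] by blast
  define p where "p i j = (\<Sum>k<n. cnj (U k i) * T k j)" for i j
  have "sesq n p v v \<in> \<real>\<^sub>\<ge>\<^sub>0" for v
  proof (cases "(\<Sum>i<n. (cmod (v i))\<^sup>2) = 0")
    case True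
    then have "\<forall>i<n. v i = 0" by (subst (asm) sum_nonneg_eq_0_iff) auto
    then show ?thesis by (simp add: sesq_def)
  next
    case False
    define N where "N = (\<Sum>i<n. (cmod (v i))\<^sup>2)"
    have N: "0 < N" using False unfolding N_def by (simp add: sum_nonneg order_less_le)
    have Nc: "(\<Sum>i<n. v i * cnj (v i)) = complex_of_real N"
      unfolding N_def of_real_sum complex_norm_square ..
    show ?thesis
    proof (rule complex_nonneg_of_rotations)
      fix w assume w: "cmod w = 1"
      \<comment> \<open>As v has squared norm N, this \<open>d\<close> makes the perturbation
        multiply the line of v by w and fix its orthogonal complement.\<close>
      define d where "d = (w - 1) / of_real N"
      have ww: "w * cnj w = 1" using w by (simp flip: complex_norm_square)
      have "d + cnj d + d * cnj d * of_real N = ((w - 1) + (cnj w - 1) + (w - 1) * (cnj w - 1)) / of_real N"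
        using N by (simp add: d_def field_simps)
      also have "\<dots> = 0" using ww by (simp add: algebra_simps)
      finally have d: "d + cnj d + d * cnj d * of_real N = 0" .
      define y where "y k = (\<Sum>j<n. U k j * v j)" for k
      note le = mx[OF unitary_upto_rank_one_perturbation[OF U Nc d]]
      \<comment> \<open>The objective changes by \<open>cnj d\<close> times the form of
        \<open>p\<close> at v, so maximality becomes the rotation inequality for that value.\<close>
      have "(\<Sum>i<n. \<Sum>k<n. cnj (U k i + d * y k * cnj (v i)) * T k i)
          = (\<Sum>i<n. \<Sum>k<n. cnj (U k i) * T k i) + cnj d * (\<Sum>i<n. \<Sum>k<n. cnj (y k) * v i * T k i)"
        by (simp add: algebra_simps sum.distrib sum_distrib_left)
      also have "(\<Sum>i<n. \<Sum>k<n. cnj (y k) * v i * T k i) = (\<Sum>i<n. \<Sum>k<n. \<Sum>j<n. cnj (U k j) * T k i * v i * cnj (v j))"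
        by (simp add: y_def sum_distrib_left sum_distrib_right mult_ac)
      also have "\<dots> = (\<Sum>i<n. \<Sum>j<n. \<Sum>k<n. cnj (U k j) * T k i * v i * cnj (v j))"
        by (intro sum.cong refl sum.swap)
      also have "\<dots> = sesq n p v v"
        unfolding sesq_def p_def by (subst sum.swap) (simp add: sum_distrib_right)
      finally have "Re (cnj d * sesq n p v v) \<le> 0"
        using le unfolding y_def by simp
      moreover have "cnj d * sesq n p v v = (cnj w * sesq n p v v - sesq n p v v) / of_real N"
        by (simp add: d_def field_simps)
      ultimately show "Re (cnj w * sesq n p v v) \<le> Re (sesq n p v v)"
        using N by (simp add: divide_le_0_iff)
    qed
  qed
  then have "psd_upto n p" by (simp add: psd_upto_def)
  with U show thesis by (intro that) (simp_all add: p_def[abs_def])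
qed

subsection \<open>Products of Hilbert-Schmidt matrices\<close>

lemma suminf_tendsto_dominated:
  fixes a :: "nat \<Rightarrow> nat \<Rightarrow> complex"
  assumes "\<And>k. (\<lambda>n. a k n) \<longlonglongrightarrow> b k" "\<And>k n. cmod (a k n) \<le> M k" "summable M"
  shows "(\<lambda>n. \<Sum>k. a k n) \<longlonglongrightarrow> (\<Sum>k. b k)"
proof -
  have "eventually (\<lambda>(k, n). norm (a k n) \<le> M k) (sequentially \<times>\<^sub>F sequentially)"
    using assms(2) by (intro always_eventually) auto
  from tannerys_theorem[OF assms(1) this assms(3)] show ?thesis by simp
qed

text \<open>The trace is a Hilbert-Schmidt inner product of the adjoint of U times \<open>g\<close>
  with \<open>h\<close>, and the unitary factor keeps the norm of \<open>g\<close>. Cutting the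
  inner index at M keeps all sums finite; the cut disappears in the limit.\<close>

lemma polar_trace_le:
  fixes g h :: cmat
  assumes g: "\<And>n. (\<Sum>i<n. \<Sum>j<n. (cmod (g i j))\<^sup>2) \<le> A"
    and h: "\<And>n. (\<Sum>i<n. \<Sum>j<n. (cmod (h i j))\<^sup>2) \<le> B"
    and T: "\<And>i j. (\<lambda>m. g i m * h m j) sums T i j"
    and U: "unitary_upto n U"
  shows "Re (\<Sum>i<n. \<Sum>k<n. cnj (U k i) * T k i) \<le> sqrt A * sqrt B"
proof (rule LIMSEQ_le_const2)
  show "(\<lambda>M. Re (\<Sum>i<n. \<Sum>k<n. cnj (U k i) * (\<Sum>m<M. g k m * h m i))) \<longlonglongrightarrow> Re (\<Sum>i<n. \<Sum>k<n. cnj (U k i) * T k i)"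
    by (intro tendsto_intros T[unfolded sums_def])
  have "Re (\<Sum>i<n. \<Sum>k<n. cnj (U k i) * (\<Sum>m<M. g k m * h m i)) \<le> sqrt A * sqrt B" for M
  proof -
    define y where "y i m = (\<Sum>k<n. cnj (U k i) * g k m)" for i m
    have "(\<Sum>i<n. \<Sum>k<n. cnj (U k i) * (\<Sum>m<M. g k m * h m i)) = (\<Sum>i<n. \<Sum>m<M. y i m * h m i)"
      unfolding y_def sum_distrib_left sum_distrib_right
      by (intro sum.cong[OF refl]) (subst sum.swap, simp add: mult_ac)
    also have "Re \<dots> \<le> (\<Sum>i<n. \<Sum>m<M. cmod (y i m) * cmod (h m i))"
      by (rule order_trans[OF complex_Re_le_cmod], intro sum_norm_le) (simp add: norm_mult)
    also have "\<dots> = (\<Sum>q\<in>{..<n} \<times> {..<M}. cmod (y (fst q) (snd q)) * cmod (h (snd q) (fst q)))"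
      by (simp add: sum.cartesian_product case_prod_unfold)
    also have "\<dots> \<le> sqrt A * sqrt B"
    proof (rule sum_mult_le_sqrt)
      have "(\<Sum>q\<in>{..<n} \<times> {..<M}. (cmod (y (fst q) (snd q)))\<^sup>2) = (\<Sum>i<n. \<Sum>m<M. (cmod (y i m))\<^sup>2)"
        by (simp add: sum.cartesian_product case_prod_unfold)
      also have "\<dots> = (\<Sum>m<M. \<Sum>i<n. (cmod (y i m))\<^sup>2)" by (rule sum.swap)
      also have "\<dots> = (\<Sum>m<M. \<Sum>k<n. (cmod (g k m))\<^sup>2)"
        unfolding y_def unitary_upto_adjoint_norm[OF U] ..
      also have "\<dots> = (\<Sum>k<n. \<Sum>m<M. (cmod (g k m))\<^sup>2)" by (rule sum.swap)
      also have "\<dots> \<le> A" by (rule double_sum_square_le[OF g])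
      finally show "(\<Sum>q\<in>{..<n} \<times> {..<M}. (cmod (y (fst q) (snd q)))\<^sup>2) \<le> A" .
      have "(\<Sum>q\<in>{..<n} \<times> {..<M}. (cmod (h (snd q) (fst q)))\<^sup>2) = (\<Sum>i<n. \<Sum>m<M. (cmod (h m i))\<^sup>2)"
        by (simp add: sum.cartesian_product case_prod_unfold)
      also have "\<dots> = (\<Sum>m<M. \<Sum>i<n. (cmod (h m i))\<^sup>2)" by (rule sum.swap)
      also have "\<dots> \<le> B" by (rule double_sum_square_le[OF h])
      finally show "(\<Sum>q\<in>{..<n} \<times> {..<M}. (cmod (h (snd q) (fst q)))\<^sup>2) \<le> B" .
    qed
    finally show ?thesis .
  qed
  then show "\<exists>N. \<forall>M\<ge>N. Re (\<Sum>i<n. \<Sum>k<n. cnj (U k i) * (\<Sum>m<M. g k m * h m i)) \<le> sqrt A * sqrt B"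
    by blast
qed

text \<open>Positivity of the finite sections reaches every vector by dominated convergence: the
  i-th term is at most \<tau> i R + |\<xi> i|^2, which is summable.\<close>

lemma positive_op_limit:
  assumes \<tau>: "summable \<tau>" "\<And>i n. (\<Sum>j<n. (cmod (p i j))\<^sup>2) \<le> \<tau> i"
    and psd: "\<And>n. psd_upto n p"
  shows "positive_op p"
  unfolding positive_op_def
proof (intro conjI ballI)
  have \<tau>0: "0 \<le> \<tau> i" for i using \<tau>(2)[where i = i and n = 0] by simp
  show "p \<in> bounded_ops"
  proof (rule hilbert_schmidt_bounded)
    fix n
    have "(\<Sum>i<n. \<Sum>j<n. (cmod (p i j))\<^sup>2) \<le> (\<Sum>i<n. \<tau> i)" by (intro sum_mono \<tau>(2))
    also have "\<dots> \<le> suminf \<tau>" by (intro sum_le_suminf \<tau>(1)) (auto simp: \<tau>0)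
    finally show "(\<Sum>i<n. \<Sum>j<n. (cmod (p i j))\<^sup>2) \<le> suminf \<tau>" .
  qed
  fix \<xi> :: vec assume \<xi>: "\<xi> \<in> ell2"
  define R where "R = (ell2_norm \<xi>)\<^sup>2"
  have R: "(\<Sum>i<n. (cmod (\<xi> i))\<^sup>2) \<le> R" for n
    unfolding R_def by (rule ell2_sum_le[OF \<xi>]) simp
  define s where "s n = (\<Sum>i. if i < n then (\<Sum>j<n. p i j * \<xi> j) * cnj (\<xi> i) else 0)" for n
  have "s n = sesq n p \<xi> \<xi>" for n
  proof -
    have "s n = (\<Sum>i<n. if i < n then (\<Sum>j<n. p i j * \<xi> j) * cnj (\<xi> i) else 0)"
      unfolding s_def by (rule suminf_finite) auto
    then show ?thesis by (simp add: sesq_def sum_distrib_right)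
  qed
  then have pos: "s n \<in> \<real>\<^sub>\<ge>\<^sub>0" for n
    using psd[of n] by (simp add: psd_upto_def)
  have "s \<longlonglongrightarrow> (\<Sum>i. mat_app p \<xi> i * cnj (\<xi> i))"
    unfolding s_def
  proof (rule suminf_tendsto_dominated)
    fix i
    have "(\<lambda>n. (\<Sum>j<n. p i j * \<xi> j) * cnj (\<xi> i)) \<longlonglongrightarrow> mat_app p \<xi> i * cnj (\<xi> i)"
      unfolding mat_app_def
      by (intro tendsto_intros summable_LIMSEQ mult_summable_of_square_bounds[OF \<tau>(2) R])
    moreover have "eventually (\<lambda>n. (\<Sum>j<n. p i j * \<xi> j) * cnj (\<xi> i)
        = (if i < n then (\<Sum>j<n. p i j * \<xi> j) * cnj (\<xi> i) else 0)) sequentially"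
      using eventually_gt_at_top[of i] by eventually_elim simp
    ultimately show "(\<lambda>n. if i < n then (\<Sum>j<n. p i j * \<xi> j) * cnj (\<xi> i) else 0) \<longlonglongrightarrow> mat_app p \<xi> i * cnj (\<xi> i)"
      by (rule Lim_transform_eventually)
  next
    show "summable (\<lambda>i. \<tau> i * R + (cmod (\<xi> i))\<^sup>2)"
      using \<xi> \<tau>(1) by (intro summable_add summable_mult2) (auto simp: ell2_def)
    fix i n
    have "(cmod (\<Sum>j<n. p i j * \<xi> j))\<^sup>2 \<le> \<tau> i * R"
      by (rule order_trans[OF cmod_sum_mult_le mult_mono[OF \<tau>(2) R]]) (auto simp: \<tau>0 sum_nonneg)
    moreover have "0 \<le> \<tau> i * R" by (simp add: \<tau>0 R_def)
    ultimately have "cmod (\<Sum>j<n. p i j * \<xi> j) * cmod (\<xi> i) \<le> \<tau> i * R + (cmod (\<xi> i))\<^sup>2"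
      using sum_squares_bound[of "cmod (\<Sum>j<n. p i j * \<xi> j)" "cmod (\<xi> i)"]
        mult_nonneg_nonneg[OF norm_ge_zero norm_ge_zero, of "\<Sum>j<n. p i j * \<xi> j" "\<xi> i"]
      by linarith
    with \<open>0 \<le> \<tau> i * R\<close> show "cmod (if i < n then (\<Sum>j<n. p i j * \<xi> j) * cnj (\<xi> i) else 0) \<le> \<tau> i * R + (cmod (\<xi> i))\<^sup>2"
      by (cases "i < n") (simp_all add: norm_mult)
  qed
  then show "(\<Sum>i. mat_app p \<xi> i * cnj (\<xi> i)) \<in> \<real>\<^sub>\<ge>\<^sub>0"
    by (rule closed_sequentially[OF closed_nonneg_Reals_complex pos])
qed

lemma hilbert_schmidt_product:
  fixes g h :: cmat
  assumes g: "\<And>n. (\<Sum>i<n. \<Sum>j<n. (cmod (g i j))\<^sup>2) \<le> A"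
    and h: "\<And>n. (\<Sum>i<n. \<Sum>j<n. (cmod (h i j))\<^sup>2) \<le> B"
  shows "(\<lambda>m. g i m * h m j) sums mat_mult g h i j"
    and "(\<Sum>i<n. \<Sum>j<n. (cmod (mat_mult g h i j))\<^sup>2) \<le> A * B"
proof -
  have gr: "(\<Sum>m<M. (cmod (g i m))\<^sup>2) \<le> A" for i M
  proof -
    have "0 \<le> (\<Sum>k<i. \<Sum>m<M. (cmod (g k m))\<^sup>2)" by (intro sum_nonneg) simp
    then show ?thesis using double_sum_square_le[OF g, where n = "Suc i" and m = M] by simp
  qed
  have hc: "(\<Sum>m<M. (cmod (h m j))\<^sup>2) \<le> B" for j M
  proof -
    have "(\<Sum>m<M. (cmod (h m j))\<^sup>2) \<le> (\<Sum>m<M. \<Sum>j<Suc j. (cmod (h m j))\<^sup>2)"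
      by (intro sum_mono) (simp add: sum_nonneg)
    then show ?thesis using double_sum_square_le[OF h, where n = M and m = "Suc j"] by linarith
  qed
  show s: "(\<lambda>m. g i m * h m j) sums mat_mult g h i j" for i j
    unfolding mat_mult_def by (rule summable_sums[OF mult_summable_of_square_bounds[OF gr hc]])
  show "(\<Sum>i<n. \<Sum>j<n. (cmod (mat_mult g h i j))\<^sup>2) \<le> A * B"
  proof (rule LIMSEQ_le_const2)
    show "(\<lambda>M. \<Sum>i<n. \<Sum>j<n. (cmod (\<Sum>m<M. g i m * h m j))\<^sup>2) \<longlonglongrightarrow> (\<Sum>i<n. \<Sum>j<n. (cmod (mat_mult g h i j))\<^sup>2)"
      by (intro tendsto_intros s[unfolded sums_def])
    have "(\<Sum>i<n. \<Sum>j<n. (cmod (\<Sum>m<M. g i m * h m j))\<^sup>2) \<le> A * B" for M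
    proof -
      have "(\<Sum>i<n. \<Sum>j<n. (cmod (\<Sum>m<M. g i m * h m j))\<^sup>2)
          \<le> (\<Sum>i<n. \<Sum>j<n. (\<Sum>m<M. (cmod (g i m))\<^sup>2) * (\<Sum>m<M. (cmod (h m j))\<^sup>2))"
        by (intro sum_mono cmod_sum_mult_le)
      also have "\<dots> = (\<Sum>i<n. \<Sum>m<M. (cmod (g i m))\<^sup>2) * (\<Sum>j<n. \<Sum>m<M. (cmod (h m j))\<^sup>2)"
        by (rule sum_product[symmetric])
      also have "(\<Sum>j<n. \<Sum>m<M. (cmod (h m j))\<^sup>2) = (\<Sum>m<M. \<Sum>j<n. (cmod (h m j))\<^sup>2)"
        by (rule sum.swap)
      also have "(\<Sum>i<n. \<Sum>m<M. (cmod (g i m))\<^sup>2) * (\<Sum>m<M. \<Sum>j<n. (cmod (h m j))\<^sup>2) \<le> A * B"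
        by (rule mult_mono[OF double_sum_square_le[OF g] double_sum_square_le[OF h]])
            (use g[of 0] in \<open>auto intro!: sum_nonneg\<close>)
      finally show ?thesis .
    qed
    then show "\<exists>N. \<forall>M\<ge>N. (\<Sum>i<n. \<Sum>j<n. (cmod (\<Sum>m<M. g i m * h m j))\<^sup>2) \<le> A * B" by blast
  qed
qed

text \<open>
  The absolute values of the finite sections converge entrywise along a subsequence. Their
  columns are dominated by those of \<open>T\<close>, so the products converge as well.
\<close>

lemma hilbert_schmidt_product_trace_class:
  fixes g h :: cmat
  assumes g: "\<And>n. (\<Sum>i<n. \<Sum>j<n. (cmod (g i j))\<^sup>2) \<le> A"
    and h: "\<And>n. (\<Sum>i<n. \<Sum>j<n. (cmod (h i j))\<^sup>2) \<le> B"
  shows "mat_mult g h \<in> trace_class"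
proof -
  define T where "T = mat_mult g h"
  have T: "(\<lambda>m. g i m * h m j) sums T i j" for i j
    unfolding T_def by (rule hilbert_schmidt_product(1)[OF g h])
  have HS: "(\<Sum>i<n. \<Sum>j<n. (cmod (T i j))\<^sup>2) \<le> A * B" for n
    unfolding T_def by (rule hilbert_schmidt_product(2)[OF g h])
  have cols: "(\<Sum>i<n. (cmod (T i j))\<^sup>2) \<le> A * B" for n j
  proof -
    have "(\<Sum>i<n. (cmod (T i j))\<^sup>2) \<le> (\<Sum>i<n. \<Sum>j<Suc j. (cmod (T i j))\<^sup>2)"
      by (intro sum_mono) (simp add: sum_nonneg)
    then show ?thesis using double_sum_square_le[OF HS, where n = n and m = "Suc j"] by linarith
  qed
  define \<tau> where "\<tau> j = (\<Sum>i. (cmod (T i j))\<^sup>2)" for j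
  have col_summable: "summable (\<lambda>i. (cmod (T i j))\<^sup>2)" for j
    using ell2_bounded(1)[OF cols, of j] by (simp add: ell2_def)
  have \<tau>: "(\<Sum>i<n. (cmod (T i j))\<^sup>2) \<le> \<tau> j" for n j
    unfolding \<tau>_def by (intro sum_le_suminf col_summable) auto
  have \<tau>0: "0 \<le> \<tau> j" for j using \<tau>[of j 0] by simp
  have \<tau>sum: "(\<Sum>j<n. \<tau> j) \<le> A * B" for n
  proof (rule LIMSEQ_le_const2)
    show "(\<lambda>m. \<Sum>j<n. \<Sum>i<m. (cmod (T i j))\<^sup>2) \<longlonglongrightarrow> (\<Sum>j<n. \<tau> j)"
      unfolding \<tau>_def by (intro tendsto_sum summable_LIMSEQ col_summable)
    have "(\<Sum>j<n. \<Sum>i<m. (cmod (T i j))\<^sup>2) \<le> A * B" for m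
      by (subst sum.swap) (rule double_sum_square_le[OF HS])
    then show "\<exists>N. \<forall>m\<ge>N. (\<Sum>j<n. \<Sum>i<m. (cmod (T i j))\<^sup>2) \<le> A * B" by blast
  qed
  have \<tau>_summable: "summable \<tau>"
    by (rule bounded_imp_summable[of _ "A * B"]) (auto simp: \<tau>0 \<tau>sum lessThan_Suc_atMost[symmetric] simp del: sum.lessThan_Suc)
  have \<tau>le: "\<tau> j \<le> A * B" for j
    using \<tau>sum[of "Suc j"] sum_nonneg[of "{..<j}" \<tau>, OF \<tau>0] by simp

  have "\<exists>U. unitary_upto n U \<and> psd_upto n (\<lambda>i j. \<Sum>k<n. cnj (U k i) * T k j)" for n
    by (rule finite_polar_decomposition[of n T]) blast
  then have "\<forall>n. \<exists>U. unitary_upto n U \<and> psd_upto n (\<lambda>i j. \<Sum>k<n. cnj (U k i) * T k j)"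
    by (rule allI)
  from choice[OF this] obtain U where
    U: "\<And>n. unitary_upto n (U n)" and psd: "\<And>n. psd_upto n (\<lambda>i j. \<Sum>k<n. cnj (U n k i) * T k j)"
    by (elim exE) (rule that, blast+)
  \<comment> \<open>The absolute value of the n-th section of \<open>T\<close>, padded with
    zeros.\<close>
  define P where "P n i j = (if i < n \<and> j < n then \<Sum>k<n. cnj (U n k i) * T k j else 0)" for n i j
  have P_sesq: "sesq m (P n) v v \<in> \<real>\<^sub>\<ge>\<^sub>0" if "m \<le> n" for m n v
  proof -
    define w where "w i = (if i < m then v i else 0)" for i
    have "sesq n (\<lambda>i j. \<Sum>k<n. cnj (U n k i) * T k j) w w = sesq n (P n) w w"
      unfolding sesq_def P_def by (intro sum.cong refl) auto
    also have "\<dots> = (\<Sum>i<m. \<Sum>j<n. P n i j * w j * cnj (w i))"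
      unfolding sesq_def using that by (intro sum.mono_neutral_right) (auto simp: w_def)
    also have "\<dots> = (\<Sum>i<m. \<Sum>j<m. P n i j * w j * cnj (w i))"
      using that by (intro sum.cong refl sum.mono_neutral_right) (auto simp: w_def)
    also have "\<dots> = sesq m (P n) v v"
      unfolding sesq_def w_def by (intro sum.cong refl) auto
    finally show ?thesis
      using psd[of n, unfolded psd_upto_def, rule_format, of w] by (simp only:)
  qed
  have Ph: "P n j i = cnj (P n i j)" for n i j
  proof (cases "i < n \<and> j < n")
    case True
    have "psd_upto n (P n)" using P_sesq by (simp add: psd_upto_def)
    from psd_upto_entry_cnj[OF this] True show ?thesis by blast
  next
    case False
    then show ?thesis by (auto simp: P_def)
  qed
  have Pcol: "(\<Sum>i<m. (cmod (P n i j))\<^sup>2) \<le> \<tau> j" for m n j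
  proof (cases "j < n")
    case True
    have "(\<Sum>i<m. (cmod (P n i j))\<^sup>2) \<le> (\<Sum>i<max m n. (cmod (P n i j))\<^sup>2)"
      by (rule sum_mono2) auto
    also have "\<dots> = (\<Sum>i<n. (cmod (P n i j))\<^sup>2)"
      by (rule sum.mono_neutral_right) (auto simp: P_def)
    also have "\<dots> = (\<Sum>k<n. (cmod (T k j))\<^sup>2)"
      using unitary_upto_adjoint_norm[OF U, of n "\<lambda>k. T k j"] True by (simp add: P_def)
    also have "\<dots> \<le> \<tau> j" by (rule \<tau>)
    finally show ?thesis .
  qed (simp add: P_def \<tau>0)
  have Pent: "(cmod (P n i j))\<^sup>2 \<le> \<tau> j" for n i j
    using Pcol[of n j "Suc i"] sum_nonneg[of "{..<i}" "\<lambda>i. (cmod (P n i j))\<^sup>2"] by simp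
  have Pent': "(cmod (P n i j))\<^sup>2 \<le> \<tau> i" for n i j
    using Pent[of n j i] Ph[of n i j] by simp
  \<comment> \<open>Hermitian symmetry turns the first factor into an adjoint, and the row relations
    of the unitary then remove it.\<close>
  have Psq: "(\<Sum>k. P n i k * P n k j) = (\<Sum>k<n. cnj (T k i) * T k j)" if "i < n" "j < n" for n i j
  proof -
    have "(\<Sum>k. P n i k * P n k j) = (\<Sum>k<n. P n i k * P n k j)"
      by (rule suminf_finite) (auto simp: P_def)
    also have "\<dots> = (\<Sum>k<n. cnj (P n k i) * P n k j)"
      by (simp add: Ph[of n i])
    also have "\<dots> = (\<Sum>m<n. (\<Sum>k<n. U n k m * cnj (T k i)) * (\<Sum>l<n. cnj (U n l m) * T l j))"
      using that by (intro sum.cong refl) (simp add: P_def)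
    also have "\<dots> = (\<Sum>m<n. \<Sum>k<n. \<Sum>l<n. cnj (T k i) * T l j * (U n k m * cnj (U n l m)))"
      unfolding sum_product by (simp only: mult_ac)
    also have "\<dots> = (\<Sum>k<n. \<Sum>l<n. \<Sum>m<n. cnj (T k i) * T l j * (U n k m * cnj (U n l m)))"
      by (subst sum.swap, rule sum.cong[OF refl], rule sum.swap)
    also have "\<dots> = (\<Sum>k<n. \<Sum>l<n. cnj (T k i) * T l j * (if k = l then 1 else 0))"
      using U[of n] by (intro sum.cong refl) (simp add: unitary_upto_def flip: sum_distrib_left)
    also have "\<dots> = (\<Sum>k<n. cnj (T k i) * T k j)"
      by (intro sum.cong refl) (simp add: mult_delta)
    finally show ?thesis .
  qed
  \<comment> \<open>The bound must be uniform in n for fixed m: since the diagonal is nonnegative,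
    the partial trace may be enlarged to the full one, to which the trace estimate applies.\<close>
  have Ptr: "Re (\<Sum>i<m. P n i i) \<le> sqrt A * sqrt B" if "m \<le> n" for m n
  proof -
    have d: "0 \<le> Re (P n i i)" if "i < n" for i
      using psd_upto_diagonal[of n "P n" i] P_sesq[of n n] that
      by (auto simp: psd_upto_def complex_nonneg_Reals_iff)
    have "Re (\<Sum>i<m. P n i i) = (\<Sum>i<m. Re (P n i i))" by simp
    also have "\<dots> \<le> (\<Sum>i<n. Re (P n i i))"
      using that by (intro sum_mono2) (auto intro: d)
    also have "\<dots> = Re (\<Sum>i<n. \<Sum>k<n. cnj (U n k i) * T k i)"
      by (simp add: P_def)
    also have "\<dots> \<le> sqrt A * sqrt B"
      by (rule polar_trace_le[OF g h T U])
    finally show ?thesis .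
  qed

  define W where "W n = (\<lambda>(i, j). P n i j)" for n
  have W: "norm (W n q) \<le> sqrt (A * B)" for n q
    using Pent[of n "fst q" "snd q"] \<tau>le[of "snd q"]
    by (auto simp: W_def case_prod_unfold intro!: real_le_rsqrt)
  obtain r f where r: "strict_mono (r :: nat \<Rightarrow> nat)" and f: "\<And>q. (\<lambda>n. W (r n) q) \<longlonglongrightarrow> f q"
    by (rule bounded_pointwise_subseq[of W "sqrt (A * B)", OF W]) (rule that)
  define p where "p i j = f (i, j)" for i j
  have p: "(\<lambda>n. P (r n) i j) \<longlonglongrightarrow> p i j" for i j
    using f[of "(i, j)"] by (simp add: p_def W_def)
  have r_ge: "n \<le> r n" for n by (rule seq_suble[OF r])
  have p_psd: "psd_upto m p" for m
    unfolding psd_upto_def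
  proof
    fix v
    \<comment> \<open>Shifting the index by m ensures m \<le> r (n + m), as positivity of the
      leading blocks requires.\<close>
    have "(\<lambda>n. sesq m (P (r (n + m))) v v) \<longlonglongrightarrow> sesq m p v v"
      unfolding sesq_def by (intro tendsto_intros LIMSEQ_ignore_initial_segment p)
    then show "sesq m p v v \<in> \<real>\<^sub>\<ge>\<^sub>0"
      by (rule closed_sequentially[OF closed_nonneg_Reals_complex, rotated])
        (rule P_sesq, use r_ge le_trans le_add2 in blast)
  qed
  have p_herm: "p j i = cnj (p i j)" for i j
    using psd_upto_entry_cnj[OF p_psd[of "Suc (max i j)"], of i j] by simp
  have p_col: "(\<Sum>i<m. (cmod (p i j))\<^sup>2) \<le> \<tau> j" for m j
    by (rule LIMSEQ_le_const2[of "\<lambda>n. \<Sum>i<m. (cmod (P (r n) i j))\<^sup>2"])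
      (intro tendsto_intros p, use Pcol in blast)
  have p_row: "(\<Sum>j<m. (cmod (p i j))\<^sup>2) \<le> \<tau> i" for m i
    using p_col[of i m] by (simp add: p_herm[of i])
  have p_pos: "positive_op p"
    by (rule positive_op_limit[OF \<tau>_summable p_row p_psd])
  have p_sq: "mat_mult p p = mat_mult (mat_adjoint T) T"
  proof (intro ext)
    fix i j
    have "(\<lambda>n. \<Sum>k. P (r n) i k * P (r n) k j) \<longlonglongrightarrow> (\<Sum>k. p i k * p k j)"
    proof (rule suminf_tendsto_dominated[OF _ _ \<tau>_summable])
      show "(\<lambda>n. P (r n) i k * P (r n) k j) \<longlonglongrightarrow> p i k * p k j" for k
        by (intro tendsto_intros p)
      \<comment> \<open>The first factor lies in column k and the second in row k, so both squares,
        and hence the product, are at most \<tau> k.\<close>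
      show "cmod (P (r n) i k * P (r n) k j) \<le> \<tau> k" for k n
        using sum_squares_bound[of "cmod (P (r n) i k)" "cmod (P (r n) k j)"] Pent[of "r n" i k] Pent'[of "r n" k j]
        by (simp add: norm_mult)
    qed
    moreover have "eventually (\<lambda>n. (\<Sum>k. P (r n) i k * P (r n) k j) = (\<Sum>k<r n. cnj (T k i) * T k j)) sequentially"
      using eventually_gt_at_top[of "max i j"]
    proof eventually_elim
      case (elim n)
      then have "i < r n" "j < r n" using r_ge[of n] by auto
      then show ?case by (rule Psq)
    qed
    ultimately have 1: "(\<lambda>n. \<Sum>k<r n. cnj (T k i) * T k j) \<longlonglongrightarrow> (\<Sum>k. p i k * p k j)"
      by (rule Lim_transform_eventually)
    have "(\<Sum>k<n. (cmod (cnj (T k i)))\<^sup>2) \<le> A * B" for n using cols[of i n] by simp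
    from mult_summable_of_square_bounds[OF this cols]
    have "(\<lambda>n. \<Sum>k<n. cnj (T k i) * T k j) \<longlonglongrightarrow> (\<Sum>k. cnj (T k i) * T k j)"
      by (rule summable_LIMSEQ)
    from LIMSEQ_subseq_LIMSEQ[OF this r] 1
    show "mat_mult p p i j = mat_mult (mat_adjoint T) T i j"
      unfolding mat_mult_def mat_adjoint_def o_def by (rule LIMSEQ_unique[symmetric])
  qed
  have p_diag: "p i i \<in> \<real>\<^sub>\<ge>\<^sub>0" for i
    by (rule psd_upto_diagonal[OF p_psd[of "Suc i"]]) simp
  have "Re (\<Sum>i<m. p i i) \<le> sqrt A * sqrt B" for m
  proof (rule LIMSEQ_le_const2)
    show "(\<lambda>n. Re (\<Sum>i<m. P (r n) i i)) \<longlonglongrightarrow> Re (\<Sum>i<m. p i i)"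
      by (intro tendsto_intros p)
    show "\<exists>N. \<forall>n\<ge>N. Re (\<Sum>i<m. P (r n) i i) \<le> sqrt A * sqrt B"
      using Ptr r_ge le_trans by blast
  qed
  then have "summable (\<lambda>i. Re (p i i))"
    using p_diag by (intro bounded_imp_summable[of _ "sqrt A * sqrt B"])
      (auto simp: complex_nonneg_Reals_iff lessThan_Suc_atMost[symmetric] simp del: sum.lessThan_Suc)
  then have "summable (\<lambda>i. complex_of_real (Re (p i i)))" by (rule summable_of_real)
  moreover have "complex_of_real (Re (p i i)) = p i i" for i
    using p_diag[of i] by (auto simp: complex_nonneg_Reals_iff complex_eq_iff)
  ultimately have "summable (\<lambda>i. p i i)" by simp
  with p_pos p_sq show ?thesis
    unfolding trace_class_def is_abs_op_def T_def[symmetric]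
    using hilbert_schmidt_bounded[OF HS] by blast
qed

subsection \<open>Multipliers dominated by a rank one matrix\<close>

text \<open>A bound on all rectangles is absolute convergence of the double series. It makes the
  iterated series in \<open>duality\<close> limits of truncated sums.\<close>

lemma double_series_summable:
  fixes f :: cmat
  assumes K: "\<And>N M. (\<Sum>i<N. \<Sum>j<M. cmod (f i j)) \<le> K"
  shows "summable (f i)" "summable (\<lambda>i. \<Sum>j. f i j)"
proof -
  have row: "(\<Sum>j<M. cmod (f i j)) \<le> K" for i M
  proof -
    have "0 \<le> (\<Sum>k<i. \<Sum>j<M. cmod (f k j))" by (intro sum_nonneg) simp
    then show ?thesis using K[of M "Suc i"] by simp
  qed
  have s: "summable (\<lambda>j. cmod (f i j))" for i
    by (rule bounded_imp_summable[of _ K])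
      (use row in \<open>auto simp: lessThan_Suc_atMost[symmetric] simp del: sum.lessThan_Suc\<close>)
  then show "summable (f i)" by (rule summable_norm_cancel)
  have "(\<Sum>i<N. \<Sum>j. cmod (f i j)) \<le> K" for N
    by (rule LIMSEQ_le_const2[of "\<lambda>M. \<Sum>i<N. \<Sum>j<M. cmod (f i j)"])
      (intro tendsto_sum summable_LIMSEQ s, use K in blast)
  then have "summable (\<lambda>i. \<Sum>j. cmod (f i j))"
    by (intro bounded_imp_summable[of _ K])
      (auto simp: lessThan_Suc_atMost[symmetric] suminf_nonneg s simp del: sum.lessThan_Suc)
  then show "summable (\<lambda>i. \<Sum>j. f i j)"
    by (rule summable_comparison_test'[of _ 0]) (rule summable_norm[OF s])
qed

lemma sum_Times: "(\<Sum>r\<in>P \<times> Q. F r) = (\<Sum>p\<in>P. \<Sum>q\<in>Q. F (p, q))"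
  by (simp add: sum.cartesian_product case_prod_unfold)

lemma duality_eq: "duality a b = (\<Sum>i. \<Sum>j. a i j * b i j)"
  by (simp add: duality_def mat_trace_def mat_mult_def mat_transpose_def)

locale dominated_multiplier =
  fixes \<phi> :: cmat and \<alpha> \<beta> :: "nat \<Rightarrow> real" and A B :: real
  assumes \<phi>: "\<And>i j. cmod (\<phi> i j) \<le> \<alpha> i * \<beta> j"
    and \<alpha>0: "\<And>i. 0 \<le> \<alpha> i" and \<beta>0: "\<And>j. 0 \<le> \<beta> j"
    and A: "\<And>n. (\<Sum>i<n. (\<alpha> i)\<^sup>2) \<le> A" and B: "\<And>n. (\<Sum>j<n. (\<beta> j)\<^sup>2) \<le> B"
begin

lemma A0: "0 \<le> A" and B0: "0 \<le> B"
  using A[of 0] B[of 0] by auto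

text \<open>A single Cauchy-Schwarz over the triples (i, j, q), with \<alpha> i attached to
  \<open>s\<close> and \<beta> j to \<open>t\<close>. The first factor then sums over j and q at
  fixed i, the second over i and q at fixed j: the row and column bounds that operator norms
  provide.\<close>

lemma multiplier_weighted_sum_le:
  fixes s t :: "'q \<Rightarrow> nat \<Rightarrow> nat \<Rightarrow> complex"
  assumes s: "\<And>i. (\<Sum>q\<in>Q. \<Sum>j<M. (cmod (s q i j))\<^sup>2) \<le> S"
    and t: "\<And>j. (\<Sum>q\<in>Q. \<Sum>i<N. (cmod (t q i j))\<^sup>2) \<le> T"
  shows "(\<Sum>i<N. \<Sum>j<M. cmod (\<phi> i j) * (\<Sum>q\<in>Q. cmod (s q i j) * cmod (t q i j))) \<le> sqrt (A * S) * sqrt (B * T)"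
proof -
  have S0: "0 \<le> S" by (rule order_trans[OF _ s]) (auto intro!: sum_nonneg)
  have T0: "0 \<le> T" by (rule order_trans[OF _ t]) (auto intro!: sum_nonneg)
  have "(\<Sum>i<N. \<Sum>j<M. cmod (\<phi> i j) * (\<Sum>q\<in>Q. cmod (s q i j) * cmod (t q i j)))
      \<le> (\<Sum>i<N. \<Sum>j<M. \<alpha> i * \<beta> j * (\<Sum>q\<in>Q. cmod (s q i j) * cmod (t q i j)))"
    by (intro sum_mono mult_right_mono \<phi> sum_nonneg) simp
  also have "\<dots> = (\<Sum>i<N. \<Sum>j<M. \<Sum>q\<in>Q. (\<alpha> i * cmod (s q i j)) * (\<beta> j * cmod (t q i j)))"
    by (simp add: sum_distrib_left mult_ac)
  also have "\<dots> = (\<Sum>r\<in>{..<N} \<times> {..<M} \<times> Q. (\<alpha> (fst r) * cmod (s (snd (snd r)) (fst r) (fst (snd r))))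
      * (\<beta> (fst (snd r)) * cmod (t (snd (snd r)) (fst r) (fst (snd r)))))"
    by (simp add: sum.cartesian_product case_prod_unfold)
  also have "\<dots> \<le> sqrt (A * S) * sqrt (B * T)"
  proof (rule sum_mult_le_sqrt)
    have "(\<Sum>r\<in>{..<N} \<times> {..<M} \<times> Q. (\<alpha> (fst r) * cmod (s (snd (snd r)) (fst r) (fst (snd r))))\<^sup>2)
        = (\<Sum>i<N. \<Sum>j<M. \<Sum>q\<in>Q. (\<alpha> i)\<^sup>2 * (cmod (s q i j))\<^sup>2)"
      by (simp add: sum.cartesian_product case_prod_unfold power_mult_distrib)
    also have "\<dots> = (\<Sum>i<N. (\<alpha> i)\<^sup>2 * (\<Sum>q\<in>Q. \<Sum>j<M. (cmod (s q i j))\<^sup>2))"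
      by (simp add: sum_distrib_left sum.swap[of _ Q])
    also have "\<dots> \<le> (\<Sum>i<N. (\<alpha> i)\<^sup>2 * S)" by (intro sum_mono mult_left_mono s) simp
    also have "\<dots> = (\<Sum>i<N. (\<alpha> i)\<^sup>2) * S" by (simp add: sum_distrib_right)
    also have "\<dots> \<le> A * S" by (intro mult_right_mono A S0)
    finally show "(\<Sum>r\<in>{..<N} \<times> {..<M} \<times> Q. (\<alpha> (fst r) * cmod (s (snd (snd r)) (fst r) (fst (snd r))))\<^sup>2) \<le> A * S" .
    have "(\<Sum>r\<in>{..<N} \<times> {..<M} \<times> Q. (\<beta> (fst (snd r)) * cmod (t (snd (snd r)) (fst r) (fst (snd r))))\<^sup>2)
        = (\<Sum>i<N. \<Sum>j<M. \<Sum>q\<in>Q. (\<beta> j)\<^sup>2 * (cmod (t q i j))\<^sup>2)"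
      by (simp add: sum.cartesian_product case_prod_unfold power_mult_distrib)
    also have "\<dots> = (\<Sum>j<M. \<Sum>i<N. \<Sum>q\<in>Q. (\<beta> j)\<^sup>2 * (cmod (t q i j))\<^sup>2)" by (rule sum.swap)
    also have "\<dots> = (\<Sum>j<M. (\<beta> j)\<^sup>2 * (\<Sum>q\<in>Q. \<Sum>i<N. (cmod (t q i j))\<^sup>2))"
      by (simp add: sum_distrib_left sum.swap[of _ Q])
    also have "\<dots> \<le> (\<Sum>j<M. (\<beta> j)\<^sup>2 * T)" by (intro sum_mono mult_left_mono t) simp
    also have "\<dots> = (\<Sum>j<M. (\<beta> j)\<^sup>2) * T" by (simp add: sum_distrib_right)
    also have "\<dots> \<le> B * T" by (intro mult_right_mono B T0)
    finally show "(\<Sum>r\<in>{..<N} \<times> {..<M} \<times> Q. (\<beta> (fst (snd r)) * cmod (t (snd (snd r)) (fst r) (fst (snd r))))\<^sup>2) \<le> B * T" .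
  qed
  finally show ?thesis .
qed

lemma duality_schur_summable:
  assumes "a \<in> bounded_ops" "b \<in> bounded_ops"
  shows "summable (\<lambda>j. schur_multiplier \<phi> a i j * b i j)"
    and "summable (\<lambda>i. \<Sum>j. schur_multiplier \<phi> a i j * b i j)"
proof -
  obtain Ca where Ca: "\<And>N i. (\<Sum>j<N. (cmod (a i j))\<^sup>2) \<le> Ca"
    using bounded_ops_entry_bounds[OF assms(1)] by metis
  obtain Cb where Cb: "\<And>N j. (\<Sum>i<N. (cmod (b i j))\<^sup>2) \<le> Cb"
    using bounded_ops_entry_bounds[OF assms(2)] by metis
  have "(\<Sum>i<N. \<Sum>j<M. cmod (schur_multiplier \<phi> a i j * b i j)) \<le> sqrt (A * Ca) * sqrt (B * Cb)" for N M
    using multiplier_weighted_sum_le[where Q = "{()}" and M = M and s = "\<lambda>_. a" and S = Ca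
        and N = N and t = "\<lambda>_. b" and T = Cb] Ca Cb
    by (simp add: schur_multiplier_def norm_mult mult_ac)
  from double_series_summable[OF this]
  show "summable (\<lambda>j. schur_multiplier \<phi> a i j * b i j)"
    and "summable (\<lambda>i. \<Sum>j. schur_multiplier \<phi> a i j * b i j)" by blast+
qed

text \<open>Writing the left side Z as a sum of z times its conjugate, the conjugate is absorbed
  into \<open>a\<close> and \<open>v\<close> into \<open>b\<close>. The weighted estimate gives Z
  \<le> sqrt (A Z) sqrt (B V), and a factor Z cancels after squaring. This is done for truncated
  pairings; the limits in M and then N follow the order of the iterated series.\<close>

lemma multiplier_pairing_bound:
  fixes a b :: "nat \<Rightarrow> nat \<Rightarrow> cmat" and v :: cmat
  assumes a: "\<And>k l. k < m \<Longrightarrow> l < m \<Longrightarrow> a k l \<in> bounded_ops" "op_norms m a \<le> 1"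
    and b: "\<And>p q. p < n \<Longrightarrow> q < n \<Longrightarrow> b p q \<in> bounded_ops" "op_norms n b \<le> 1"
  shows "(\<Sum>p<n. \<Sum>k<m. (cmod (\<Sum>q<n. \<Sum>l<m. duality (schur_multiplier \<phi> (a k l)) (b p q) * v q l))\<^sup>2)
    \<le> A * B * (\<Sum>q<n. \<Sum>l<m. (cmod (v q l))\<^sup>2)"
proof -
  define d where "d N M k l p q = (\<Sum>i<N. \<Sum>j<M. \<phi> i j * a k l i j * b p q i j)" for N M k l p q
  define z where "z N M p k = (\<Sum>q<n. \<Sum>l<m. d N M k l p q * v q l)" for N M p k
  define V where "V = (\<Sum>q<n. \<Sum>l<m. (cmod (v q l))\<^sup>2)"
  have V0: "0 \<le> V" unfolding V_def by (simp add: sum_nonneg)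
  have trunc: "(\<Sum>p<n. \<Sum>k<m. (cmod (z N M p k))\<^sup>2) \<le> A * B * V" for N M
  proof -
    define Z where "Z = (\<Sum>p<n. \<Sum>k<m. (cmod (z N M p k))\<^sup>2)"
    have Z0: "0 \<le> Z" unfolding Z_def by (simp add: sum_nonneg)
    \<comment> \<open>The sums over k and q go into \<open>s\<close> and \<open>t\<close>; the
      remaining indices p and l form the auxiliary index of the weighted estimate.\<close>
    define s where "s r i j = (\<Sum>k<m. a k (snd r) i j * cnj (z N M (fst r) k))" for r i j
    define t where "t r i j = (\<Sum>q<n. b (fst r) q i j * v q (snd r))" for r i j
    let ?Q = "{..<n} \<times> {..<m}"
    have s: "(\<Sum>r\<in>?Q. \<Sum>j<M. (cmod (s r i j))\<^sup>2) \<le> Z" for i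
    proof -
      have "(\<Sum>r\<in>?Q. \<Sum>j<M. (cmod (s r i j))\<^sup>2)
          = (\<Sum>p<n. \<Sum>l<m. \<Sum>j<M. (cmod (\<Sum>k<m. a k l i j * cnj (z N M p k)))\<^sup>2)"
        by (simp add: s_def sum_Times)
      also have "\<dots> \<le> (\<Sum>p<n. 1\<^sup>2 * (\<Sum>k<m. (cmod (cnj (z N M p k)))\<^sup>2))"
        by (intro sum_mono op_norms_row_bound) (use a in auto)
      also have "\<dots> = Z" by (simp add: Z_def)
      finally show ?thesis .
    qed
    have t: "(\<Sum>r\<in>?Q. \<Sum>i<N. (cmod (t r i j))\<^sup>2) \<le> V" for j
    proof -
      have "(\<Sum>r\<in>?Q. \<Sum>i<N. (cmod (t r i j))\<^sup>2)
          = (\<Sum>p<n. \<Sum>l<m. \<Sum>i<N. (cmod (\<Sum>q<n. b p q i j * v q l))\<^sup>2)"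
        by (simp add: t_def sum_Times)
      also have "\<dots> = (\<Sum>l<m. \<Sum>p<n. \<Sum>i<N. (cmod (\<Sum>q<n. b p q i j * v q l))\<^sup>2)"
        by (rule sum.swap)
      also have "\<dots> \<le> (\<Sum>l<m. 1\<^sup>2 * (\<Sum>q<n. (cmod (v q l))\<^sup>2))"
        by (intro sum_mono op_norms_column_bound) (use b in auto)
      also have "\<dots> = V" unfolding V_def by (subst sum.swap) simp
      finally show ?thesis .
    qed
    have "complex_of_real Z = (\<Sum>p<n. \<Sum>k<m. z N M p k * cnj (z N M p k))"
      unfolding Z_def of_real_sum complex_norm_square ..
    also have "\<dots> = (\<Sum>p<n. \<Sum>k<m. \<Sum>q<n. \<Sum>l<m. \<Sum>i<N. \<Sum>j<M.
        \<phi> i j * ((a k l i j * cnj (z N M p k)) * (b p q i j * v q l)))"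
      by (subst (1) z_def) (simp add: d_def sum_distrib_left sum_distrib_right mult_ac)
    also have "\<dots> = (\<Sum>u\<in>({..<n}\<times>{..<m}\<times>{..<n}\<times>{..<m})\<times>({..<N}\<times>{..<M}). case u of ((p,k,q,l),(i,j)) \<Rightarrow>
        \<phi> i j * ((a k l i j * cnj (z N M p k)) * (b p q i j * v q l)))"
      by (simp add: sum_Times)
    \<comment> \<open>All six sums are reordered by one bijection of index sets, which brings i and
      j to the outside.\<close>
    also have "\<dots> = (\<Sum>u\<in>({..<N}\<times>{..<M})\<times>({..<n}\<times>{..<m}\<times>{..<m}\<times>{..<n}). case u of ((i,j),(p,l,k,q)) \<Rightarrow>
        \<phi> i j * ((a k l i j * cnj (z N M p k)) * (b p q i j * v q l)))"
      by (rule sum.reindex_bij_witness[where i = "\<lambda>((i,j),(p,l,k,q)). ((p,k,q,l),(i,j))"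
            and j = "\<lambda>((p,k,q,l),(i,j)). ((i,j),(p,l,k,q))"]) auto
    also have "\<dots> = (\<Sum>i<N. \<Sum>j<M. \<Sum>p<n. \<Sum>l<m. \<Sum>k<m. \<Sum>q<n.
        \<phi> i j * ((a k l i j * cnj (z N M p k)) * (b p q i j * v q l)))"
      by (simp add: sum_Times)
    also have "\<dots> = (\<Sum>i<N. \<Sum>j<M. \<phi> i j * (\<Sum>p<n. \<Sum>l<m. s (p, l) i j * t (p, l) i j))"
      by (simp only: s_def t_def sum_product fst_conv snd_conv) (simp only: sum_distrib_left)
    also have "\<dots> = (\<Sum>i<N. \<Sum>j<M. \<phi> i j * (\<Sum>r\<in>?Q. s r i j * t r i j))"
      by (simp add: sum_Times)
    finally have "Z = cmod (\<Sum>i<N. \<Sum>j<M. \<phi> i j * (\<Sum>r\<in>?Q. s r i j * t r i j))"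
      using Z0 by (metis norm_of_real abs_of_nonneg)
    also have "\<dots> \<le> (\<Sum>i<N. \<Sum>j<M. cmod (\<phi> i j) * (\<Sum>r\<in>?Q. cmod (s r i j) * cmod (t r i j)))"
    proof (intro sum_norm_le)
      fix i j
      have "cmod (\<Sum>r\<in>?Q. s r i j * t r i j) \<le> (\<Sum>r\<in>?Q. cmod (s r i j) * cmod (t r i j))"
        by (rule sum_norm_le) (simp add: norm_mult)
      then show "cmod (\<phi> i j * (\<Sum>r\<in>?Q. s r i j * t r i j)) \<le> cmod (\<phi> i j) * (\<Sum>r\<in>?Q. cmod (s r i j) * cmod (t r i j))"
        by (simp add: norm_mult mult_left_mono)
    qed
    also have "\<dots> \<le> sqrt (A * Z) * sqrt (B * V)"
      by (rule multiplier_weighted_sum_le[OF s t])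
    finally have "Z\<^sup>2 \<le> (sqrt (A * Z) * sqrt (B * V))\<^sup>2"
      by (intro power_mono Z0)
    also have "\<dots> = (A * B * V) * Z"
      using A0 B0 V0 Z0 by (simp add: power_mult_distrib)
    finally have "Z * Z \<le> (A * B * V) * Z" by (simp add: power2_eq_square)
    moreover have "0 \<le> A * B * V" using A0 B0 V0 by simp
    ultimately show ?thesis unfolding Z_def[symmetric] using Z0
      by (cases "Z = 0") auto
  qed
  define d1 where "d1 N k l p q = (\<Sum>i<N. \<Sum>j. \<phi> i j * a k l i j * b p q i j)" for N k l p q
  have lim1: "(\<lambda>M. d N M k l p q) \<longlonglongrightarrow> d1 N k l p q" if "k < m" "l < m" "p < n" "q < n" for N k l p q
    unfolding d_def d1_def
    by (intro tendsto_sum summable_LIMSEQ duality_schur_summable(1)[OF a(1) b(1), unfolded schur_multiplier_def] that)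
  have lim2: "(\<lambda>N. d1 N k l p q) \<longlonglongrightarrow> duality (schur_multiplier \<phi> (a k l)) (b p q)"
    if "k < m" "l < m" "p < n" "q < n" for k l p q
    unfolding d1_def duality_eq schur_multiplier_def
    by (intro summable_LIMSEQ duality_schur_summable(2)[OF a(1) b(1), unfolded schur_multiplier_def] that)
  have "(\<Sum>p<n. \<Sum>k<m. (cmod (\<Sum>q<n. \<Sum>l<m. d1 N k l p q * v q l))\<^sup>2) \<le> A * B * V" for N
  proof (rule LIMSEQ_le_const2)
    show "(\<lambda>M. \<Sum>p<n. \<Sum>k<m. (cmod (z N M p k))\<^sup>2) \<longlonglongrightarrow> (\<Sum>p<n. \<Sum>k<m. (cmod (\<Sum>q<n. \<Sum>l<m. d1 N k l p q * v q l))\<^sup>2)"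
      unfolding z_def by (intro tendsto_intros lim1) auto
  qed (use trunc in blast)
  then show ?thesis
    unfolding V_def[symmetric]
    by (intro LIMSEQ_le_const2[of "\<lambda>N. \<Sum>p<n. \<Sum>k<m. (cmod (\<Sum>q<n. \<Sum>l<m. d1 N k l p q * v q l))\<^sup>2"])
      (intro tendsto_intros lim2, auto)
qed

text \<open>The Schur product is the diagonal matrix of \<alpha> times a matrix whose j-th column is
  dominated by \<beta> j times that of \<open>a\<close>. Columns of \<open>a\<close> being bounded
  in norm, both factors are Hilbert-Schmidt.\<close>

lemma schur_multiplier_trace_class:
  assumes a: "a \<in> bounded_ops"
  shows "schur_multiplier \<phi> a \<in> trace_class"
proof -
  define g :: cmat where "g i m = (if m = i then complex_of_real (\<alpha> i) else 0)" for i m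
  \<comment> \<open>Where \<alpha> m = 0 the quotient is 0 by convention, which is consistent:
    \<phi> vanishes on that row.\<close>
  define h :: cmat where "h m j = \<phi> m j * a m j / complex_of_real (\<alpha> m)" for m j
  obtain Ca where Ca: "0 \<le> Ca" "\<And>N j. (\<Sum>i<N. (cmod (a i j))\<^sup>2) \<le> Ca"
    using bounded_ops_entry_bounds[OF a] by metis
  have hb: "cmod (h m j) \<le> \<beta> j * cmod (a m j)" for m j
  proof (cases "\<alpha> m = 0")
    case False
    then have "0 < \<alpha> m" using \<alpha>0[of m] by simp
    then show ?thesis
      using mult_right_mono[OF \<phi>[of m j] norm_ge_zero[of "a m j"]]
      by (simp add: h_def norm_mult norm_divide divide_le_eq mult_ac)
  qed (simp add: h_def \<beta>0)
  have "mat_mult g h i j = schur_multiplier \<phi> a i j" for i j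
  proof -
    have "mat_mult g h i j = (\<Sum>m\<in>{i}. g i m * h m j)"
      unfolding mat_mult_def by (rule suminf_finite) (auto simp: g_def)
    also have "\<dots> = schur_multiplier \<phi> a i j"
      using \<phi>[of i j] by (cases "\<alpha> i = 0") (auto simp: g_def h_def schur_multiplier_def)
    finally show ?thesis .
  qed
  then have eq: "schur_multiplier \<phi> a = mat_mult g h" by (intro ext) simp
  show ?thesis unfolding eq
  proof (rule hilbert_schmidt_product_trace_class)
    fix n
    have "(\<Sum>i<n. \<Sum>m<n. (cmod (g i m))\<^sup>2) = (\<Sum>i<n. \<Sum>m<n. if m = i then (\<alpha> i)\<^sup>2 else 0)"
      by (intro sum.cong refl) (auto simp: g_def)
    then show "(\<Sum>i<n. \<Sum>m<n. (cmod (g i m))\<^sup>2) \<le> A" using A[of n] by simp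
    have "(\<Sum>m<n. \<Sum>j<n. (cmod (h m j))\<^sup>2) \<le> (\<Sum>m<n. \<Sum>j<n. (\<beta> j * cmod (a m j))\<^sup>2)"
      by (intro sum_mono power_mono hb) simp
    also have "\<dots> = (\<Sum>j<n. (\<beta> j)\<^sup>2 * (\<Sum>m<n. (cmod (a m j))\<^sup>2))"
      by (subst sum.swap) (simp add: power_mult_distrib sum_distrib_left)
    also have "\<dots> \<le> (\<Sum>j<n. (\<beta> j)\<^sup>2 * Ca)" by (intro sum_mono mult_left_mono Ca) simp
    also have "\<dots> \<le> B * Ca" unfolding sum_distrib_right[symmetric] by (intro mult_right_mono B Ca)
    finally show "(\<Sum>m<n. \<Sum>j<n. (cmod (h m j))\<^sup>2) \<le> B * Ca" .
  qed
qed

lemma completely_bounded_on_bounded_ops: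
  "completely_bounded bounded_ops op_norms trace_class S1_norms (schur_multiplier \<phi>)"
  unfolding completely_bounded_def
proof (intro conjI ballI allI)
  show "schur_multiplier \<phi> a \<in> trace_class" if "a \<in> bounded_ops" for a
    by (rule schur_multiplier_trace_class[OF that])
  show "schur_multiplier \<phi> (\<lambda>i j. c * a i j + b i j) = (\<lambda>i j. c * schur_multiplier \<phi> a i j + schur_multiplier \<phi> b i j)" for a b c
    by (simp add: schur_multiplier_def fun_eq_iff algebra_simps)
  have "cb_norm bounded_ops op_norms S1_norms (schur_multiplier \<phi>) \<le> ennreal (sqrt (A * B))"
    unfolding cb_norm_def S1_norms_def Mn_norms_def fin_op_norm_def
  proof (intro SUP_least, elim CollectE conjE, intro ennreal_leI)
    fix m a n b v
    assume a: "\<forall>p<m. \<forall>q<m. a p q \<in> bounded_ops" "op_norms m a \<le> 1"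
      and b: "\<forall>p<n. \<forall>q<n. b p q \<in> compact_ops" "op_norms n b \<le> 1"
      and v: "(\<Sum>i\<in>{..<n} \<times> {..<m}. (cmod (v i))\<^sup>2) \<le> 1"
    have v': "(\<Sum>q<n. \<Sum>l<m. (cmod (v (q, l)))\<^sup>2) \<le> 1"
      using v by (simp add: sum.cartesian_product case_prod_unfold)
    have "(\<Sum>i\<in>{..<n} \<times> {..<m}. (cmod (\<Sum>j\<in>{..<n} \<times> {..<m}.
        (case i of (p, k) \<Rightarrow> \<lambda>(q, l). duality (schur_multiplier \<phi> (a k l)) (b p q)) j * v j))\<^sup>2)
      = (\<Sum>p<n. \<Sum>k<m. (cmod (\<Sum>q<n. \<Sum>l<m. duality (schur_multiplier \<phi> (a k l)) (b p q) * v (q, l)))\<^sup>2)"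
      by (simp add: sum_Times)
    also have "\<dots> \<le> A * B * (\<Sum>q<n. \<Sum>l<m. (cmod (v (q, l)))\<^sup>2)"
      by (rule multiplier_pairing_bound) (use a b in \<open>auto simp: compact_ops_def\<close>)
    also have "\<dots> \<le> A * B" using v' A0 B0 by (simp add: mult_left_le)
    finally show "sqrt (\<Sum>i\<in>{..<n} \<times> {..<m}. (cmod (\<Sum>j\<in>{..<n} \<times> {..<m}.
        (case i of (p, k) \<Rightarrow> \<lambda>(q, l). duality (schur_multiplier \<phi> (a k l)) (b p q)) j * v j))\<^sup>2) \<le> sqrt (A * B)"
      by simp
  qed
  also have "\<dots> < \<infinity>" by simp
  finally show "cb_norm bounded_ops op_norms S1_norms (schur_multiplier \<phi>) < \<infinity>" .
qed

end

text \<open>A column times a row, stored in column 0 and row 0 of two otherwise zero matrices, both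
  Hilbert-Schmidt.\<close>

lemma rank_one_trace_class:
  assumes "x \<in> ell2" "y \<in> ell2"
  shows "(\<lambda>i j. x i * y j) \<in> trace_class"
proof -
  define g :: cmat where "g i m = (if m = 0 then x i else 0)" for i m
  define h :: cmat where "h m j = (if m = 0 then y j else 0)" for m j
  have "mat_mult g h i j = (\<Sum>m\<in>{0}. g i m * h m j)" for i j
    unfolding mat_mult_def by (rule suminf_finite) (auto simp: g_def)
  then have eq: "(\<lambda>i j. x i * y j) = mat_mult g h" by (simp add: fun_eq_iff g_def h_def)
  show ?thesis unfolding eq
  proof (rule hilbert_schmidt_product_trace_class)
    fix n
    have "(\<Sum>i<n. \<Sum>m<n. (cmod (g i m))\<^sup>2) \<le> (\<Sum>i<n. (cmod (x i))\<^sup>2)"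
      by (intro sum_mono) (cases n, auto simp: g_def if_distrib[of cmod] if_distrib[of "\<lambda>x. x\<^sup>2"] cong: if_cong)
    also have "\<dots> \<le> (ell2_norm x)\<^sup>2" by (rule ell2_sum_le[OF assms(1)]) simp
    finally show "(\<Sum>i<n. \<Sum>m<n. (cmod (g i m))\<^sup>2) \<le> (ell2_norm x)\<^sup>2" .
    have "(\<Sum>m<n. \<Sum>j<n. (cmod (h m j))\<^sup>2) = (\<Sum>j<n. \<Sum>m<n. (cmod (h m j))\<^sup>2)" by (rule sum.swap)
    also have "\<dots> \<le> (\<Sum>j<n. (cmod (y j))\<^sup>2)"
      by (intro sum_mono) (cases n, auto simp: h_def if_distrib[of cmod] if_distrib[of "\<lambda>x. x\<^sup>2"] cong: if_cong)
    also have "\<dots> \<le> (ell2_norm y)\<^sup>2" by (rule ell2_sum_le[OF assms(2)]) simp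
    finally show "(\<Sum>m<n. \<Sum>j<n. (cmod (h m j))\<^sup>2) \<le> (ell2_norm y)\<^sup>2" .
  qed
qed

subsection \<open>Rank one domination of trace class matrices\<close>

text \<open>Compactness: K does not depend on the section, so the weights converge pointwise along a
  subsequence, and the bounds on partial sums and the product inequalities survive the limit.
  Treating f and g as one sequence of pairs yields a common subsequence. Square roots of the limits
  are the two vectors.\<close>

lemma rank_one_domination_of_sections:
  fixes \<psi> :: "nat \<Rightarrow> nat \<Rightarrow> real"
  assumes \<psi>0: "\<And>i j. 0 \<le> \<psi> i j"
    and sections: "\<And>n. \<exists>f g. (\<forall>i<n. 0 \<le> f i) \<and> (\<forall>j<n. 0 \<le> g j) \<and> (\<Sum>i<n. f i) \<le> K \<and> (\<Sum>j<n. g j) \<le> K \<and>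
      (\<forall>i<n. \<forall>j<n. (\<psi> i j)\<^sup>2 \<le> f i * g j)"
  obtains x y where "x \<in> ell2" "y \<in> ell2" "\<And>i j. \<psi> i j \<le> cmod (x i) * cmod (y j)"
proof -
  define good where "good n h \<longleftrightarrow> (\<forall>i<n. 0 \<le> fst (h i)) \<and> (\<forall>j<n. 0 \<le> snd (h j)) \<and>
      (\<Sum>i<n. fst (h i)) \<le> K \<and> (\<Sum>j<n. snd (h j)) \<le> K \<and>
      (\<forall>i<n. \<forall>j<n. (\<psi> i j)\<^sup>2 \<le> fst (h i) * snd (h j))" for n and h :: "nat \<Rightarrow> real \<times> real"
  have "\<exists>h. good n h" for n
  proof -
    obtain f g where "(\<forall>i<n. 0 \<le> f i) \<and> (\<forall>j<n. 0 \<le> g j) \<and> (\<Sum>i<n. f i) \<le> K \<and> (\<Sum>j<n. g j) \<le> K \<and>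
      (\<forall>i<n. \<forall>j<n. (\<psi> i j)\<^sup>2 \<le> f i * g j)" using sections[of n] by blast
    then have "good n (\<lambda>i. (f i, g i))" unfolding good_def by simp
    then show ?thesis by blast
  qed
  then have "\<forall>n. \<exists>h. good n h" by blast
  from choice[OF this] obtain H where H: "\<And>n. good n (H n)" by blast
  have le: "fst (H n i) \<le> K" "snd (H n i) \<le> K" if "i < n" for n i
    using H[of n] that member_le_sum[of i "{..<n}" "\<lambda>i. fst (H n i)"] member_le_sum[of i "{..<n}" "\<lambda>i. snd (H n i)"]
    unfolding good_def by force+
  have K0: "0 \<le> K" using H[of 0] unfolding good_def by simp
  define W where "W n i = (if i < n then H n i else 0)" for n i
  have W: "norm (W n i) \<le> 2 * K" for n i
  proof (cases "i < n")
    case True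
    then have "0 \<le> fst (H n i)" "0 \<le> snd (H n i)" using H[of n] unfolding good_def by auto
    then have "norm (H n i) \<le> fst (H n i) + snd (H n i)"
      using norm_Pair_le[of "fst (H n i)" "snd (H n i)"] by simp
    then show ?thesis using le[OF True] by (simp add: W_def True)
  qed (simp add: W_def K0)
  obtain r h where r: "strict_mono (r :: nat \<Rightarrow> nat)" and h: "\<And>i. (\<lambda>n. W (r n) i) \<longlonglongrightarrow> h i"
    by (rule bounded_pointwise_subseq[of W "2 * K", OF W]) (rule that)
  define f where "f i = fst (h i)" for i
  define g where "g i = snd (h i)" for i
  have f: "(\<lambda>n. fst (W (r n) i)) \<longlonglongrightarrow> f i" and g: "(\<lambda>n. snd (W (r n) i)) \<longlonglongrightarrow> g i" for i
    unfolding f_def g_def by (intro tendsto_fst tendsto_snd h)+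
  have nonneg: "0 \<le> fst (W n i)" "0 \<le> snd (W n i)" for n i
    using H[of n] unfolding good_def W_def by auto
  have part: "(\<Sum>i<m. fst (W n i)) \<le> K" "(\<Sum>i<m. snd (W n i)) \<le> K" for n m
  proof -
    have "(\<Sum>i<m. fst (W n i)) \<le> (\<Sum>i<max m n. fst (W n i))" by (rule sum_mono2) (auto simp: nonneg)
    also have "\<dots> = (\<Sum>i<n. fst (H n i))" by (rule sum.mono_neutral_cong_right) (auto simp: W_def)
    finally show "(\<Sum>i<m. fst (W n i)) \<le> K" using H[of n] unfolding good_def by linarith
    have "(\<Sum>i<m. snd (W n i)) \<le> (\<Sum>i<max m n. snd (W n i))" by (rule sum_mono2) (auto simp: nonneg)
    also have "\<dots> = (\<Sum>i<n. snd (H n i))" by (rule sum.mono_neutral_cong_right) (auto simp: W_def)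
    finally show "(\<Sum>i<m. snd (W n i)) \<le> K" using H[of n] unfolding good_def by linarith
  qed
  have f0: "0 \<le> f i" and g0: "0 \<le> g i" for i
    by (rule LIMSEQ_le_const[OF f], use nonneg in blast) (rule LIMSEQ_le_const[OF g], use nonneg in blast)
  have "(\<Sum>i<m. f i) \<le> K" for m
    by (rule LIMSEQ_le_const2[of "\<lambda>n. \<Sum>i<m. fst (W (r n) i)"]) (intro tendsto_sum f, use part in blast)
  then have x: "(\<lambda>i. complex_of_real (sqrt (f i))) \<in> ell2"
    by (intro ell2_bounded(1)[of _ K]) (simp add: f0)
  have "(\<Sum>i<m. g i) \<le> K" for m
    by (rule LIMSEQ_le_const2[of "\<lambda>n. \<Sum>i<m. snd (W (r n) i)"]) (intro tendsto_sum g, use part in blast)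
  then have y: "(\<lambda>i. complex_of_real (sqrt (g i))) \<in> ell2"
    by (intro ell2_bounded(1)[of _ K]) (simp add: g0)
  have "(\<psi> i j)\<^sup>2 \<le> f i * g j" for i j
  proof (rule LIMSEQ_le_const)
    show "(\<lambda>n. fst (W (r n) i) * snd (W (r n) j)) \<longlonglongrightarrow> f i * g j" by (intro tendsto_mult f g)
    have "(\<psi> i j)\<^sup>2 \<le> fst (W (r n) i) * snd (W (r n) j)" if "n \<ge> Suc (max i j)" for n
    proof -
      have "i < r n" "j < r n" using that seq_suble[OF r, of n] by auto
      then show ?thesis using H[of "r n"] unfolding good_def W_def by simp
    qed
    then show "\<exists>N. \<forall>n\<ge>N. (\<psi> i j)\<^sup>2 \<le> fst (W (r n) i) * snd (W (r n) j)" by blast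
  qed
  then have "\<psi> i j \<le> sqrt (f i * g j)" for i j by (rule real_le_rsqrt)
  then show thesis by (intro that[OF x y]) (simp add: f0 g0 real_sqrt_mult)
qed

section \<open>Gram-Schmidt for a possibly degenerate positive form\<close>

abbreviation unit_vec :: "nat \<Rightarrow> vec" where
  "unit_vec j \<equiv> (\<lambda>k. if k = j then 1 else 0)"

lemma sesq_sum_left: "sesq n p (\<lambda>i. \<Sum>k\<in>A. c k * u k i) v = (\<Sum>k\<in>A. c k * sesq n p (u k) v)"
proof (induction A rule: infinite_finite_induct)
  case (insert k A)
  then show ?case by (simp add: sesq_add_left sesq_scale_left)
qed (simp_all add: sesq_def)

lemma sesq_diff_left: "sesq n p (\<lambda>i. u i - u' i) v = sesq n p u v - sesq n p u' v"
  using sesq_add_left[of n p u "\<lambda>i. (-1) * u' i" v] unfolding sesq_scale_left by simp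

lemma sesq_support:
  assumes "\<And>i. i \<ge> n \<Longrightarrow> u i = 0" "\<And>i. i \<ge> n \<Longrightarrow> v i = 0" "n \<le> N"
  shows "sesq N p u v = sesq n p u v"
proof -
  have "sesq N p u v = (\<Sum>i<n. \<Sum>j<N. p i j * u j * cnj (v i))"
    unfolding sesq_def using assms by (intro sum.mono_neutral_right) auto
  also have "\<dots> = sesq n p u v"
    unfolding sesq_def using assms by (intro sum.cong refl sum.mono_neutral_right) auto
  finally show ?thesis .
qed

text \<open>Cauchy-Schwarz for a degenerate form: adding multiples of z to w changes the value of
  the form linearly in the parameter, and a linear function that stays nonnegative has slope
  zero.\<close>

lemma psd_upto_null:
  assumes "psd_upto n p" "sesq n p z z = 0"
  shows "sesq n p z w = 0"
proof -
  define q where "q = sesq n p z w"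
  have "0 \<le> - 2 * s * (cmod q)\<^sup>2 + Re (sesq n p w w)" for s
  proof -
    define c where "c = - complex_of_real s * cnj q"
    have "sesq n p (\<lambda>i. c * z i + w i) (\<lambda>i. c * z i + w i) = c * q + cnj (c * q) + sesq n p w w"
      using assms(2) psd_upto_hermitian[OF assms(1), of w z]
      by (simp add: sesq_add_left sesq_add_right sesq_scale_left sesq_scale_right q_def)
    moreover have "c * q = - complex_of_real (s * (cmod q)\<^sup>2)"
      unfolding c_def of_real_mult complex_norm_square by (simp add: mult_ac)
    ultimately have "Re (sesq n p (\<lambda>i. c * z i + w i) (\<lambda>i. c * z i + w i)) = - 2 * s * (cmod q)\<^sup>2 + Re (sesq n p w w)"
      by simp
    then show ?thesis using assms(1) unfolding psd_upto_def complex_nonneg_Reals_iff by metis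
  qed
  \<comment> \<open>With this s the right side is -2 minus the nonnegative value of the form at w,
    hence negative.\<close>
  from this[of "(Re (sesq n p w w) + 1) / (cmod q)\<^sup>2"]
  show ?thesis
    using assms(1) unfolding psd_upto_def complex_nonneg_Reals_iff q_def[symmetric]
    by (cases "q = 0") (auto dest: spec[of _ w])
qed

definition orthonormal_upto :: "nat \<Rightarrow> cmat \<Rightarrow> nat \<Rightarrow> (nat \<Rightarrow> vec) \<Rightarrow> bool" where
  "orthonormal_upto n p m u \<longleftrightarrow> (\<forall>k<m. \<forall>l<m. sesq n p (u k) (u l) = (if k = l then 1 else 0))"

context
  fixes n :: nat and p :: cmat and m :: nat and u :: "nat \<Rightarrow> vec" and w z :: vec
  assumes psd: "psd_upto n p" and on: "orthonormal_upto n p m u"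
    and z: "z = (\<lambda>i. w i - (\<Sum>k<m. sesq n p w (u k) * u k i))"
begin

lemma residual_orthogonal: "l < m \<Longrightarrow> sesq n p z (u l) = 0"
  using on unfolding z sesq_diff_left sesq_sum_left orthonormal_upto_def by (simp add: mult_delta)

text \<open>Pythagoras for the projection of w onto the span of the \<open>u k\<close>, in the
  geometry of \<open>p\<close>.\<close>

lemma residual_norm: "sesq n p z z = sesq n p w w - of_real (\<Sum>k<m. (cmod (sesq n p w (u k)))\<^sup>2)"
proof -
  have o': "sesq n p (u l) z = 0" if "l < m" for l
    using residual_orthogonal[OF that] psd_upto_hermitian[OF psd, of "u l" z] by simp
  have "sesq n p z z = sesq n p w z"
    by (subst (1) z) (simp add: sesq_diff_left sesq_sum_left o')
  also have "\<dots> = cnj (sesq n p z w)" by (rule psd_upto_hermitian[OF psd])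
  also have "sesq n p z w = sesq n p w w - (\<Sum>k<m. sesq n p w (u k) * sesq n p (u k) w)"
    by (simp add: z sesq_diff_left sesq_sum_left)
  also have "(\<Sum>k<m. sesq n p w (u k) * sesq n p (u k) w) = of_real (\<Sum>k<m. (cmod (sesq n p w (u k)))\<^sup>2)"
    unfolding of_real_sum complex_norm_square by (intro sum.cong refl) (simp flip: psd_upto_hermitian[OF psd])
  finally show ?thesis using psd_upto_hermitian[OF psd, of w w] by simp
qed

lemma bessel: "(\<Sum>k<m. (cmod (sesq n p w (u k)))\<^sup>2) \<le> Re (sesq n p w w)"
  using psd residual_norm unfolding psd_upto_def complex_nonneg_Reals_iff
  by (metis Re_complex_of_real diff_ge_0_iff_ge minus_complex.sel(1))

end

text \<open>The Parseval identity says that the residual of each basis vector is null for the form.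
  It replaces a spanning statement, which can fail when the form is degenerate. For the same reason
  m may be smaller than n: a basis vector with null residual adds no new member.\<close>

lemma gram_schmidt:
  assumes psd: "\<And>n. psd_upto n p"
  shows "\<exists>m u. (\<forall>k<m. \<forall>i\<ge>n. u k i = 0) \<and> orthonormal_upto n p m u \<and>
    (\<forall>j<n. Re (p j j) = (\<Sum>k<m. (cmod (sesq n p (unit_vec j) (u k)))\<^sup>2))"
proof (induction n)
  case 0
  show ?case by (intro exI[of _ 0]) (simp add: orthonormal_upto_def)
next
  case (Suc n)
  then obtain m u where supp: "\<And>k i. k < m \<Longrightarrow> i \<ge> n \<Longrightarrow> u k i = 0" and on: "orthonormal_upto n p m u"
    and pars: "\<And>j. j < n \<Longrightarrow> Re (p j j) = (\<Sum>k<m. (cmod (sesq n p (unit_vec j) (u k)))\<^sup>2)"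
    by blast
  have S: "sesq (Suc n) p (u k) (u l) = sesq n p (u k) (u l)" if "k < m" "l < m" for k l
    using that by (intro sesq_support) (auto simp: supp)
  have on': "orthonormal_upto (Suc n) p m u"
    using on by (simp add: orthonormal_upto_def S)
  have S': "sesq (Suc n) p (unit_vec j) (u k) = sesq n p (unit_vec j) (u k)" if "j < n" "k < m" for j k
    using that by (intro sesq_support) (auto simp: supp)
  define z where "z = (\<lambda>i. unit_vec n i - (\<Sum>k<m. sesq (Suc n) p (unit_vec n) (u k) * u k i))"
  define q where "q = Re (p n n) - (\<Sum>k<m. (cmod (sesq (Suc n) p (unit_vec n) (u k)))\<^sup>2)"
  have pr: "complex_of_real (Re (p j j)) = p j j" for j
    using psd_upto_diagonal[OF psd[of "Suc j"], of j] by (auto simp: complex_nonneg_Reals_iff complex_eq_iff)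
  have un: "sesq (Suc n) p (unit_vec j) (unit_vec j) = p j j" if "j < Suc n" for j
    using sesq_unit[OF that that] .
  have zz: "sesq (Suc n) p z z = of_real q"
    unfolding residual_norm[OF psd on' z_def] un[OF lessI] q_def of_real_diff pr ..
  have q0: "0 \<le> q"
    using psd[of "Suc n"] zz unfolding psd_upto_def by (metis nonneg_Reals_of_real_iff)
  show ?case
  proof (cases "q = 0")
    case True
    have "Re (p j j) = (\<Sum>k<m. (cmod (sesq (Suc n) p (unit_vec j) (u k)))\<^sup>2)" if "j < Suc n" for j
    proof (cases "j = n")
      case True
      then show ?thesis using \<open>q = 0\<close> by (simp add: q_def)
    next
      case False
      then show ?thesis using that by (simp add: pars S')
    qed
    then show ?thesis using supp on' by (intro exI[of _ m] exI[of _ u]) auto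
  next
    case False
    then have q: "0 < q" using q0 by simp
    define c where "c = complex_of_real (1 / sqrt q)"
    define u' where "u' = u(m := (\<lambda>i. c * z i))"
    have zu: "sesq (Suc n) p z (u l) = 0" if "l < m" for l
      by (rule residual_orthogonal[OF psd on' z_def that])
    have uz: "sesq (Suc n) p (u l) z = 0" if "l < m" for l
      using zu[OF that] psd_upto_hermitian[OF psd, of "Suc n" "u l" z] by simp
    have c: "cnj c * (c * complex_of_real q) = 1"
      using q by (simp add: c_def flip: of_real_mult)
    have on'': "orthonormal_upto (Suc n) p (Suc m) u'"
      using on' unfolding orthonormal_upto_def u'_def
      by (auto simp: less_Suc_eq sesq_scale_left sesq_scale_right zu uz zz c)
    \<comment> \<open>Bessel for the enlarged family, against Parseval for the old one, forces
      equality for the earlier basis vectors without computing their new coefficient.\<close>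
    have bes: "(\<Sum>k<Suc m. (cmod (sesq (Suc n) p (unit_vec j) (u' k)))\<^sup>2) \<le> Re (p j j)" if "j < Suc n" for j
      using bessel[OF psd on'' refl, of "unit_vec j"] unfolding un[OF that] .
    have "Re (p j j) = (\<Sum>k<Suc m. (cmod (sesq (Suc n) p (unit_vec j) (u' k)))\<^sup>2)" if "j < Suc n" for j
    proof (cases "j = n")
      case True
      have "sesq (Suc n) p z z = sesq (Suc n) p (unit_vec n) z"
        by (subst (1) z_def) (simp add: sesq_diff_left sesq_sum_left uz)
      then have "sesq (Suc n) p (unit_vec n) (\<lambda>i. c * z i) = cnj c * of_real q"
        by (simp add: sesq_scale_right zz)
      moreover have "(cmod (cnj c * of_real q))\<^sup>2 = q"
        using q by (simp add: c_def norm_mult norm_divide power_mult_distrib power_divide power2_eq_square)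
      ultimately show ?thesis using True by (simp add: u'_def q_def)
    next
      case False
      then have "j < n" using that by simp
      then have "Re (p j j) \<le> (\<Sum>k<Suc m. (cmod (sesq (Suc n) p (unit_vec j) (u' k)))\<^sup>2)"
        by (simp add: pars S' u'_def)
      with bes[OF that] show ?thesis by simp
    qed
    moreover have "u' k i = 0" if "k < Suc m" "i \<ge> Suc n" for k i
      using that by (auto simp: u'_def less_Suc_eq z_def supp)
    ultimately show ?thesis using on'' by blast
  qed
qed

text \<open>The squared norm of a v is the form of the adjoint of \<open>a\<close> times
  \<open>a\<close>. Operators with the same such product have equal norms on finitely supported
  vectors; this is how T is compared with its absolute value.\<close>

lemma column_norm_sums:
  fixes a :: cmat
  assumes "a \<in> bounded_ops"
  shows "(\<lambda>k. complex_of_real ((cmod (\<Sum>j<n. a k j * v j))\<^sup>2)) sums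
    (\<Sum>i<n. \<Sum>j<n. mat_mult (mat_adjoint a) a i j * v j * cnj (v i))"
proof -
  obtain C where C: "\<And>N j. (\<Sum>i<N. (cmod (a i j))\<^sup>2) \<le> C"
    using bounded_ops_entry_bounds[OF assms] by metis
  have C': "(\<Sum>k<N. (cmod (cnj (a k i)))\<^sup>2) \<le> C" for N i using C[of i N] by simp
  have "(\<lambda>k. cnj (a k i) * a k j) sums mat_mult (mat_adjoint a) a i j" for i j
    unfolding mat_mult_def mat_adjoint_def
    by (rule summable_sums[OF mult_summable_of_square_bounds[OF C' C]])
  then have "(\<lambda>k. \<Sum>i<n. \<Sum>j<n. cnj (a k i) * a k j * v j * cnj (v i)) sums
      (\<Sum>i<n. \<Sum>j<n. mat_mult (mat_adjoint a) a i j * v j * cnj (v i))"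
    by (intro sums_sum sums_mult2)
  moreover have "(\<Sum>i<n. \<Sum>j<n. cnj (a k i) * a k j * v j * cnj (v i)) = complex_of_real ((cmod (\<Sum>j<n. a k j * v j))\<^sup>2)" for k
  proof -
    have "complex_of_real ((cmod (\<Sum>j<n. a k j * v j))\<^sup>2) = cnj (\<Sum>i<n. a k i * v i) * (\<Sum>j<n. a k j * v j)"
      unfolding complex_norm_square by (rule mult.commute)
    also have "\<dots> = (\<Sum>i<n. cnj (a k i) * cnj (v i)) * (\<Sum>j<n. a k j * v j)"
      by simp
    also have "\<dots> = (\<Sum>i<n. \<Sum>j<n. cnj (a k i) * a k j * v j * cnj (v i))"
      unfolding sum_product by (simp only: mult_ac)
    finally show ?thesis ..
  qed
  ultimately show ?thesis by simp
qed

lemma positive_op_psd_upto: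
  assumes "positive_op p"
  shows "psd_upto n p"
  unfolding psd_upto_def
proof
  fix v
  define \<xi> :: vec where "\<xi> i = (if i < n then v i else 0)" for i
  have "\<xi> \<in> ell2" by (rule ell2_finite_support[of n]) (simp add: \<xi>_def)
  then have "(\<Sum>i. mat_app p \<xi> i * cnj (\<xi> i)) \<in> \<real>\<^sub>\<ge>\<^sub>0"
    using assms by (simp add: positive_op_def)
  also have "(\<Sum>i. mat_app p \<xi> i * cnj (\<xi> i)) = (\<Sum>i<n. mat_app p \<xi> i * cnj (\<xi> i))"
    by (rule suminf_finite) (auto simp: \<xi>_def)
  also have "\<dots> = (\<Sum>i<n. (\<Sum>j<n. p i j * \<xi> j) * cnj (\<xi> i))"
    by (intro sum.cong refl, subst mat_app_finite_support[of n]) (auto simp: \<xi>_def)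
  also have "\<dots> = sesq n p v v"
    by (simp add: sesq_def \<xi>_def sum_distrib_right)
  finally show "sesq n p v v \<in> \<real>\<^sub>\<ge>\<^sub>0" .
qed

lemma sesq_unit_vec_right:
  assumes "\<And>j. j \<ge> n \<Longrightarrow> u j = 0" "n \<le> N" "i < N"
  shows "sesq N p u (unit_vec i) = (\<Sum>j<n. p i j * u j)"
proof -
  have "sesq N p u (unit_vec i) = (\<Sum>k<N. if k = i then \<Sum>j<N. p k j * u j else 0)"
    unfolding sesq_def by (intro sum.cong refl) (auto simp: mult_delta)
  also have "\<dots> = (\<Sum>j<N. p i j * u j)" using assms(3) by simp
  also have "\<dots> = (\<Sum>j<n. p i j * u j)"
    using assms by (intro sum.mono_neutral_right) auto
  finally show ?thesis .
qed

text \<open>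
  With \<open>p = |T|\<close> and \<open>u\<^sub>k\<close> orthonormal for the form of \<open>p\<close>, expanding the basis vectors
  gives \<open>T e\<^sub>j = \<Sum>\<^sub>k \<langle>p e\<^sub>j, u\<^sub>k\<rangle> T u\<^sub>k\<close>, and \<open>\<parallel>T u\<^sub>k\<parallel> = \<parallel>p u\<^sub>k\<parallel>\<close>.
\<close>

lemma trace_class_sections:
  assumes "T \<in> trace_class"
  obtains K where "\<And>n. \<exists>f g. (\<forall>i<n. 0 \<le> f i) \<and> (\<forall>j<n. 0 \<le> g j) \<and> (\<Sum>i<n. f i) \<le> K \<and> (\<Sum>j<n. g j) \<le> K \<and>
      (\<forall>i<n. \<forall>j<n. (cmod (T i j))\<^sup>2 \<le> f i * g j)"
proof -
  obtain p where T: "T \<in> bounded_ops" and pos: "positive_op p"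
    and sq: "mat_mult p p = mat_mult (mat_adjoint T) T" and sm: "summable (\<lambda>i. p i i)"
    using assms unfolding trace_class_def is_abs_op_def by blast
  have pb: "p \<in> bounded_ops" using pos by (simp add: positive_op_def)
  note psd = positive_op_psd_upto[OF pos]
  have diag: "0 \<le> Re (p i i)" for i
    using psd_upto_diagonal[OF psd, of i "Suc i"] by (simp add: complex_nonneg_Reals_iff)
  have "cnj (p j i) = p i j" for i j
    using psd_upto_entry_cnj[OF psd[of "Suc (max i j)"], of j i] by simp
  then have "mat_adjoint p = p" by (simp add: mat_adjoint_def)
  then have sq': "mat_mult (mat_adjoint p) p = mat_mult (mat_adjoint T) T" using sq by simp
  define K where "K = (\<Sum>i. Re (p i i))"
  have tr: "(\<Sum>i<n. Re (p i i)) \<le> K" for n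
    unfolding K_def by (intro sum_le_suminf summable_Re sm) (auto simp: diag)
  have norms: "summable (\<lambda>k. (cmod (\<Sum>j<n. T k j * v j))\<^sup>2)" "summable (\<lambda>k. (cmod (\<Sum>j<n. p k j * v j))\<^sup>2)"
    "(\<Sum>k. (cmod (\<Sum>j<n. T k j * v j))\<^sup>2) = (\<Sum>k. (cmod (\<Sum>j<n. p k j * v j))\<^sup>2)" for n v
  proof -
    note 1 = column_norm_sums[OF T, of v n] and 2 = column_norm_sums[OF pb, of v n, unfolded sq']
    have 3: "(\<lambda>k. (cmod (\<Sum>j<n. T k j * v j))\<^sup>2) sums Re (\<Sum>i<n. \<Sum>j<n. mat_mult (mat_adjoint T) T i j * v j * cnj (v i))"
      using sums_Re[OF 1] by simp
    have 4: "(\<lambda>k. (cmod (\<Sum>j<n. p k j * v j))\<^sup>2) sums Re (\<Sum>i<n. \<Sum>j<n. mat_mult (mat_adjoint T) T i j * v j * cnj (v i))"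
      using sums_Re[OF 2] by simp
    show "summable (\<lambda>k. (cmod (\<Sum>j<n. T k j * v j))\<^sup>2)" "summable (\<lambda>k. (cmod (\<Sum>j<n. p k j * v j))\<^sup>2)"
      "(\<Sum>k. (cmod (\<Sum>j<n. T k j * v j))\<^sup>2) = (\<Sum>k. (cmod (\<Sum>j<n. p k j * v j))\<^sup>2)"
      using 3 4 by (auto simp: sums_iff)
  qed
  have "\<exists>f g. (\<forall>i<n. 0 \<le> f i) \<and> (\<forall>j<n. 0 \<le> g j) \<and> (\<Sum>i<n. f i) \<le> K \<and> (\<Sum>j<n. g j) \<le> K \<and>
      (\<forall>i<n. \<forall>j<n. (cmod (T i j))\<^sup>2 \<le> f i * g j)" for n
  proof -
    obtain m u where supp: "\<And>k i. k < m \<Longrightarrow> i \<ge> n \<Longrightarrow> u k i = 0" and on: "orthonormal_upto n p m u"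
      and pars: "\<And>j. j < n \<Longrightarrow> Re (p j j) = (\<Sum>k<m. (cmod (sesq n p (unit_vec j) (u k)))\<^sup>2)"
      using gram_schmidt[of p n, OF psd] by blast
    have on': "orthonormal_upto N p m u" if "n \<le> N" for N
    proof -
      have "sesq N p (u k) (u l) = sesq n p (u k) (u l)" if "k < m" "l < m" for k l
        using that \<open>n \<le> N\<close> by (intro sesq_support) (auto simp: supp)
      then show ?thesis using on by (simp add: orthonormal_upto_def)
    qed
    define L where "L j k = sesq n p (unit_vec j) (u k)" for j k
    define Tu where "Tu k i = (\<Sum>j<n. T i j * u k j)" for k i
    \<comment> \<open>The residual of the basis vector is null for the form of \<open>p\<close>, so
      \<open>p\<close> kills it by degenerate Cauchy-Schwarz, and \<open>T\<close> kills it because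
      \<open>T\<close> and \<open>p\<close> have equal norms on it.\<close>
    have expand: "T i j = (\<Sum>k<m. L j k * Tu k i)" if "j < n" for i j
    proof -
      define z where "z = (\<lambda>i. unit_vec j i - (\<Sum>k<m. L j k * u k i))"
      have z0: "z i = 0" if "i \<ge> n" for i using that \<open>j < n\<close> by (simp add: z_def supp)
      have un: "sesq n p (unit_vec j) (unit_vec j) = p j j" by (rule sesq_unit[OF that that])
      have "Im (p j j) = 0" using psd_upto_diagonal[OF psd that] by (simp add: complex_nonneg_Reals_iff)
      then have zz: "sesq n p z z = 0"
        using residual_norm[OF psd on, of z "unit_vec j"] pars[OF that]
        by (simp add: z_def L_def un complex_eq_iff)
      have "(\<Sum>l<n. p i l * z l) = 0" for i
      proof -
        \<comment> \<open>Coordinate i may lie beyond n, so the form is enlarged to contain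
          it.\<close>
        define N where "N = max n (Suc i)"
        have "sesq N p z z = 0" unfolding N_def using zz by (subst sesq_support[of n]) (auto simp: z0)
        then have "sesq N p z (unit_vec i) = 0" by (rule psd_upto_null[OF psd])
        then show ?thesis by (subst (asm) sesq_unit_vec_right[of n]) (auto simp: z0 N_def)
      qed
      then have "(\<Sum>k. (cmod (\<Sum>l<n. T k l * z l))\<^sup>2) = 0"
        using norms(3)[of z n] by simp
      then have "(\<Sum>l<n. T i l * z l) = 0"
        using suminf_eq_zero_iff[OF norms(1)[of z n]] by simp
      also have "(\<Sum>l<n. T i l * z l) = (\<Sum>l<n. T i l * unit_vec j l) - (\<Sum>l<n. \<Sum>k<m. L j k * (T i l * u k l))"
        by (simp add: z_def right_diff_distrib sum_subtractf sum_distrib_left mult_ac)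
      also have "(\<Sum>l<n. T i l * unit_vec j l) = T i j" using that by (simp add: mult_delta)
      also have "(\<Sum>l<n. \<Sum>k<m. L j k * (T i l * u k l)) = (\<Sum>k<m. L j k * Tu k i)"
        unfolding Tu_def by (subst sum.swap) (simp add: sum_distrib_left)
      finally show ?thesis by simp
    qed
    have "(\<Sum>i<N. \<Sum>k<m. (cmod (\<Sum>j<n. p i j * u k j))\<^sup>2) \<le> K" for N
    proof -
      define M where "M = max n N"
      \<comment> \<open>The left side is the squared length of the projection of the i-th basis
        vector. Bessel bounds it by \<open>p i i\<close>, so the \<open>p u_k\<close> together have
        squared norm at most the trace of \<open>p\<close>.\<close>
      have "(\<Sum>k<m. (cmod (\<Sum>j<n. p i j * u k j))\<^sup>2) \<le> Re (p i i)" if "i < N" for i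
      proof -
        have i: "i < M" "n \<le> M" using that by (auto simp: M_def)
        have "(\<Sum>k<m. (cmod (\<Sum>j<n. p i j * u k j))\<^sup>2) = (\<Sum>k<m. (cmod (sesq M p (u k) (unit_vec i)))\<^sup>2)"
          by (intro sum.cong refl, subst sesq_unit_vec_right[of n]) (use i in \<open>auto simp: supp\<close>)
        also have "\<dots> = (\<Sum>k<m. (cmod (sesq M p (unit_vec i) (u k)))\<^sup>2)"
          by (subst psd_upto_hermitian[OF psd]) simp
        also have "\<dots> \<le> Re (sesq M p (unit_vec i) (unit_vec i))"
          by (rule bessel[OF psd on'[OF i(2)] refl])
        also have "\<dots> = Re (p i i)" by (simp add: sesq_unit[OF i(1) i(1)])
        finally show ?thesis .
      qed
      then have "(\<Sum>i<N. \<Sum>k<m. (cmod (\<Sum>j<n. p i j * u k j))\<^sup>2) \<le> (\<Sum>i<N. Re (p i i))"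
        by (intro sum_mono) auto
      then show ?thesis using tr[of N] by linarith
    qed
    then have "(\<Sum>k<m. \<Sum>i<N. (cmod (\<Sum>j<n. p i j * u k j))\<^sup>2) \<le> K" for N
      by (subst sum.swap)
    then have pu: "(\<Sum>k<m. \<Sum>i. (cmod (\<Sum>j<n. p i j * u k j))\<^sup>2) \<le> K"
      by (intro LIMSEQ_le_const2[of "\<lambda>N. \<Sum>k<m. \<Sum>i<N. (cmod (\<Sum>j<n. p i j * u k j))\<^sup>2"])
        (intro tendsto_sum summable_LIMSEQ norms, blast)
    define f where "f i = (\<Sum>k<m. (cmod (Tu k i))\<^sup>2)" for i
    have "(\<Sum>i<n. f i) = (\<Sum>k<m. \<Sum>i<n. (cmod (Tu k i))\<^sup>2)"
      unfolding f_def by (rule sum.swap)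
    also have "\<dots> \<le> (\<Sum>k<m. \<Sum>i. (cmod (\<Sum>j<n. T i j * u k j))\<^sup>2)"
      unfolding Tu_def by (intro sum_mono sum_le_suminf norms) auto
    also have "\<dots> \<le> K" unfolding norms(3) by (rule pu)
    finally have fK: "(\<Sum>i<n. f i) \<le> K" .
    \<comment> \<open>Cauchy-Schwarz in the factorisation through the index k: the vectors
      \<open>Tu k\<close> give f, and Parseval identifies the squared norm of \<open>L j\<close>
      with \<open>p j j\<close>.\<close>
    have "(cmod (T i j))\<^sup>2 \<le> f i * Re (p j j)" if "j < n" for i j
      using cmod_sum_mult_le[of "L j" "\<lambda>k. Tu k i" "{..<m}"]
      unfolding expand[OF that, symmetric] f_def by (simp add: L_def pars[OF that] mult.commute)
    moreover have "0 \<le> f i" for i by (simp add: f_def sum_nonneg)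
    ultimately show ?thesis
      using fK tr[of n] diag by (intro exI[of _ f] exI[of _ "\<lambda>j. Re (p j j)"]) blast
  qed
  then show thesis by (rule that)
qed

subsection \<open>Partial matchings as test matrices\<close>

text \<open>The images have only n possibly nonzero coordinates, so coordinatewise convergence of a
  bounded subsequence is already convergence in norm.\<close>

lemma finite_support_compact:
  assumes supp: "\<And>i j. i \<ge> n \<or> j \<ge> n \<Longrightarrow> a i j = 0"
  shows "a \<in> compact_ops"
proof -
  have ab: "a \<in> bounded_ops"
  proof (rule hilbert_schmidt_bounded)
    fix m
    have "(\<Sum>i<m. \<Sum>j<m. (cmod (a i j))\<^sup>2) \<le> (\<Sum>i<max m n. \<Sum>j<max m n. (cmod (a i j))\<^sup>2)"
      by (intro order_trans[OF sum_mono[OF sum_mono2] sum_mono2]) (auto intro!: sum_nonneg)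
    also have "\<dots> = (\<Sum>i<n. \<Sum>j<max m n. (cmod (a i j))\<^sup>2)"
      by (rule sum.mono_neutral_right) (auto simp: supp)
    also have "\<dots> = (\<Sum>i<n. \<Sum>j<n. (cmod (a i j))\<^sup>2)"
      by (intro sum.cong refl sum.mono_neutral_right) (auto simp: supp)
    finally show "(\<Sum>i<m. \<Sum>j<m. (cmod (a i j))\<^sup>2) \<le> (\<Sum>i<n. \<Sum>j<n. (cmod (a i j))\<^sup>2)" .
  qed
  obtain C where C: "0 \<le> C" "\<And>\<xi>. \<xi> \<in> ell2 \<Longrightarrow> ell2_norm (mat_app a \<xi>) \<le> C * ell2_norm \<xi>"
    using bounded_ops_obtain[OF ab] by blast
  have zero: "mat_app a \<xi> i = 0" if "i \<ge> n" for \<xi> i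
    using that by (simp add: mat_app_def supp)
  show ?thesis
    unfolding compact_ops_def mem_Collect_eq
  proof (intro conjI ab allI impI)
    fix \<xi> :: "nat \<Rightarrow> vec"
    assume \<xi>: "\<forall>k. \<xi> k \<in> ell2 \<and> ell2_norm (\<xi> k) \<le> 1"
    have bd: "norm (mat_app a (\<xi> k) i) \<le> C" for k i
    proof -
      have m: "mat_app a (\<xi> k) \<in> ell2" using \<xi> by (intro bounded_ops_mat_app ab) auto
      have "(cmod (mat_app a (\<xi> k) i))\<^sup>2 \<le> (ell2_norm (mat_app a (\<xi> k)))\<^sup>2"
        using ell2_sum_le[OF m, of "{i}"] by simp
      then have "cmod (mat_app a (\<xi> k) i) \<le> ell2_norm (mat_app a (\<xi> k))"
        by (rule power2_le_imp_le) (rule ell2_norm_nonneg[OF m])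
      also have "\<dots> \<le> C * ell2_norm (\<xi> k)" using \<xi> by (intro C) auto
      also have "\<dots> \<le> C" using \<xi> by (intro mult_left_le C) auto
      finally show ?thesis .
    qed
    obtain r \<eta> where r: "strict_mono (r :: nat \<Rightarrow> nat)" and \<eta>: "\<And>i. (\<lambda>k. mat_app a (\<xi> (r k)) i) \<longlonglongrightarrow> \<eta> i"
      by (rule bounded_pointwise_subseq[of "\<lambda>k. mat_app a (\<xi> k)" C, OF bd]) (rule that)
    have \<eta>0: "\<eta> i = 0" if "i \<ge> n" for i
      using \<eta>[of i] zero[OF that] by (simp add: LIMSEQ_const_iff)
    have eq: "ell2_norm (\<lambda>i. mat_app a (\<xi> (r k)) i - \<eta> i) = sqrt (\<Sum>i<n. (cmod (mat_app a (\<xi> (r k)) i - \<eta> i))\<^sup>2)" for k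
      by (rule real_sqrt_unique[symmetric])
        (auto intro!: ell2_finite_support[of n] ell2_norm_nonneg simp: zero \<eta>0)
    have "(\<lambda>k. sqrt (\<Sum>i<n. (cmod (mat_app a (\<xi> (r k)) i - \<eta> i))\<^sup>2)) \<longlonglongrightarrow> sqrt (\<Sum>i<n. (cmod (\<eta> i - \<eta> i))\<^sup>2)"
      by (intro tendsto_intros \<eta>)
    then have "(\<lambda>k. ell2_norm (\<lambda>i. mat_app a (\<xi> (r k)) i - \<eta> i)) \<longlonglongrightarrow> 0"
      unfolding eq by simp
    moreover have "\<eta> \<in> ell2" by (rule ell2_finite_support(1)[OF \<eta>0])
    ultimately show "\<exists>r \<eta>. strict_mono (r :: nat \<Rightarrow> nat) \<and> \<eta> \<in> ell2 \<and>
          (\<lambda>k. ell2_norm (\<lambda>i. mat_app a (\<xi> (r k)) i - \<eta> i)) \<longlonglongrightarrow> 0"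
      using r by blast
  qed
qed

lemma fin_op_norm_bound:
  fixes M :: "'i \<Rightarrow> 'i \<Rightarrow> complex"
  assumes I: "finite I" and c: "0 \<le> c" "fin_op_norm I M \<le> ennreal c"
  shows "(\<Sum>i\<in>I. (cmod (\<Sum>j\<in>I. M i j * v j))\<^sup>2) \<le> c\<^sup>2 * (\<Sum>i\<in>I. (cmod (v i))\<^sup>2)"
proof (cases "(\<Sum>i\<in>I. (cmod (v i))\<^sup>2) = 0")
  case True
  then have "\<forall>i\<in>I. v i = 0" using I by (subst (asm) sum_nonneg_eq_0_iff) auto
  then show ?thesis by simp
next
  case False
  define s where "s = (\<Sum>i\<in>I. (cmod (v i))\<^sup>2)"
  have s: "0 < s" using False unfolding s_def by (simp add: sum_nonneg order_less_le)
  define t where "t = complex_of_real (1 / sqrt s)"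
  have t: "(cmod t)\<^sup>2 = 1 / s" using s by (simp add: t_def norm_divide power_divide)
  have "(\<Sum>i\<in>I. (cmod (t * v i))\<^sup>2) = 1"
    using s by (simp add: norm_mult power_mult_distrib t s_def flip: sum_divide_distrib)
  then have "ennreal (sqrt (\<Sum>i\<in>I. (cmod (\<Sum>j\<in>I. M i j * (t * v j)))\<^sup>2)) \<le> fin_op_norm I M"
    unfolding fin_op_norm_def by (intro SUP_upper) simp
  then have "sqrt (\<Sum>i\<in>I. (cmod (\<Sum>j\<in>I. M i j * (t * v j)))\<^sup>2) \<le> c"
    using c by (meson ennreal_le_iff order_trans)
  then have "(\<Sum>i\<in>I. (cmod (\<Sum>j\<in>I. M i j * (t * v j)))\<^sup>2) \<le> c\<^sup>2" by (rule sqrt_le_D)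
  also have "(\<Sum>i\<in>I. (cmod (\<Sum>j\<in>I. M i j * (t * v j)))\<^sup>2) = (\<Sum>i\<in>I. (cmod (\<Sum>j\<in>I. M i j * v j))\<^sup>2) / s"
  proof -
    have "(\<Sum>j\<in>I. M i j * (t * v j)) = t * (\<Sum>j\<in>I. M i j * v j)" for i
      by (simp add: sum_distrib_left mult_ac)
    then show ?thesis by (simp add: norm_mult power_mult_distrib t sum_divide_distrib)
  qed
  finally show ?thesis using s by (simp add: s_def[symmetric] divide_le_eq)
qed

lemma sum_if_unique:
  fixes F :: "'e \<Rightarrow> 'b::comm_monoid_add"
  assumes "finite E" "e \<in> E" "P e" and "\<And>e'. e' \<in> E \<Longrightarrow> P e' \<Longrightarrow> e' = e"
  shows "(\<Sum>e'\<in>E. if P e' then F e' else 0) = F e"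
proof -
  have "(\<Sum>e'\<in>E. if P e' then F e' else 0) = (\<Sum>e'\<in>E. if e' = e then F e' else 0)"
    by (intro sum.cong refl if_cong) (use assms(3,4) in blast)
  then show ?thesis using assms(1,2) by simp
qed

lemma sum_if_at_most_one:
  fixes F :: "'e \<Rightarrow> complex"
  assumes E: "finite E" and one: "\<And>e e'. e \<in> E \<Longrightarrow> e' \<in> E \<Longrightarrow> P e \<Longrightarrow> P e' \<Longrightarrow> e = e'"
  shows "(cmod (\<Sum>e\<in>E. if P e then F e else 0))\<^sup>2 = (\<Sum>e\<in>E. if P e then (cmod (F e))\<^sup>2 else 0)"
proof (cases "\<exists>e\<in>E. P e")
  case True
  then obtain e where e: "e \<in> E" "P e" by blast
  have "(\<Sum>e\<in>E. if P e then F e else 0) = F e"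
    by (rule sum_if_unique[where P = P, OF E e]) (rule one[OF _ e(1) _ e(2)])
  moreover have "(\<Sum>e\<in>E. if P e then (cmod (F e))\<^sup>2 else 0) = (cmod (F e))\<^sup>2"
    by (rule sum_if_unique[where P = P, OF E e]) (rule one[OF _ e(1) _ e(2)])
  ultimately show ?thesis by simp
next
  case False
  then have "(\<Sum>e\<in>E. if P e then F e else 0) = 0" "(\<Sum>e\<in>E. if P e then (cmod (F e))\<^sup>2 else 0) = 0"
    by (auto intro!: sum.neutral)
  then show ?thesis by simp
qed

text \<open>
  A finite set of edges \<open>(J e, H e) \<rightarrow> (I e, G e)\<close> forming a partial matching is a partial
  permutation matrix, hence a contraction, whatever unimodular weights \<open>\<theta>\<close> it carries.
\<close>

locale partial_matching =
  fixes E :: "'e set" and I J G H :: "'e \<Rightarrow> nat" and N R :: nat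
  assumes E: "finite E"
    and I: "\<And>e. e \<in> E \<Longrightarrow> I e < N" and J: "\<And>e. e \<in> E \<Longrightarrow> J e < N"
    and G: "\<And>e. e \<in> E \<Longrightarrow> G e < R" and H: "\<And>e. e \<in> E \<Longrightarrow> H e < R"
    and inj_IG: "inj_on (\<lambda>e. (I e, G e)) E" and inj_JH: "inj_on (\<lambda>e. (J e, H e)) E"
begin

definition matching_matrix :: "('e \<Rightarrow> complex) \<Rightarrow> nat \<Rightarrow> nat \<Rightarrow> cmat" where
  "matching_matrix \<theta> k l i j = (\<Sum>e\<in>E. if G e = k \<and> H e = l \<and> I e = i \<and> J e = j then \<theta> e else 0)"

lemma matching_matrix_support: "i \<ge> N \<or> j \<ge> N \<Longrightarrow> matching_matrix \<theta> k l i j = 0"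
  unfolding matching_matrix_def by (intro sum.neutral ballI) (auto dest: I J)

text \<open>Injectivity of (I, G) leaves at most one term in each output coordinate, so squared
  moduli pass through the sum; injectivity of (J, H) counts each input coordinate at most
  once.\<close>

lemma matching_matrix_norm:
  assumes \<theta>: "\<And>e. e \<in> E \<Longrightarrow> cmod (\<theta> e) \<le> 1"
  shows "op_norms R (matching_matrix \<theta>) \<le> 1"
  unfolding op_norms_def
proof (rule SUP_least, elim CollectE conjE)
  fix \<xi> :: "nat \<Rightarrow> vec"
  assume \<xi>: "\<forall>l<R. \<xi> l \<in> ell2" and 1: "(\<Sum>l<R. (ell2_norm (\<xi> l))\<^sup>2) \<le> 1"
  define y where "y k i = (\<Sum>l<R. mat_app (matching_matrix \<theta> k l) (\<xi> l) i)" for k i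
  have app: "mat_app (matching_matrix \<theta> k l) (\<xi> l) i = (\<Sum>j<N. matching_matrix \<theta> k l i j * \<xi> l j)" for k l i
    unfolding mat_app_def by (rule suminf_finite) (auto simp: matching_matrix_support)
  have y_eq: "y k i = (\<Sum>e\<in>E. if I e = i \<and> G e = k then \<theta> e * \<xi> (H e) (J e) else 0)" for k i
  proof -
    have "y k i = (\<Sum>l<R. \<Sum>j<N. \<Sum>e\<in>E. if G e = k \<and> H e = l \<and> I e = i \<and> J e = j then \<theta> e * \<xi> l j else 0)"
      unfolding y_def app matching_matrix_def sum_distrib_right by (intro sum.cong refl) auto
    also have "\<dots> = (\<Sum>l<R. \<Sum>e\<in>E. \<Sum>j<N. if G e = k \<and> H e = l \<and> I e = i \<and> J e = j then \<theta> e * \<xi> l j else 0)"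
      by (rule sum.cong[OF refl], rule sum.swap)
    also have "\<dots> = (\<Sum>e\<in>E. \<Sum>l<R. \<Sum>j<N. if G e = k \<and> H e = l \<and> I e = i \<and> J e = j then \<theta> e * \<xi> l j else 0)"
      by (rule sum.swap)
    also have "\<dots> = (\<Sum>e\<in>E. if I e = i \<and> G e = k then \<theta> e * \<xi> (H e) (J e) else 0)"
    proof (intro sum.cong refl)
      fix e assume e: "e \<in> E"
      have "(\<Sum>l<R. \<Sum>j<N. if G e = k \<and> H e = l \<and> I e = i \<and> J e = j then \<theta> e * \<xi> l j else 0)
          = (\<Sum>l<R. if l = H e then \<Sum>j<N. if j = J e then if I e = i \<and> G e = k then \<theta> e * \<xi> l j else 0 else 0 else 0)"
        by (intro sum.cong refl) (auto intro!: sum.cong)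
      also have "\<dots> = (if I e = i \<and> G e = k then \<theta> e * \<xi> (H e) (J e) else 0)"
        using H[OF e] J[OF e] by simp
      finally show "(\<Sum>l<R. \<Sum>j<N. if G e = k \<and> H e = l \<and> I e = i \<and> J e = j then \<theta> e * \<xi> l j else 0)
          = (if I e = i \<and> G e = k then \<theta> e * \<xi> (H e) (J e) else 0)" .
    qed
    finally show ?thesis .
  qed
  have y0: "y k i = 0" if "i \<ge> N" for k i
    unfolding y_eq using I that by (intro sum.neutral) force
  have "(\<Sum>k<R. (ell2_norm (y k))\<^sup>2) = (\<Sum>k<R. \<Sum>i<N. (cmod (y k i))\<^sup>2)"
    by (intro sum.cong refl ell2_finite_support(2) y0)
  also have "\<dots> = (\<Sum>k<R. \<Sum>i<N. \<Sum>e\<in>E. if I e = i \<and> G e = k then (cmod (\<theta> e * \<xi> (H e) (J e)))\<^sup>2 else 0)"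
    unfolding y_eq using inj_onD[OF inj_IG] by (intro sum.cong refl sum_if_at_most_one[OF E]) auto
  also have "\<dots> = (\<Sum>k<R. \<Sum>e\<in>E. \<Sum>i<N. if I e = i \<and> G e = k then (cmod (\<theta> e * \<xi> (H e) (J e)))\<^sup>2 else 0)"
    by (rule sum.cong[OF refl], rule sum.swap)
  also have "\<dots> = (\<Sum>e\<in>E. \<Sum>k<R. \<Sum>i<N. if I e = i \<and> G e = k then (cmod (\<theta> e * \<xi> (H e) (J e)))\<^sup>2 else 0)"
    by (rule sum.swap)
  also have "\<dots> = (\<Sum>e\<in>E. (cmod (\<theta> e * \<xi> (H e) (J e)))\<^sup>2)"
  proof (intro sum.cong refl)
    fix e assume e: "e \<in> E"
    have "(\<Sum>k<R. \<Sum>i<N. if I e = i \<and> G e = k then (cmod (\<theta> e * \<xi> (H e) (J e)))\<^sup>2 else 0)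
        = (\<Sum>k<R. if k = G e then \<Sum>i<N. if i = I e then (cmod (\<theta> e * \<xi> (H e) (J e)))\<^sup>2 else 0 else 0)"
      by (intro sum.cong refl) (auto intro!: sum.cong)
    also have "\<dots> = (cmod (\<theta> e * \<xi> (H e) (J e)))\<^sup>2" using G[OF e] I[OF e] by simp
    finally show "(\<Sum>k<R. \<Sum>i<N. if I e = i \<and> G e = k then (cmod (\<theta> e * \<xi> (H e) (J e)))\<^sup>2 else 0) = (cmod (\<theta> e * \<xi> (H e) (J e)))\<^sup>2" .
  qed
  also have "\<dots> \<le> (\<Sum>e\<in>E. (cmod (\<xi> (H e) (J e)))\<^sup>2)"
    using \<theta> by (intro sum_mono power_mono) (auto simp: norm_mult intro!: mult_left_le_one_le)
  also have "\<dots> = (\<Sum>q\<in>(\<lambda>e. (J e, H e)) ` E. (cmod (\<xi> (snd q) (fst q)))\<^sup>2)"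
    by (simp add: sum.reindex[OF inj_JH])
  also have "\<dots> \<le> (\<Sum>q\<in>{..<N} \<times> {..<R}. (cmod (\<xi> (snd q) (fst q)))\<^sup>2)"
    using J H by (intro sum_mono2) auto
  also have "\<dots> = (\<Sum>l<R. \<Sum>j<N. (cmod (\<xi> l j))\<^sup>2)"
    unfolding sum_Times by (subst sum.swap) simp
  also have "\<dots> \<le> (\<Sum>l<R. (ell2_norm (\<xi> l))\<^sup>2)"
    using \<xi> by (intro sum_mono ell2_sum_le) auto
  finally have "(\<Sum>k<R. (ell2_norm (y k))\<^sup>2) \<le> 1" using 1 by linarith
  then show "ennreal (sqrt (\<Sum>k<R. (ell2_norm (\<lambda>i. \<Sum>l<R. mat_app (matching_matrix \<theta> k l) (\<xi> l) i))\<^sup>2)) \<le> 1"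
    unfolding y_def[symmetric] by (simp add: ennreal_le_1)
qed

text \<open>The same matching is used twice, once with the phases that turn \<phi> into its modulus
  and once plain. Pairing the blocks (h, h') of both collects |\<phi>| over the edges with G = h and
  H = h'. The resulting matrix is tested on the diagonal vector with coefficients sqrt (D h), whose
  squared norm is the sum of D.\<close>

lemma matching_inequality:
  assumes C: "0 \<le> C" "cb_norm compact_ops op_norms S1_norms (schur_multiplier \<phi>) \<le> ennreal C"
    and D: "\<And>h. 0 \<le> D h"
  shows "(\<Sum>e\<in>E. cmod (\<phi> (I e) (J e)) * (sqrt (D (G e)) * sqrt (D (H e)))) \<le> C * (\<Sum>h<R. D h)"
proof -
  define \<theta> where "\<theta> e = cnj (sgn (\<phi> (I e) (J e)))" for e
  define a where "a = matching_matrix \<theta>"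
  define b where "b = matching_matrix (\<lambda>_. 1)"
  have comp: "a k l \<in> compact_ops" "b k l \<in> compact_ops" for k l
    unfolding a_def b_def by (rule finite_support_compact[OF matching_matrix_support], assumption)+
  have na: "op_norms R a \<le> 1" unfolding a_def
    by (rule matching_matrix_norm) (simp add: \<theta>_def norm_sgn)
  have nb: "op_norms R b \<le> 1" unfolding b_def by (rule matching_matrix_norm) simp
  let ?Q = "{..<R} \<times> {..<R}"
  let ?M = "\<lambda>(p, k) (q, l). duality (schur_multiplier \<phi> (a k l)) (b p q)"
  have "fin_op_norm ?Q ?M = Mn_norms R R (\<lambda>p q k l. duality (schur_multiplier \<phi> (a k l)) (b p q))"
    by (simp add: Mn_norms_def)
  \<comment> \<open>Both suprema are evaluated at level R: the inner one at \<open>b\<close>, and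
    next the outer one at \<open>a\<close>.\<close>
  also have "\<dots> \<le> S1_norms R (\<lambda>k l. schur_multiplier \<phi> (a k l))"
    unfolding S1_norms_def cb_norm_def
    by (rule SUP_upper2[of R], simp, rule SUP_upper2[of b]) (use comp nb in auto)
  also have "\<dots> \<le> cb_norm compact_ops op_norms S1_norms (schur_multiplier \<phi>)"
    unfolding cb_norm_def by (rule SUP_upper2[of R], simp, rule SUP_upper2[of a]) (use comp na in auto)
  also note C(2)
  finally have M: "fin_op_norm ?Q ?M \<le> ennreal C" .
  define v where "v r = (if fst r = snd r then complex_of_real (sqrt (D (fst r))) else 0)" for r :: "nat \<times> nat"
  define s where "s = (\<Sum>h<R. D h)"
  have s0: "0 \<le> s" unfolding s_def by (simp add: sum_nonneg D)
  have vs: "(\<Sum>r\<in>?Q. (cmod (v r))\<^sup>2) = s"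
  proof -
    have "(\<Sum>r\<in>?Q. (cmod (v r))\<^sup>2) = (\<Sum>h<R. \<Sum>h'<R. if h' = h then D h else 0)"
      unfolding sum_Times by (intro sum.cong refl) (auto simp: v_def D)
    then show ?thesis by (simp add: s_def)
  qed
  define w where "w r = (\<Sum>r'\<in>?Q. ?M r r' * v r')" for r
  have w: "(\<Sum>r\<in>?Q. (cmod (w r))\<^sup>2) \<le> C\<^sup>2 * s"
    using fin_op_norm_bound[OF _ C(1) M, of v] unfolding w_def vs by simp
  have dual: "duality (schur_multiplier \<phi> (a h h')) (b h h')
      = (\<Sum>e\<in>E. if G e = h \<and> H e = h' then complex_of_real (cmod (\<phi> (I e) (J e))) else 0)" for h h'
  proof -
    define c where "c i j = schur_multiplier \<phi> (a h h') i j * b h h' i j" for i j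
    have c0: "c i j = 0" if "i \<ge> N \<or> j \<ge> N" for i j
      using that by (simp add: c_def b_def matching_matrix_support)
    have "duality (schur_multiplier \<phi> (a h h')) (b h h') = (\<Sum>i. \<Sum>j. c i j)"
      by (simp add: duality_eq c_def)
    also have "\<dots> = (\<Sum>i<N. \<Sum>j. c i j)"
      by (rule suminf_finite) (auto simp: c0)
    also have "\<dots> = (\<Sum>i<N. \<Sum>j<N. c i j)"
      by (intro sum.cong refl suminf_finite) (auto simp: c0)
    also have "\<dots> = (\<Sum>i<N. \<Sum>j<N. \<Sum>e\<in>E. if G e = h \<and> H e = h' \<and> I e = i \<and> J e = j then complex_of_real (cmod (\<phi> (I e) (J e))) else 0)"
    proof (intro sum.cong refl)
      fix i j
      let ?P = "\<lambda>e. G e = h \<and> H e = h' \<and> I e = i \<and> J e = j"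
      show "c i j = (\<Sum>e\<in>E. if ?P e then complex_of_real (cmod (\<phi> (I e) (J e))) else 0)"
      proof (cases "\<exists>e\<in>E. ?P e")
        case True
        then obtain e where e: "e \<in> E" "?P e" by blast
        have un: "e' = e" if "e' \<in> E" "?P e'" for e'
          using inj_onD[OF inj_IG _ that(1) e(1)] that(2) e(2) by simp
        have S: "(\<Sum>e\<in>E. if ?P e then F e else 0) = F e" for F :: "'e \<Rightarrow> complex"
          by (rule sum_if_unique[where P = ?P, OF E e]) (rule un)
        have "\<phi> i j * cnj (sgn (\<phi> i j)) = complex_of_real (cmod (\<phi> i j))"
          by (cases "\<phi> i j = 0")
            (simp_all add: sgn_div_norm scaleR_conv_of_real divide_simps power2_eq_square flip: complex_norm_square)
        then show ?thesis
          unfolding c_def schur_multiplier_def a_def b_def matching_matrix_def S using e(2) by (simp add: \<theta>_def)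
      next
        case False
        then have "b h h' i j = 0" unfolding b_def matching_matrix_def by (intro sum.neutral) auto
        moreover have "(\<Sum>e\<in>E. if ?P e then complex_of_real (cmod (\<phi> (I e) (J e))) else 0) = 0"
          using False by (intro sum.neutral) auto
        ultimately show ?thesis unfolding c_def by simp
      qed
    qed
    also have "\<dots> = (\<Sum>i<N. \<Sum>e\<in>E. \<Sum>j<N. if G e = h \<and> H e = h' \<and> I e = i \<and> J e = j then complex_of_real (cmod (\<phi> (I e) (J e))) else 0)"
      by (rule sum.cong[OF refl], rule sum.swap)
    also have "\<dots> = (\<Sum>e\<in>E. \<Sum>i<N. \<Sum>j<N. if G e = h \<and> H e = h' \<and> I e = i \<and> J e = j then complex_of_real (cmod (\<phi> (I e) (J e))) else 0)"
      by (rule sum.swap)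
    also have "\<dots> = (\<Sum>e\<in>E. if G e = h \<and> H e = h' then complex_of_real (cmod (\<phi> (I e) (J e))) else 0)"
    proof (intro sum.cong refl)
      fix e assume e: "e \<in> E"
      have "(\<Sum>i<N. \<Sum>j<N. if G e = h \<and> H e = h' \<and> I e = i \<and> J e = j then complex_of_real (cmod (\<phi> (I e) (J e))) else 0)
        = (\<Sum>i<N. if i = I e then \<Sum>j<N. if j = J e then if G e = h \<and> H e = h' then complex_of_real (cmod (\<phi> (I e) (J e))) else 0 else 0 else 0)"
        by (intro sum.cong refl) (auto intro!: sum.cong)
      then show "(\<Sum>i<N. \<Sum>j<N. if G e = h \<and> H e = h' \<and> I e = i \<and> J e = j then complex_of_real (cmod (\<phi> (I e) (J e))) else 0)
        = (if G e = h \<and> H e = h' then complex_of_real (cmod (\<phi> (I e) (J e))) else 0)"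
        using I[OF e] J[OF e] by simp
    qed
    finally show ?thesis .
  qed
  define S where "S = (\<Sum>e\<in>E. cmod (\<phi> (I e) (J e)) * (sqrt (D (G e)) * sqrt (D (H e))))"
  have S0: "0 \<le> S" unfolding S_def by (intro sum_nonneg) (simp add: D)
  \<comment> \<open>As \<open>v\<close> lives on the diagonal, only the pairings of
    \<open>a h h'\<close> with \<open>b h h'\<close> survive.\<close>
  have "(\<Sum>r\<in>?Q. v r * w r) = (\<Sum>h<R. complex_of_real (sqrt (D h)) * w (h, h))"
    unfolding sum_Times v_def by (simp add: if_distribR if_distrib[of "\<lambda>f. f * _"] cong: if_cong)
  also have "\<dots> = (\<Sum>h<R. \<Sum>h'<R. complex_of_real (sqrt (D h)) * (duality (schur_multiplier \<phi> (a h h')) (b h h') * complex_of_real (sqrt (D h'))))"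
    unfolding w_def sum_Times v_def
    by (simp add: sum_distrib_left if_distrib[of "\<lambda>x. _ * x"] cong: if_cong)
  also have "\<dots> = (\<Sum>h<R. \<Sum>h'<R. \<Sum>e\<in>E. if G e = h \<and> H e = h' then complex_of_real (cmod (\<phi> (I e) (J e)) * (sqrt (D h) * sqrt (D h'))) else 0)"
    unfolding dual sum_distrib_left sum_distrib_right by (intro sum.cong refl) auto
  also have "\<dots> = (\<Sum>h<R. \<Sum>e\<in>E. \<Sum>h'<R. if G e = h \<and> H e = h' then complex_of_real (cmod (\<phi> (I e) (J e)) * (sqrt (D h) * sqrt (D h'))) else 0)"
    by (rule sum.cong[OF refl], rule sum.swap)
  also have "\<dots> = (\<Sum>e\<in>E. \<Sum>h<R. \<Sum>h'<R. if G e = h \<and> H e = h' then complex_of_real (cmod (\<phi> (I e) (J e)) * (sqrt (D h) * sqrt (D h'))) else 0)"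
    by (rule sum.swap)
  also have "\<dots> = (\<Sum>e\<in>E. complex_of_real (cmod (\<phi> (I e) (J e)) * (sqrt (D (G e)) * sqrt (D (H e)))))"
  proof (intro sum.cong refl)
    fix e assume e: "e \<in> E"
    have "(\<Sum>h<R. \<Sum>h'<R. if G e = h \<and> H e = h' then complex_of_real (cmod (\<phi> (I e) (J e)) * (sqrt (D h) * sqrt (D h'))) else 0)
      = (\<Sum>h<R. if h = G e then \<Sum>h'<R. if h' = H e then complex_of_real (cmod (\<phi> (I e) (J e)) * (sqrt (D h) * sqrt (D h'))) else 0 else 0)"
      by (intro sum.cong refl) (auto intro!: sum.cong)
    then show "(\<Sum>h<R. \<Sum>h'<R. if G e = h \<and> H e = h' then complex_of_real (cmod (\<phi> (I e) (J e)) * (sqrt (D h) * sqrt (D h'))) else 0)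
      = complex_of_real (cmod (\<phi> (I e) (J e)) * (sqrt (D (G e)) * sqrt (D (H e))))"
      using G[OF e] H[OF e] by simp
  qed
  finally have "(\<Sum>r\<in>?Q. v r * w r) = complex_of_real S"
    by (simp add: S_def)
  then have "S\<^sup>2 = (cmod (\<Sum>r\<in>?Q. v r * w r))\<^sup>2" by simp
  also have "\<dots> \<le> s * (\<Sum>r\<in>?Q. (cmod (w r))\<^sup>2)"
    using cmod_sum_mult_le[of v w ?Q] unfolding vs .
  also have "\<dots> \<le> s * (C\<^sup>2 * s)" by (intro mult_left_mono w s0)
  also have "\<dots> = (C * s)\<^sup>2" by (simp add: power2_eq_square mult_ac)
  finally have "S \<le> C * s" by (rule power2_le_imp_le) (simp add: C s0)
  then show ?thesis by (simp add: S_def s_def)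
qed

end

subsection \<open>Transport plans\<close>

lemma sum_Sigma_pairs:
  assumes "finite A" "\<And>x. x \<in> A \<Longrightarrow> finite (B x)"
  shows "(\<Sum>r\<in>Sigma A B. F r) = (\<Sum>p\<in>A. \<Sum>q\<in>B p. F (p, q))"
  using assms by (simp add: sum.Sigma case_prod_unfold)

text \<open>A number is coded by its block n, an interval j inside the block and an offset t.
  Division by f recovers n, and disjointness of consecutive intervals of lengths \<open>c j\<close>
  recovers j and t. Both injectivity conditions of the matching come from here.\<close>

lemma block_code_unique:
  fixes c :: "nat \<Rightarrow> nat"
  assumes f: "f = (\<Sum>k<N. c k)"
    and j: "j < N" "t < c j" and j': "j' < N" "t' < c j'"
    and eq: "n * f + (\<Sum>k<j. c k) + t = n' * f + (\<Sum>k<j'. c k) + t'"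
  shows "n = n' \<and> j = j' \<and> t = t'"
proof -
  have less: "(\<Sum>k<j. c k) + t < (\<Sum>k<M. c k)" if "j < M" "t < c j" for j t M
  proof -
    have "(\<Sum>k<j. c k) + t < (\<Sum>k<Suc j. c k)" using that by simp
    also have "\<dots> \<le> (\<Sum>k<M. c k)" using that by (intro sum_mono2) auto
    finally show ?thesis .
  qed
  let ?r = "(\<Sum>k<j. c k) + t" and ?r' = "(\<Sum>k<j'. c k) + t'"
  have r: "?r < f" "?r' < f" unfolding f using j j' by (auto intro: less)
  have eq': "n * f + ?r = n' * f + ?r'" using eq by simp
  have "(n * f + ?r) div f = n" "(n' * f + ?r') div f = n'"
    using r by (simp_all add: div_mult_self3)
  then have n: "n = n'" using eq' by simp
  then have rr: "?r = ?r'" using eq' by simp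
  have "j = j'"
  proof (rule ccontr)
    assume "j \<noteq> j'"
    then consider "j < j'" | "j' < j" by linarith
    then show False
    proof cases
      case 1
      from less[OF this j(2)] rr show False by simp
    next
      case 2
      from less[OF this j'(2)] rr show False by simp
    qed
  qed
  with n rr show ?thesis by simp
qed

text \<open>
  Test on the matchings that, for every scale \<open>n < L\<close>, join \<open>c i j\<close> elements of the block
  \<open>[n g\<^sub>j, (n+1) g\<^sub>j)\<close> to \<open>c i j\<close> elements of the block \<open>[n f\<^sub>i, (n+1) f\<^sub>i)\<close>, with
  \<open>D h = 1 / (h + 1)\<close>. Both sides grow like the harmonic numbers.
\<close>

lemma integral_plan_inequality:
  fixes c :: "nat \<Rightarrow> nat \<Rightarrow> nat" and N :: nat
  assumes C: "0 \<le> C" "cb_norm compact_ops op_norms S1_norms (schur_multiplier \<phi>) \<le> ennreal C"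
  defines "f \<equiv> \<lambda>i. \<Sum>j<N. c i j" and "g \<equiv> \<lambda>j. \<Sum>i<N. c i j"
  shows "(\<Sum>i<N. \<Sum>j<N. cmod (\<phi> i j) * (real (c i j) / sqrt (real (f i) * real (g j)))) \<le> C"
proof -
  define F where "F = (\<Sum>i<N. \<Sum>j<N. cmod (\<phi> i j) * (real (c i j) / sqrt (real (f i) * real (g j))))"
  define b where "b = 1 + (\<Sum>i<N. \<Sum>j<N. c i j)"
  have fb: "f i \<le> b" if "i < N" for i
    using member_le_sum[of i "{..<N}" f] that by (simp add: f_def b_def)
  have gb: "g j \<le> b" if "j < N" for j
    using member_le_sum[of j "{..<N}" g] that sum.swap[of c "{..<N}" "{..<N}"] by (simp add: g_def b_def)
  define D where "D h = 1 / (real h + 1)" for h :: nat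
  have D0: "0 \<le> D h" for h by (simp add: D_def)
  have main: "F * harm L \<le> C * (harm L + real b)" if "0 < L" for L
  proof -
    define E where "E = (SIGMA n:{..<L}. SIGMA i:{..<N}. SIGMA j:{..<N}. {..<c i j})"
    define I where "I = (\<lambda>(n::nat, i::nat, j::nat, t::nat). i)"
    define J where "J = (\<lambda>(n::nat, i::nat, j::nat, t::nat). j)"
    define G where "G = (\<lambda>(n, i, j, t). n * f i + (\<Sum>k<j. c i k) + t)"
    define H where "H = (\<lambda>(n, i, j, t). n * g j + (\<Sum>k<i. c k j) + t)"
    have pre: "(\<Sum>k<j. c i k) + t < f i" if "j < N" "t < c i j" for i j t
    proof -
      have "(\<Sum>k<j. c i k) + t < (\<Sum>k<Suc j. c i k)" using that by simp
      also have "\<dots> \<le> f i" unfolding f_def using that by (intro sum_mono2) auto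
      finally show ?thesis .
    qed
    have pre': "(\<Sum>k<i. c k j) + t < g j" if "i < N" "t < c i j" for i j t
    proof -
      have "(\<Sum>k<i. c k j) + t < (\<Sum>k<Suc i. c k j)" using that by simp
      also have "\<dots> \<le> g j" unfolding g_def using that by (intro sum_mono2) auto
      finally show ?thesis .
    qed
    have bnd: "n * d + r < L * b" if "n < L" "r < d" "d \<le> b" for n d r
    proof -
      have "n * d + r < (n + 1) * d" using that by simp
      also have "\<dots> \<le> L * b" using that by (intro mult_le_mono) auto
      finally show ?thesis .
    qed
    interpret partial_matching E I J G H N "L * b"
    proof
      show "finite E" unfolding E_def by auto
      show "I e < N" "J e < N" if "e \<in> E" for e using that by (auto simp: E_def I_def J_def)
      show "G e < L * b" if "e \<in> E" for e
        using that bnd[OF _ pre fb] by (auto simp: E_def G_def add.assoc)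
      show "H e < L * b" if "e \<in> E" for e
        using that bnd[OF _ pre' gb] by (auto simp: E_def H_def add.assoc)
      show "inj_on (\<lambda>e. (I e, G e)) E"
        by (rule inj_onI) (auto simp: E_def I_def G_def dest: block_code_unique[OF f_def[THEN meta_eq_to_obj_eq, THEN fun_cong]])
      show "inj_on (\<lambda>e. (J e, H e)) E"
        by (rule inj_onI) (auto simp: E_def J_def H_def dest: block_code_unique[OF g_def[THEN meta_eq_to_obj_eq, THEN fun_cong]])
    qed
    have "F * harm L = (\<Sum>n<L. inverse (real (Suc n)) * F)"
      by (simp add: harm_altdef sum_distrib_right sum_distrib_left mult.commute)
    also have "\<dots> = (\<Sum>n<L. \<Sum>i<N. \<Sum>j<N. \<Sum>t<c i j. cmod (\<phi> i j) * (inverse (real (Suc n)) / sqrt (real (f i) * real (g j))))"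
      by (simp add: F_def sum_distrib_left mult_ac)
    also have "\<dots> = (\<Sum>(n, i, j, t)\<in>E. cmod (\<phi> i j) * (inverse (real (Suc n)) / sqrt (real (f i) * real (g j))))"
      unfolding E_def by (simp add: sum_Sigma_pairs)
    also have "\<dots> \<le> (\<Sum>e\<in>E. cmod (\<phi> (I e) (J e)) * (sqrt (D (G e)) * sqrt (D (H e))))"
    proof (rule sum_mono)
      fix e assume "e \<in> E"
      then obtain n i j t where e: "e = (n, i, j, t)" and l: "n < L" "i < N" "j < N" "t < c i j"
        by (auto simp: E_def)
      \<comment> \<open>Codes start at 0, and the shift by 1 in \<open>D\<close> fits this bound:
        the weight at \<open>G e\<close> is at least 1 / ((n + 1) f i).\<close>
      have "G e + 1 \<le> Suc n * f i" "H e + 1 \<le> Suc n * g j"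
        using pre[OF l(3,4)] pre'[OF l(2,4)] by (auto simp: e G_def H_def)
      then have "real (G e) + 1 \<le> real (Suc n) * real (f i)" "real (H e) + 1 \<le> real (Suc n) * real (g j)"
        by (metis of_nat_1 of_nat_add of_nat_le_iff of_nat_mult)+
      then have "(real (G e) + 1) * (real (H e) + 1) \<le> (real (Suc n) * real (f i)) * (real (Suc n) * real (g j))"
        by (intro mult_mono) auto
      then have "sqrt ((real (G e) + 1) * (real (H e) + 1)) \<le> sqrt ((real (Suc n))\<^sup>2 * (real (f i) * real (g j)))"
        by (simp add: power2_eq_square mult_ac)
      also have "\<dots> = real (Suc n) * sqrt (real (f i) * real (g j))"
        by (simp only: real_sqrt_mult real_sqrt_abs abs_of_nat)
      finally have "1 / (real (Suc n) * sqrt (real (f i) * real (g j))) \<le> 1 / sqrt ((real (G e) + 1) * (real (H e) + 1))"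
        using pre[OF l(3,4)] pre'[OF l(2,4)]
        by (intro divide_left_mono mult_pos_pos) (auto simp del: of_nat_Suc)
      moreover have "1 / sqrt ((real (G e) + 1) * (real (H e) + 1)) = sqrt (D (G e)) * sqrt (D (H e))"
        by (simp add: D_def real_sqrt_mult real_sqrt_divide)
      moreover have "1 / (real (Suc n) * sqrt (real (f i) * real (g j))) = inverse (real (Suc n)) / sqrt (real (f i) * real (g j))"
        by (simp only: inverse_eq_divide divide_divide_eq_left)
      ultimately have "inverse (real (Suc n)) / sqrt (real (f i) * real (g j)) \<le> sqrt (D (G e)) * sqrt (D (H e))"
        by simp
      from mult_left_mono[OF this norm_ge_zero[of "\<phi> i j"]]
      show "(case e of (n, i, j, t) \<Rightarrow> cmod (\<phi> i j) * (inverse (real (Suc n)) / sqrt (real (f i) * real (g j))))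
          \<le> cmod (\<phi> (I e) (J e)) * (sqrt (D (G e)) * sqrt (D (H e)))"
        by (simp only: e I_def J_def prod.case)
    qed
    also have "\<dots> \<le> C * (\<Sum>h<L * b. D h)"
      by (rule matching_inequality[OF C D0])
    \<comment> \<open>The first L weights form the harmonic number; fewer than L * b others remain,
      each at most 1 / L.\<close>
    also have "(\<Sum>h<L * b. D h) \<le> harm L + real b"
    proof -
      have b1: "1 \<le> b" by (simp add: b_def)
      have "(\<Sum>h<L * b. D h) = (\<Sum>h<L. D h) + (\<Sum>h=L..<L * b. D h)"
        using b1 by (subst sum.atLeastLessThan_concat[of 0 L "L * b", symmetric, unfolded atLeast0LessThan]) auto
      also have "(\<Sum>h<L. D h) = harm L"
        by (simp add: D_def harm_altdef inverse_eq_divide add.commute)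
      also have "(\<Sum>h=L..<L * b. D h) \<le> (\<Sum>h=L..<L * b. 1 / real L)"
        using that by (intro sum_mono) (auto simp: D_def intro!: divide_left_mono)
      also have "\<dots> \<le> real b"
        using that by (simp add: of_nat_diff field_simps) (metis b1 diff_le_self le_trans of_nat_le_iff of_nat_mult)
      finally show ?thesis by simp
    qed
    finally show ?thesis using C(1) by (simp add: mult_left_mono)
  qed
  \<comment> \<open>The error b is fixed while the harmonic numbers diverge, so dividing by them
    leaves the limit inequality.\<close>
  have "F \<le> C"
  proof (rule ccontr)
    assume "\<not> F \<le> C"
    then have "0 < F - C" by simp
    have "eventually (\<lambda>L. harm L > C * real b / (F - C)) sequentially"
      using harm_at_top by (simp add: filterlim_at_top_dense)
    then have "eventually (\<lambda>L. harm L > C * real b / (F - C) \<and> 0 < L) sequentially"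
      using eventually_gt_at_top[of 0] by (rule eventually_conj)
    then obtain L where L: "harm L > C * real b / (F - C)" "0 < L"
      unfolding eventually_sequentially by blast
    have "C * real b < (F - C) * harm L"
      using L(1) \<open>0 < F - C\<close> by (simp add: divide_less_eq mult.commute)
    with main[OF L(2)] show False by (simp add: algebra_simps)
  qed
  then show ?thesis by (simp add: F_def)
qed

lemma floor_scaling_tendsto:
  fixes x :: real
  assumes "0 \<le> x"
  shows "(\<lambda>n. real (nat \<lfloor>real n * x\<rfloor>) / real n) \<longlonglongrightarrow> x"
proof (rule tendsto_sandwich)
  show "eventually (\<lambda>n. x - 1 / real n \<le> real (nat \<lfloor>real n * x\<rfloor>) / real n) sequentially"
    using eventually_gt_at_top[of 0]
  proof eventually_elim
    case (elim n)
    have "real n * x - 1 \<le> real (nat \<lfloor>real n * x\<rfloor>)" using assms by linarith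
    then have "(real n * x - 1) / real n \<le> real (nat \<lfloor>real n * x\<rfloor>) / real n"
      by (intro divide_right_mono) auto
    with elim show ?case by (simp add: diff_divide_distrib)
  qed
  show "eventually (\<lambda>n. real (nat \<lfloor>real n * x\<rfloor>) / real n \<le> x) sequentially"
    using eventually_gt_at_top[of 0]
  proof eventually_elim
    case (elim n)
    have "real (nat \<lfloor>real n * x\<rfloor>) \<le> real n * x" using assms by (simp add: of_nat_floor)
    with elim show ?case by (simp add: field_simps)
  qed
  have "(\<lambda>n. x - 1 / real n) \<longlonglongrightarrow> x - 0" by (intro tendsto_intros lim_1_over_n)
  then show "(\<lambda>n. x - 1 / real n) \<longlonglongrightarrow> x" by simp
qed simp

text \<open>The summands are homogeneous of degree 0 in \<open>c\<close>, so integral plans give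
  rational ones, and rounding n c down gives real ones in the limit. Positivity of \<open>c\<close>
  keeps the limiting marginals away from zero, where the quotient is continuous.\<close>

lemma plan_inequality:
  fixes c :: "nat \<Rightarrow> nat \<Rightarrow> real"
  assumes C: "0 \<le> C" "cb_norm compact_ops op_norms S1_norms (schur_multiplier \<phi>) \<le> ennreal C"
    and c: "\<And>i j. 0 < c i j"
  shows "(\<Sum>i<N. \<Sum>j<N. cmod (\<phi> i j) * (c i j / sqrt ((\<Sum>j<N. c i j) * (\<Sum>i<N. c i j)))) \<le> C"
proof (cases "N = 0")
  case False
  define d where "d n i j = nat \<lfloor>real n * c i j\<rfloor>" for n i j
  define q where "q n i j = real (d n i j) / real n" for n i j
  have q: "(\<lambda>n. q n i j) \<longlonglongrightarrow> c i j" for i j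
    unfolding q_def d_def by (rule floor_scaling_tendsto) (use c[of i j] in simp)
  have pos: "0 < (\<Sum>j<N. c i j)" "0 < (\<Sum>i<N. c i j)" for i j
    using False by (auto intro!: sum_pos c)
  show ?thesis
  proof (rule LIMSEQ_le_const2)
    show "(\<lambda>n. \<Sum>i<N. \<Sum>j<N. cmod (\<phi> i j) * (q n i j / sqrt ((\<Sum>j<N. q n i j) * (\<Sum>i<N. q n i j)))) \<longlonglongrightarrow>
        (\<Sum>i<N. \<Sum>j<N. cmod (\<phi> i j) * (c i j / sqrt ((\<Sum>j<N. c i j) * (\<Sum>i<N. c i j))))"
      by (intro tendsto_intros q) (use pos in \<open>simp add: less_imp_neq[symmetric]\<close>)
    have "(\<Sum>i<N. \<Sum>j<N. cmod (\<phi> i j) * (q n i j / sqrt ((\<Sum>j<N. q n i j) * (\<Sum>i<N. q n i j)))) \<le> C" if "n \<ge> 1" for n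
    proof -
      have "q n i j / sqrt ((\<Sum>j<N. q n i j) * (\<Sum>i<N. q n i j))
          = real (d n i j) / sqrt (real (\<Sum>j<N. d n i j) * real (\<Sum>i<N. d n i j))" for i j
      proof -
        have "(\<Sum>j<N. q n i j) * (\<Sum>i<N. q n i j) = (real (\<Sum>j<N. d n i j) * real (\<Sum>i<N. d n i j)) / (real n)\<^sup>2"
          by (simp add: q_def power2_eq_square flip: sum_divide_distrib)
        then have "sqrt ((\<Sum>j<N. q n i j) * (\<Sum>i<N. q n i j)) = sqrt (real (\<Sum>j<N. d n i j) * real (\<Sum>i<N. d n i j)) / real n"
          by (simp only: real_sqrt_divide real_sqrt_abs abs_of_nat)
        then show ?thesis using that by (simp add: q_def)
      qed
      then show ?thesis using integral_plan_inequality[OF C, where N = N and c = "d n"] by simp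
    qed
    then show "\<exists>n0. \<forall>n\<ge>n0. (\<Sum>i<N. \<Sum>j<N. cmod (\<phi> i j) * (q n i j / sqrt ((\<Sum>j<N. q n i j) * (\<Sum>i<N. q n i j)))) \<le> C"
      by blast
  qed
qed (simp add: C)

subsection \<open>Rank one domination from transport plans\<close>

text \<open>The first order condition 1 = k a / s^(k+1), multiplied by s.\<close>

lemma minimiser_add_inverse_power:
  fixes s a :: real
  assumes s: "0 < s" and min: "\<And>t. 0 < t \<Longrightarrow> s + a / s ^ k \<le> t + a / t ^ k"
  shows "s = real k * (a / s ^ k)"
proof -
  have "((\<lambda>t. t + a / t ^ k) has_real_derivative 1 - a * (real k * s ^ (k - 1)) / (s ^ k * s ^ k)) (at s)"
    using s by (auto intro!: derivative_eq_intros)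
  then have "1 - a * (real k * s ^ (k - 1)) / (s ^ k * s ^ k) = 0"
    by (rule DERIV_local_min[OF _ s]) (use min in auto)
  moreover have "a * (real k * s ^ (k - 1)) / (s ^ k * s ^ k) = real k * (a / s ^ k) / s"
    using s by (cases k) (simp_all add: field_simps)
  ultimately have "real k * (a / s ^ k) / s = 1" by linarith
  then show ?thesis using s by (simp only: divide_eq_1_iff)
qed

text \<open>The power is a smooth stand-in for the constraint \<psi>^2 \<le> f g: for large k it is
  negligible where the quotient stays below 1 and huge where it exceeds 1.\<close>

definition penalty :: "nat \<Rightarrow> nat \<Rightarrow> (nat \<Rightarrow> nat \<Rightarrow> real) \<Rightarrow> (nat \<Rightarrow> real) \<Rightarrow> (nat \<Rightarrow> real) \<Rightarrow> real" where
  "penalty k N \<psi> f g = (\<Sum>i<N. f i) + (\<Sum>j<N. g j) + (\<Sum>i<N. \<Sum>j<N. ((\<psi> i j)\<^sup>2 / (f i * g j)) ^ k)"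

lemma penalty_swap: "penalty k N \<psi> f g = penalty k N (\<lambda>i j. \<psi> j i) g f"
proof -
  have "(\<Sum>i<N. \<Sum>j<N. ((\<psi> i j)\<^sup>2 / (f i * g j)) ^ k) = (\<Sum>j<N. \<Sum>i<N. ((\<psi> i j)\<^sup>2 / (g j * f i)) ^ k)"
    by (subst sum.swap) (simp only: mult.commute)
  then show ?thesis by (simp add: penalty_def)
qed

text \<open>As a function of the single coordinate f i, the functional is t + a / t^k plus a
  constant, and stationarity is the row marginal identity. Minimality is taken in f for fixed g, so
  that exchanging the roles gives the column marginals.\<close>

lemma penalty_stationary:
  assumes f: "\<And>i. 0 < f i" and i: "i < N"
    and min: "\<And>f'. (\<And>i. 0 < f' i) \<Longrightarrow> penalty k N \<psi> f g \<le> penalty k N \<psi> f' g"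
  shows "f i = (\<Sum>j<N. real k * ((\<psi> i j)\<^sup>2 / (f i * g j)) ^ k)"
proof -
  define a where "a = (\<Sum>j<N. ((\<psi> i j)\<^sup>2 / g j) ^ k)"
  define r where "r = (\<Sum>l\<in>{..<N} - {i}. f l) + (\<Sum>j<N. g j) + (\<Sum>l\<in>{..<N} - {i}. \<Sum>j<N. ((\<psi> l j)\<^sup>2 / (f l * g j)) ^ k)"
  have scale: "(\<Sum>j<N. ((\<psi> i j)\<^sup>2 / (t * g j)) ^ k) = a / t ^ k" for t
    by (simp add: a_def sum_divide_distrib power_divide power_mult_distrib mult.commute)
  have eq: "penalty k N \<psi> (f(i := t)) g = t + a / t ^ k + r" for t
  proof -
    have split: "(\<Sum>l<N. F l) = F i + (\<Sum>l\<in>{..<N} - {i}. F l)" for F :: "nat \<Rightarrow> real"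
      using i by (intro sum.remove) auto
    have "(\<Sum>l\<in>{..<N} - {i}. (f(i := t)) l) = (\<Sum>l\<in>{..<N} - {i}. f l)"
      by (intro sum.cong refl) auto
    moreover have "(\<Sum>l\<in>{..<N} - {i}. \<Sum>j<N. ((\<psi> l j)\<^sup>2 / ((f(i := t)) l * g j)) ^ k)
        = (\<Sum>l\<in>{..<N} - {i}. \<Sum>j<N. ((\<psi> l j)\<^sup>2 / (f l * g j)) ^ k)"
      by (intro sum.cong refl) auto
    ultimately show ?thesis
      unfolding penalty_def r_def split[of "f(i := t)"] split[of "\<lambda>l. \<Sum>j<N. ((\<psi> l j)\<^sup>2 / ((f(i := t)) l * g j)) ^ k"]
      by (simp only: fun_upd_same scale)
  qed
  have "f i + a / f i ^ k \<le> t + a / t ^ k" if "0 < t" for t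
    using min[of "f(i := t)"] eq[of t] eq[of "f i"] f that by simp
  from minimiser_add_inverse_power[OF f this]
  show ?thesis by (simp flip: sum_distrib_left scale)
qed

text \<open>Along a minimising sequence the linear terms bound f and g above, and the penalty bounds
  each product f i g j below by a positive multiple of \<psi>^2, so no limit coordinate vanishes.
  Coordinates beyond N do not enter the functional and are set to 1.\<close>

lemma penalty_attains_min:
  assumes \<psi>: "\<And>i j. 0 < \<psi> i j" and N: "0 < N" and k: "0 < k"
  obtains f g where "\<And>i. 0 < f i" "\<And>j. 0 < g j"
    "\<And>f' g'. \<forall>i. 0 < f' i \<Longrightarrow> \<forall>j. 0 < g' j \<Longrightarrow> penalty k N \<psi> f g \<le> penalty k N \<psi> f' g'"
proof -
  define pos where "pos h \<longleftrightarrow> (\<forall>i. 0 < fst (h i) \<and> 0 < snd (h i))" for h :: "nat \<Rightarrow> real \<times> real"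
  define val where "val h = penalty k N \<psi> (\<lambda>i. fst (h i)) (\<lambda>i. snd (h i))" for h :: "nat \<Rightarrow> real \<times> real"
  define S where "S = val ` Collect pos"
  have pen0: "0 \<le> ((\<psi> i j)\<^sup>2 / (fst (h i) * snd (h j))) ^ k" if "pos h" for h i j
    using that unfolding pos_def by (simp add: less_imp_le)
  have parts: "fst (h i) \<le> val h" "snd (h j) \<le> val h" "((\<psi> i j)\<^sup>2 / (fst (h i) * snd (h j))) ^ k \<le> val h"
    if "pos h" "i < N" "j < N" for h i j
  proof -
    have 1: "fst (h i) \<le> (\<Sum>i<N. fst (h i))" "snd (h j) \<le> (\<Sum>i<N. snd (h i))"
      using that unfolding pos_def by (intro member_le_sum; simp add: less_imp_le)+
    have "((\<psi> i j)\<^sup>2 / (fst (h i) * snd (h j))) ^ k \<le> (\<Sum>j<N. ((\<psi> i j)\<^sup>2 / (fst (h i) * snd (h j))) ^ k)"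
      using that by (intro member_le_sum[of j "{..<N}" "\<lambda>j. ((\<psi> i j)\<^sup>2 / (fst (h i) * snd (h j))) ^ k"] pen0) auto
    also have "\<dots> \<le> (\<Sum>i<N. \<Sum>j<N. ((\<psi> i j)\<^sup>2 / (fst (h i) * snd (h j))) ^ k)"
      using that by (intro member_le_sum[of i "{..<N}" "\<lambda>i. \<Sum>j<N. ((\<psi> i j)\<^sup>2 / (fst (h i) * snd (h j))) ^ k"] sum_nonneg pen0) auto
    finally have 2: "((\<psi> i j)\<^sup>2 / (fst (h i) * snd (h j))) ^ k \<le> (\<Sum>i<N. \<Sum>j<N. ((\<psi> i j)\<^sup>2 / (fst (h i) * snd (h j))) ^ k)" .
    have 3: "0 < fst (h i)" "0 < snd (h j)" using that unfolding pos_def by auto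
    show "fst (h i) \<le> val h" "snd (h j) \<le> val h" "((\<psi> i j)\<^sup>2 / (fst (h i) * snd (h j))) ^ k \<le> val h"
      using 1 2 3 pen0[OF that(1), of i j] unfolding val_def penalty_def by linarith+
  qed
  have "pos (\<lambda>_. (1, 1))" by (simp add: pos_def)
  then have ne: "S \<noteq> {}" unfolding S_def by auto
  have "0 \<le> val h" if "pos h" for h
    using parts(1)[OF that N N] that unfolding pos_def by (meson less_imp_le order_trans)
  then have bdd: "bdd_below S" unfolding S_def by (auto intro!: bdd_belowI)
  have "\<exists>h. pos h \<and> val h < Inf S + 1 / real (Suc m)" for m
    using cInf_less_iff[OF ne bdd, of "Inf S + 1 / real (Suc m)"] unfolding S_def by auto
  then have "\<forall>m. \<exists>h. pos h \<and> val h < Inf S + 1 / real (Suc m)" by (rule allI)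
  from choice[OF this] obtain h where h: "\<And>m. pos (h m)" "\<And>m. val (h m) < Inf S + 1 / real (Suc m)"
    by blast
  \<comment> \<open>With B \<ge> 1, the bound x^k \<le> B gives x \<le> B, hence a lower bound for
    the products that is free of k.\<close>
  define B where "B = max 1 (Inf S + 1)"
  have B1: "1 \<le> B" by (simp add: B_def)
  have hB: "val (h m) \<le> B" for m
  proof -
    have "1 / real (Suc m) \<le> 1" by simp
    then show ?thesis using h(2)[of m] unfolding B_def by linarith
  qed
  have ub: "fst (h m i) \<le> B" "snd (h m i) \<le> B" if "i < N" for m i
    using parts(1,2)[OF h(1) that that, of m] hB[of m] by linarith+
  have fg: "(\<psi> i j)\<^sup>2 / B \<le> fst (h m i) * snd (h m j)" if "i < N" "j < N" for m i j
  proof -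
    define x where "x = (\<psi> i j)\<^sup>2 / (fst (h m i) * snd (h m j))"
    have p: "0 < fst (h m i) * snd (h m j)" using h(1)[of m] unfolding pos_def by simp
    have "x ^ k \<le> B" using parts(3)[OF h(1) that, of m] hB[of m] unfolding x_def by linarith
    have "x \<le> B"
    proof (rule ccontr)
      assume "\<not> x \<le> B"
      then have "1 \<le> x" using B1 by linarith
      then have "x \<le> x ^ k" using k by (simp add: self_le_power)
      with \<open>x ^ k \<le> B\<close> \<open>\<not> x \<le> B\<close> show False by linarith
    qed
    then show ?thesis using p B1 unfolding x_def by (simp add: field_simps)
  qed
  define W where "W m i = (if i < N then h m i else (1, 1))" for m i
  have "norm (W m i) \<le> 2 * B" for m i
  proof (cases "i < N")
    case True
    have "0 < fst (h m i)" "0 < snd (h m i)" using h(1)[of m] unfolding pos_def by auto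
    then have "norm (h m i) \<le> fst (h m i) + snd (h m i)"
      using norm_Pair_le[of "fst (h m i)" "snd (h m i)"] by simp
    then show ?thesis using ub[OF True, of m] by (simp add: W_def True)
  next
    case False
    then show ?thesis using norm_Pair_le[of "1::real" "1::real"] B1 by (simp add: W_def)
  qed
  note W = this
  obtain r w where r: "strict_mono (r :: nat \<Rightarrow> nat)" and w: "\<And>i. (\<lambda>m. W (r m) i) \<longlonglongrightarrow> w i"
    by (rule bounded_pointwise_subseq[of W "2 * B", OF W]) (rule that)
  have hw: "(\<lambda>m. fst (h (r m) i)) \<longlonglongrightarrow> fst (w i)" "(\<lambda>m. snd (h (r m) i)) \<longlonglongrightarrow> snd (w i)" if "i < N" for i
    using tendsto_fst[OF w[of i]] tendsto_snd[OF w[of i]] that by (simp_all add: W_def)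
  have nonneg: "0 \<le> fst (w i)" "0 \<le> snd (w i)" if "i < N" for i
    by (rule LIMSEQ_le_const[OF hw(1)[OF that]], use h(1) less_imp_le in \<open>unfold pos_def, blast\<close>)
      (rule LIMSEQ_le_const[OF hw(2)[OF that]], use h(1) less_imp_le in \<open>unfold pos_def, blast\<close>)
  have "(\<psi> i j)\<^sup>2 / B \<le> fst (w i) * snd (w j)" if "i < N" "j < N" for i j
    by (rule LIMSEQ_le_const[OF tendsto_mult[OF hw(1)[OF that(1)] hw(2)[OF that(2)]]]) (use fg that in blast)
  moreover have "0 < (\<psi> i j)\<^sup>2 / B" for i j using \<psi>[of i j] B1 by simp
  ultimately have prod: "0 < fst (w i) * snd (w j)" if "i < N" "j < N" for i j
    using that by (meson less_le_trans)
  have wpos: "0 < fst (w i)" "0 < snd (w i)" if "i < N" for i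
    using prod[OF that that] nonneg[OF that] by (auto simp: zero_less_mult_iff)
  define f where "f i = (if i < N then fst (w i) else 1)" for i
  define g where "g i = (if i < N then snd (w i) else 1)" for i
  have "(\<lambda>m. val (h (r m))) \<longlonglongrightarrow> penalty k N \<psi> f g"
    unfolding val_def penalty_def
    by (intro tendsto_intros) (use wpos hw in \<open>auto simp: f_def g_def less_imp_neq[symmetric]\<close>)
  moreover have "(\<lambda>m. Inf S + 1 / real (Suc (r m))) \<longlonglongrightarrow> Inf S + 0"
    by (intro tendsto_intros LIMSEQ_subseq_LIMSEQ[OF _ r, of "\<lambda>m. 1 / real (Suc m)", unfolded o_def] LIMSEQ_Suc[OF lim_1_over_n])
  ultimately have "penalty k N \<psi> f g \<le> Inf S + 0"
    by (rule LIMSEQ_le) (use h(2) less_imp_le in blast)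
  then have le: "penalty k N \<psi> f g \<le> val h" if "pos h" for h
    using cInf_lower[OF _ bdd, of "val h"] that unfolding S_def by auto
  show thesis
  proof (rule that[of f g])
    show "0 < f i" "0 < g i" for i by (auto simp: f_def g_def wpos)
    show "penalty k N \<psi> f g \<le> penalty k N \<psi> f' g'" if "\<forall>i. 0 < f' i" "\<forall>j. 0 < g' j" for f' g'
      using le[of "\<lambda>i. (f' i, g' i)"] that by (simp add: pos_def val_def)
  qed
qed

text \<open>
  At a minimum of the penalised functional, \<open>c i j = k \<theta>\<^sub>i\<^sub>j\<^sup>k\<close> with
  \<open>\<theta>\<^sub>i\<^sub>j = \<psi>\<^sub>i\<^sub>j\<^sup>2 / (f\<^sub>i g\<^sub>j)\<close> is a transport plan with marginals \<open>f\<close> and \<open>g\<close>, nearly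
  concentrated where \<open>\<theta>\<^sub>i\<^sub>j \<ge> 1/4\<close>. Testing the hypothesis on it bounds its mass.
\<close>

lemma domination_of_plan_inequality:
  fixes \<psi> :: "nat \<Rightarrow> nat \<Rightarrow> real"
  assumes \<psi>: "\<And>i j. 0 < \<psi> i j" and N: "0 < N"
    and plan: "\<And>c. (\<And>i j. 0 < c i j) \<Longrightarrow>
      (\<Sum>i<N. \<Sum>j<N. \<psi> i j * (c i j / sqrt ((\<Sum>j<N. c i j) * (\<Sum>i<N. c i j)))) \<le> C"
  obtains f g where "\<And>i. 0 < f i" "\<And>j. 0 < g j" "(\<Sum>i<N. f i) \<le> 2 * C + 1" "(\<Sum>j<N. g j) \<le> 2 * C + 1"
    "\<forall>i<N. \<forall>j<N. (\<psi> i j)\<^sup>2 \<le> f i * g j"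
proof -
  \<comment> \<open>The summand N * N makes N^2 k / 4^k at most 1, through k \<le> 2^k. The other
    one makes k at least 2 C + 1, so that a single entry with \<theta> > 1 would exceed the total
    mass of the plan.\<close>
  define k where "k = N * N + nat \<lceil>2 * C + 1\<rceil>"
  have k0: "0 < k" using N by (simp add: k_def)
  have kC: "2 * C + 1 \<le> real k" unfolding k_def by linarith
  have kN: "real (N * N) * (real k * (1 / 4) ^ k) \<le> 1"
  proof -
    have "k \<le> 2 ^ k" "N * N \<le> k" using less_exp[of k] by (simp_all add: k_def)
    then have "N * N * k \<le> 2 ^ k * 2 ^ k" by (intro mult_le_mono) linarith+
    also have "(2::nat) ^ k * 2 ^ k = 4 ^ k" by (simp flip: power_mult_distrib)
    finally have "real (N * N * k) \<le> 4 ^ k" by (metis of_nat_le_iff of_nat_numeral of_nat_power)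
    then show ?thesis by (simp add: power_divide divide_le_eq mult_ac)
  qed
  obtain f g where f: "\<And>i. 0 < f i" and g: "\<And>j. 0 < g j"
    and min: "\<And>f' g'. \<forall>i. 0 < f' i \<Longrightarrow> \<forall>j. 0 < g' j \<Longrightarrow> penalty k N \<psi> f g \<le> penalty k N \<psi> f' g'"
    by (rule penalty_attains_min[where \<psi> = \<psi>, OF \<psi> N k0]) (rule that)
  define \<theta> where "\<theta> i j = (\<psi> i j)\<^sup>2 / (f i * g j)" for i j
  define c where "c i j = real k * \<theta> i j ^ k" for i j
  have \<theta>0: "0 < \<theta> i j" for i j unfolding \<theta>_def using \<psi>[of i j] f g by simp
  have c0: "0 < c i j" for i j unfolding c_def using \<theta>0 k0 by simp
  have rows: "(\<Sum>j<N. c i j) = f i" if "i < N" for i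
    unfolding c_def \<theta>_def by (rule penalty_stationary[symmetric, OF f that]) (simp add: min g)
  have cols: "(\<Sum>i<N. c i j) = g j" if "j < N" for j
  proof -
    have "g j = (\<Sum>i<N. real k * ((\<psi> i j)\<^sup>2 / (g j * f i)) ^ k)"
      by (rule penalty_stationary[where \<psi> = "\<lambda>j i. \<psi> i j", OF g that])
        (simp add: penalty_swap[of k N "\<lambda>j i. \<psi> i j"] min f)
    then show ?thesis by (simp add: c_def \<theta>_def mult.commute)
  qed
  define S where "S = (\<Sum>i<N. \<Sum>j<N. c i j)"
  have Sf: "(\<Sum>i<N. f i) = S" unfolding S_def by (intro sum.cong refl) (simp add: rows)
  have Sg: "(\<Sum>j<N. g j) = S" unfolding S_def by (subst sum.swap, intro sum.cong refl) (simp add: cols)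
  \<comment> \<open>Since the marginals of \<open>c\<close> are f and g, the factor \<psi> / sqrt (f
    g) is sqrt \<theta>.\<close>
  have "(\<Sum>i<N. \<Sum>j<N. c i j * sqrt (\<theta> i j)) = (\<Sum>i<N. \<Sum>j<N. \<psi> i j * (c i j / sqrt ((\<Sum>j<N. c i j) * (\<Sum>i<N. c i j))))"
    using \<psi> by (intro sum.cong refl) (simp add: rows cols \<theta>_def real_sqrt_divide less_imp_le)
  also have "\<dots> \<le> C" by (rule plan[OF c0])
  finally have le: "(\<Sum>i<N. \<Sum>j<N. c i j * sqrt (\<theta> i j)) \<le> C" .
  \<comment> \<open>Above the threshold 1/4 the root of \<theta> is at least 1/2; below it the whole
    entry is at most k / 4^k.\<close>
  have "c i j \<le> 2 * (c i j * sqrt (\<theta> i j)) + real k * (1 / 4) ^ k" for i j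
  proof (cases "\<theta> i j \<ge> 1 / 4")
    case True
    then have "sqrt ((1 / 2)\<^sup>2) \<le> sqrt (\<theta> i j)" by (simp add: power2_eq_square)
    then have "1 / 2 \<le> sqrt (\<theta> i j)" by (simp only: real_sqrt_abs)
    then have "c i j * (1 / 2) \<le> c i j * sqrt (\<theta> i j)" using c0[of i j] by (intro mult_left_mono) auto
    moreover have "0 \<le> real k * (1 / 4) ^ k" by simp
    ultimately show ?thesis by linarith
  next
    case False
    then have "c i j \<le> real k * (1 / 4) ^ k"
      unfolding c_def using \<theta>0[of i j] by (intro mult_left_mono power_mono) auto
    moreover have "0 \<le> c i j * sqrt (\<theta> i j)" using c0[of i j] \<theta>0[of i j] by simp
    ultimately show ?thesis by linarith
  qed
  then have "S \<le> (\<Sum>i<N. \<Sum>j<N. 2 * (c i j * sqrt (\<theta> i j)) + real k * (1 / 4) ^ k)"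
    unfolding S_def by (intro sum_mono)
  also have "\<dots> = 2 * (\<Sum>i<N. \<Sum>j<N. c i j * sqrt (\<theta> i j)) + real (N * N) * (real k * (1 / 4) ^ k)"
    by (simp add: sum.distrib flip: sum_distrib_left)
  also have "\<dots> \<le> 2 * C + 1" using le kN by linarith
  finally have S: "S \<le> 2 * C + 1" .
  have "(\<psi> i j)\<^sup>2 \<le> f i * g j" if "i < N" "j < N" for i j
  proof (rule ccontr)
    assume "\<not> ?thesis"
    then have "1 < \<theta> i j" unfolding \<theta>_def using f[of i] g[of j] by (simp add: less_divide_eq)
    then have "1 < \<theta> i j ^ k" using k0 by (simp add: one_less_power)
    then have "real k < c i j" unfolding c_def using k0 by simp
    also have "c i j \<le> (\<Sum>j<N. c i j)" using that c0 by (intro member_le_sum) (auto intro: less_imp_le)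
    also have "\<dots> \<le> S" unfolding S_def
      using that c0 by (intro member_le_sum[of i "{..<N}" "\<lambda>i. \<Sum>j<N. c i j"] sum_nonneg) (auto intro: less_imp_le)
    finally show False using S kC by linarith
  qed
  with f g S show thesis by (intro that[of f g]) (simp_all add: Sf Sg)
qed

text \<open>The penalised problem takes strictly positive data, so \<delta> is added to |\<phi>|. An
  entry is no larger than either of its marginals, so each quotient in the plan inequality is at
  most 1 and \<delta> = 1 / N^2 costs at most 1. The constant C + 1 then gives 2 (C + 1) + 1 = 2 C +
  3, independent of N.\<close>

lemma completely_bounded_sections:
  assumes C: "0 \<le> C" "cb_norm compact_ops op_norms S1_norms (schur_multiplier \<phi>) \<le> ennreal C"
  shows "\<exists>f g. (\<forall>i<N. 0 \<le> f i) \<and> (\<forall>j<N. 0 \<le> g j) \<and> (\<Sum>i<N. f i) \<le> 2 * C + 3 \<and> (\<Sum>j<N. g j) \<le> 2 * C + 3 \<and>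
      (\<forall>i<N. \<forall>j<N. (cmod (\<phi> i j))\<^sup>2 \<le> f i * g j)"
proof (cases "N = 0")
  case True
  then show ?thesis using C(1) by simp
next
  case False
  then have N: "0 < N" by simp
  define \<delta> where "\<delta> = 1 / real (N * N)"
  have \<delta>: "0 < \<delta>" using N by (simp add: \<delta>_def)
  define \<psi> where "\<psi> i j = cmod (\<phi> i j) + \<delta>" for i j
  have \<psi>: "0 < \<psi> i j" for i j using \<delta> by (simp add: \<psi>_def add_nonneg_pos)
  have plan: "(\<Sum>i<N. \<Sum>j<N. \<psi> i j * (c i j / sqrt ((\<Sum>j<N. c i j) * (\<Sum>i<N. c i j)))) \<le> C + 1"
    if c: "\<And>i j. 0 < c i j" for c
  proof -
    define q where "q i j = c i j / sqrt ((\<Sum>j<N. c i j) * (\<Sum>i<N. c i j))" for i j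
    have q1: "q i j \<le> 1" if "i < N" "j < N" for i j
    proof -
      have "c i j \<le> (\<Sum>j<N. c i j)" "c i j \<le> (\<Sum>i<N. c i j)"
        using that c member_le_sum[of j "{..<N}" "c i"] member_le_sum[of i "{..<N}" "\<lambda>i. c i j"]
        by (simp_all add: less_imp_le)
      then have "(c i j)\<^sup>2 \<le> (\<Sum>j<N. c i j) * (\<Sum>i<N. c i j)"
        unfolding power2_eq_square using c[of i j] by (intro mult_mono) auto
      then have "c i j \<le> sqrt ((\<Sum>j<N. c i j) * (\<Sum>i<N. c i j))" by (rule real_le_rsqrt)
      moreover from this have "0 < sqrt ((\<Sum>j<N. c i j) * (\<Sum>i<N. c i j))" using c[of i j] by linarith
      ultimately show ?thesis unfolding q_def by (simp only: divide_le_eq_1_pos)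
    qed
    have "(\<Sum>i<N. \<Sum>j<N. \<psi> i j * q i j) = (\<Sum>i<N. \<Sum>j<N. cmod (\<phi> i j) * q i j) + \<delta> * (\<Sum>i<N. \<Sum>j<N. q i j)"
      by (simp add: \<psi>_def distrib_right sum.distrib sum_distrib_left)
    also have "(\<Sum>i<N. \<Sum>j<N. cmod (\<phi> i j) * q i j) \<le> C"
      unfolding q_def by (rule plan_inequality[OF C c])
    also have "(\<Sum>i<N. \<Sum>j<N. q i j) \<le> (\<Sum>i<N. \<Sum>j<N. 1)" by (intro sum_mono q1) auto
    also have "\<delta> * (\<Sum>i<N. \<Sum>j<N. 1) = 1" using N by (simp add: \<delta>_def)
    finally show ?thesis using \<delta> by (simp add: q_def)
  qed
  obtain f g where f: "\<And>i. 0 < f i" and g: "\<And>j. 0 < g j"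
    and sums: "(\<Sum>i<N. f i) \<le> 2 * (C + 1) + 1" "(\<Sum>j<N. g j) \<le> 2 * (C + 1) + 1"
    and dom: "\<forall>i<N. \<forall>j<N. (\<psi> i j)\<^sup>2 \<le> f i * g j"
    by (rule domination_of_plan_inequality[where \<psi> = \<psi>, OF \<psi> N plan]) (blast, rule that)
  have "(cmod (\<phi> i j))\<^sup>2 \<le> f i * g j" if "i < N" "j < N" for i j
  proof -
    have "(cmod (\<phi> i j))\<^sup>2 \<le> (\<psi> i j)\<^sup>2" using \<delta> by (intro power_mono) (simp_all add: \<psi>_def)
    moreover have "(\<psi> i j)\<^sup>2 \<le> f i * g j" using dom that by blast
    ultimately show ?thesis by linarith
  qed
  then show ?thesis using f g sums
    by (intro exI[of _ f] exI[of _ g]) (auto intro: less_imp_le)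
qed

theorem theorem4p2:
  fixes \<phi> :: "nat \<Rightarrow> nat \<Rightarrow> complex"
  shows
    "(completely_bounded compact_ops op_norms trace_class S1_norms (schur_multiplier \<phi>) \<longleftrightarrow>
        completely_bounded bounded_ops op_norms trace_class S1_norms (schur_multiplier \<phi>)) \<and>
     (completely_bounded compact_ops op_norms trace_class S1_norms (schur_multiplier \<phi>) \<longleftrightarrow>
        (\<exists>x\<in>ell2. \<exists>y\<in>ell2. \<exists>C::real. \<forall>i j. cmod (\<phi> i j) \<le> C * cmod (x i) * cmod (y j))) \<and>
     (completely_bounded compact_ops op_norms trace_class S1_norms (schur_multiplier \<phi>) \<longleftrightarrow>
        (\<exists>T\<in>trace_class. \<exists>C::real. \<forall>i j. cmod (\<phi> i j) \<le> C * cmod (T i j)))"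
proof -
  let ?i = "completely_bounded compact_ops op_norms trace_class S1_norms (schur_multiplier \<phi>)"
  let ?i' = "completely_bounded bounded_ops op_norms trace_class S1_norms (schur_multiplier \<phi>)"
  let ?ii = "\<exists>x\<in>ell2. \<exists>y\<in>ell2. \<exists>C::real. \<forall>i j. cmod (\<phi> i j) \<le> C * cmod (x i) * cmod (y j)"
  let ?iii = "\<exists>T\<in>trace_class. \<exists>C::real. \<forall>i j. cmod (\<phi> i j) \<le> C * cmod (T i j)"
  have "?i" if ?i'
  proof -
    have sub: "compact_ops \<subseteq> bounded_ops" by (auto simp: compact_ops_def)
    have "cb_norm compact_ops op_norms S1_norms (schur_multiplier \<phi>)
        \<le> cb_norm bounded_ops op_norms S1_norms (schur_multiplier \<phi>)"
      unfolding cb_norm_def by (intro SUP_mono' SUP_subset_mono) (use sub in auto)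
    also have "\<dots> < \<infinity>" using that by (simp add: completely_bounded_def)
    finally have "cb_norm compact_ops op_norms S1_norms (schur_multiplier \<phi>) < \<infinity>" .
    moreover have "schur_multiplier \<phi> a \<in> trace_class" if "a \<in> compact_ops" for a
      using that \<open>?i'\<close> sub by (auto simp: completely_bounded_def)
    ultimately show ?thesis
      by (simp add: completely_bounded_def schur_multiplier_def fun_eq_iff algebra_simps)
  qed
  moreover have "?ii" if ?i
  proof -
    have "cb_norm compact_ops op_norms S1_norms (schur_multiplier \<phi>) < \<infinity>"
      using that by (simp add: completely_bounded_def)
    then obtain C where C: "0 \<le> C" "cb_norm compact_ops op_norms S1_norms (schur_multiplier \<phi>) = ennreal C"
      by (cases "cb_norm compact_ops op_norms S1_norms (schur_multiplier \<phi>)") auto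
    obtain x y where xy: "x \<in> ell2" "y \<in> ell2" "\<And>i j. cmod (\<phi> i j) \<le> cmod (x i) * cmod (y j)"
      by (rule rank_one_domination_of_sections[of "\<lambda>i j. cmod (\<phi> i j)" "2 * C + 3"])
        (simp, rule completely_bounded_sections[OF C(1) eq_refl[OF C(2)]], rule that)
    then show ?thesis by (intro bexI[of _ x] bexI[of _ y] exI[of _ 1]) simp_all
  qed
  moreover have "?i'" if ii: ?ii
  proof -
    obtain x y C where x: "x \<in> ell2" and y: "y \<in> ell2" and le: "\<forall>i j. cmod (\<phi> i j) \<le> C * cmod (x i) * cmod (y j)"
      using ii by blast
    \<comment> \<open>C is an arbitrary real, so its absolute value is moved into the first weight,
      which makes C^2 appear in the bound for its squares.\<close>
    have "cmod (\<phi> i j) \<le> (\<bar>C\<bar> * cmod (x i)) * cmod (y j)" for i j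
      by (rule order_trans[OF le[rule_format]]) (intro mult_right_mono, auto)
    then interpret dominated_multiplier \<phi> "\<lambda>i. \<bar>C\<bar> * cmod (x i)" "\<lambda>j. cmod (y j)"
      "C\<^sup>2 * (ell2_norm x)\<^sup>2" "(ell2_norm y)\<^sup>2"
      using ell2_sum_le[OF x] ell2_sum_le[OF y]
      by unfold_locales (auto simp: power_mult_distrib mult_left_mono simp flip: sum_distrib_left)
    show ?thesis by (rule completely_bounded_on_bounded_ops)
  qed
  moreover have "?iii" if ii: ?ii
  proof -
    obtain x y C where x: "x \<in> ell2" and y: "y \<in> ell2" and le: "\<forall>i j. cmod (\<phi> i j) \<le> C * cmod (x i) * cmod (y j)"
      using ii by blast
    then show ?thesis
      by (intro bexI[OF _ rank_one_trace_class[OF x y]] exI[of _ C]) (simp add: norm_mult mult.assoc)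
  qed
  moreover have "?ii" if iii: ?iii
  proof -
    obtain T C where T: "T \<in> trace_class" and le: "\<forall>i j. cmod (\<phi> i j) \<le> C * cmod (T i j)"
      using iii by blast
    obtain K where K: "\<And>n. \<exists>f g. (\<forall>i<n. 0 \<le> f i) \<and> (\<forall>j<n. 0 \<le> g j) \<and> (\<Sum>i<n. f i) \<le> K \<and> (\<Sum>j<n. g j) \<le> K \<and>
      (\<forall>i<n. \<forall>j<n. (cmod (T i j))\<^sup>2 \<le> f i * g j)"
      by (rule trace_class_sections[OF T]) (rule that)
    obtain x y where xy: "x \<in> ell2" "y \<in> ell2" "\<And>i j. cmod (T i j) \<le> cmod (x i) * cmod (y j)"
      by (rule rank_one_domination_of_sections[of "\<lambda>i j. cmod (T i j)" K]) (simp, rule K, rule that)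
    have "cmod (\<phi> i j) \<le> \<bar>C\<bar> * cmod (x i) * cmod (y j)" for i j
    proof -
      have "cmod (\<phi> i j) \<le> \<bar>C\<bar> * cmod (T i j)"
        by (rule order_trans[OF le[rule_format]]) (intro mult_right_mono, auto)
      also have "\<dots> \<le> \<bar>C\<bar> * (cmod (x i) * cmod (y j))" by (intro mult_left_mono xy) simp
      finally show ?thesis by (simp add: mult.assoc)
    qed
    then show ?thesis using xy by blast
  qed
  ultimately show ?thesis by blast
qed


end
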